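(* Let $V=\bigoplus_{i\in\mathbb Z/n\mathbb Z}V_i$ be an $n$-colored vector space, $\widetilde V=\bigcup_i V_i$, $K=\prod_i GL(V_i)$, $\mathcal N$ the colored nilpotent cone, and let $\Psi$ be the map from marked colored partitions of signature $\xi(V)$ to $K\backslash(V\times\mathcal N)$ (all defined in the context). 1. The image of $\Psi$ is precisely the set of $K$-orbits in $V\times\mathcal N$ whose elements admit a normal basis. That is, every nonempty fiber of $\Psi$ contains a generalized striped $n$-bipartition. 2. $\Psi$ induces a bijection $\widetilde{\mathcal Q}_{\xi(V)}\to K\backslash(\widetilde V\times\mathcal N)$. That is: (a) If $\mathcal O\in K\backslash(V\times\mathcal N)$, then $\mathcal O\in K\backslash(\widetilde V\times\mathcal N)$ if and only if there is a striped $n$-bipartition $(\lambda,\epsilon,\mu)$ of signature $\xi(V)$ with $\Psi(\lambda,\epsilon,\mu)=\mathcal O$. (b) If $(v,x)\in\widetilde V\times\mathcal N$ and $v\neq 0$, then any two striped $n$-bipartitions mapped by $\Psi$ to the orbit of $(v,x)$ are identical up to permuting rows (i.e. row-equivalent). (c) If $x\in\mathcal N$ and $v=0$, then the striped $n$-bipartitions mapped by $\Psi$ to the orbit of $(0,x)$ are precisely (up to row-equivalence) the $\rho_m(\lambda,\epsilon,0)$, $m\in\mathbb Z/n\mathbb Z$, where $(\lambda,\epsilon)$ is the colored Jordan type of $x$.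
   Context: Fix an integer $n\ge 1$; write $[a]$ for the class of $a\in\mathbb Z$ in $\mathbb Z/n\mathbb Z$. Colored spaces. An $n$-colored vector space is a finite-dimensional vector space $V$ over a field $\mathbb F$ with a decomposition $V=\bigoplus_{i\in\mathbb Z/n\mathbb Z}V_i$ (summands may be $0$). Its signature is $\xi(V):\mathbb Z/n\mathbb Z\to\mathbb Z^{\ge0}$, $\xi_i(V)=\dim V_i$. Put $\widetilde V=\bigcup_iV_i$, $K=\prod_iGL(V_i)\subset GL(V)$, and $\mathcal N=\{x\in\mathrm{End}(V): x\text{ nilpotent},\ xV_i\subset V_{i+[1]}\ \forall i\}$. $K$ acts on $V\times\mathcal N$ by $k\cdot(v,x)=(kv,kxk^{-1})$, preserving $\widetilde V\times\mathcal N$. Colored partitions. A partition is a weakly decreasing $\lambda:\mathbb N=\{1,2,\dots\}\to\mathbb Z^{\ge0}$ that is eventually $0$; $l(\lambda)=\#\{i:\lambda_i>0\}$. A colored partition is $(\lambda,\epsilon)$ with $\lambda$ a partition and $\epsilon:\mathbb N\to\mathbb Z/n\mathbb Z$ taking each value infinitely often; row $i$ is $(\lambda_i,\epsilon_i)$. Its signature is $\xi_m(\lambda,\epsilon)=\#\{(i,j):1\le j\le\lambda_i,\ \epsilon_i+[\lambda_i-j]=m\}$. For a colored partition of signature $\xi(V)$, a colored Jordan basis of type $(\lambda,\epsilon)$ for $x\in\mathcal N$ is a basis $\{v_{i,j}:1\le i\le l(\lambda),1\le j\le\lambda_i\}$ of $V$ with $v_{i,j}\in V_{\epsilon_i+[\lambda_i-j]}$,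 $xv_{i,j}=v_{i,j-1}$ for $j>1$ and $xv_{i,1}=0$. Convention: $v_{i,j}=0$ for $j\le0$. Every $x\in\mathcal N$ has such a basis, and its type $(\lambda,\epsilon)$, the colored Jordan type of $x$, is unique up to permuting rows of equal length. Markings. A marking of $\lambda$ is a function $\mu:\mathbb N\to\mathbb Z$ with $\mu_i\le\lambda_i$ for all $i$; put $\nu=\lambda-\mu$. Then $(\lambda,\epsilon,\mu)$ is a marked colored partition; its signature is $\xi(\lambda,\epsilon)$. It is a striped $n$-bipartition if $\mu_i>-n$ for all $i$, $\mu_j<\mu_i+n$ and $\nu_j<\nu_i+n$ for all $i<j$, and $\epsilon_i+[\nu_i]=\epsilon_j+[\nu_j]$ for all $i,j$. It is a generalized striped $n$-bipartition if $\mu_i>-n$ for all $i$ and, for every pair $i<j$ with $\epsilon_i+[\nu_i]=\epsilon_j+[\nu_j]$, one has $\mu_j<\mu_i+n$ and $\nu_j<\nu_i+n$. Two marked colored partitions are row-equivalent if one is obtained from the other by permuting rows of equal length, along with their colors and marks. Weak equivalence: $(\lambda,\epsilon,\mu)\sim(\alpha,\beta,\gamma)$ if there is a permutation $\sigma$ of $\mathbb N$ with $\alpha=\lambda\circ\sigma$, $\beta=\epsilon\circ\sigma$, and $\gamma_i=\mu_{\sigma(i)}$ whenever $\gamma_i>0$ or $\mu_{\sigma(i)}>0$. $\widetilde{\mathcal Q}_f$ is the set of weak equivalence classes of marked colored partitions of signature $f$ that contain at least one striped $n$-bipartition. For $m\in\mathbb Z/n\mathbb Z$, $\rho_m(\lambda,\epsilon,\mu)=(\lambda,\epsilon,\delta)$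 with $\delta_i=\max\{k\in\mathbb Z:k\le\mu_i,\ \epsilon_i+[\lambda_i-k]=m\}$. The map $\Psi$. For a marked colored partition $(\lambda,\epsilon,\mu)$ of signature $\xi(V)$, choose $x\in\mathcal N$ with a colored Jordan basis $\{v_{i,j}\}$ of type $(\lambda,\epsilon)$; $\Psi(\lambda,\epsilon,\mu)$ is the $K$-orbit of $(v,x)$, $v=\sum_{i=1}^{l(\lambda)}v_{i,\mu_i}$. It is independent of choices and constant on weak equivalence classes. Normal basis. A normal basis for $(v,x)\in V\times\mathcal N$ is a colored Jordan basis $\{v_{i,j}\}$ for $x$ of some type $(\lambda,\epsilon)$ for which there is a marking $\mu$ of $\lambda$ such that $v=\sum_{i=1}^{l(\lambda)}v_{i,\mu_i}$ and $(\lambda,\epsilon,\mu)$ is a generalized striped $n$-bipartition. *)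

theory Defs
  imports Berlekamp_Zassenhaus.Finite_Field
begin

text \<open>
  The integer n is \<open>CARD('n)\<close> for a type \<open>'n\<close> of class \<open>finite\<close>, and the group of integers
  modulo n is the type \<open>'n mod_ring\<close>. For n = 1 this type is only a \<open>comm_ring\<close>, not a
  \<open>comm_ring_1\<close>, so residue classes are written with \<open>of_int_mod_ring\<close> rather than \<open>of_int\<close>.
\<close>

abbreviation res :: "int \<Rightarrow> 'n::finite mod_ring" where
  "res a \<equiv> of_int_mod_ring a"


section \<open>Colored partitions\<close>

text \<open>
  Rows are indexed by \<open>nat\<close> starting at 0, so row i here is row i + 1 when rows are counted
  from 1. Columns are indexed from 1, by integers since they get compared with marks.
\<close>

definition is_partition :: "(nat \<Rightarrow> nat) \<Rightarrow> bool" where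
  "is_partition lam \<longleftrightarrow> antimono lam \<and> (\<forall>\<^sub>F i in sequentially. lam i = 0)"

definition num_rows :: "(nat \<Rightarrow> nat) \<Rightarrow> nat" where
  "num_rows lam = card {i. lam i > 0}"

definition colored_partition :: "(nat \<Rightarrow> nat) \<Rightarrow> (nat \<Rightarrow> 'n::finite mod_ring) \<Rightarrow> bool" where
  "colored_partition lam eps \<longleftrightarrow> is_partition lam \<and> (\<forall>c. infinite {i. eps i = c})"

definition boxes :: "(nat \<Rightarrow> nat) \<Rightarrow> (nat \<times> int) set" where
  "boxes lam = {(i, j). 1 \<le> j \<and> j \<le> int (lam i)}"

definition signature ::
    "(nat \<Rightarrow> nat) \<Rightarrow> (nat \<Rightarrow> 'n::finite mod_ring) \<Rightarrow> 'n mod_ring \<Rightarrow> nat" where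
  "signature lam eps m = card {(i, j) \<in> boxes lam. eps i + res (int (lam i) - j) = m}"


section \<open>Marked colored partitions\<close>

text \<open>A triple of row lengths, row colors and marks.\<close>

type_synonym 'n mcp = "(nat \<Rightarrow> nat) \<times> (nat \<Rightarrow> 'n mod_ring) \<times> (nat \<Rightarrow> int)"

definition marking :: "(nat \<Rightarrow> nat) \<Rightarrow> (nat \<Rightarrow> int) \<Rightarrow> bool" where
  "marking lam mu \<longleftrightarrow> (\<forall>i. mu i \<le> int (lam i))"

definition nu :: "(nat \<Rightarrow> nat) \<Rightarrow> (nat \<Rightarrow> int) \<Rightarrow> nat \<Rightarrow> int" where
  "nu lam mu i = int (lam i) - mu i"

fun marked_colored_partition :: "'n::finite mcp \<Rightarrow> bool" where
  "marked_colored_partition (lam, eps, mu) \<longleftrightarrow> colored_partition lam eps \<and> marking lam mu"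

definition mcps :: "('n::finite mod_ring \<Rightarrow> nat) \<Rightarrow> 'n mcp set" where
  "mcps f = {(lam, eps, mu). marked_colored_partition (lam, eps, mu) \<and> signature lam eps = f}"

fun striped :: "'n::finite mcp \<Rightarrow> bool" where
  "striped (lam, eps, mu) \<longleftrightarrow>
     marked_colored_partition (lam, eps, mu) \<and>
     (\<forall>i. mu i > - int CARD('n)) \<and>
     (\<forall>i j. i < j \<longrightarrow> mu j < mu i + int CARD('n) \<and> nu lam mu j < nu lam mu i + int CARD('n)) \<and>
     (\<forall>i j. eps i + res (nu lam mu i) = eps j + res (nu lam mu j))"

fun generalized_striped :: "'n::finite mcp \<Rightarrow> bool" where
  "generalized_striped (lam, eps, mu) \<longleftrightarrow>
     marked_colored_partition (lam, eps, mu) \<and>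
     (\<forall>i. mu i > - int CARD('n)) \<and>
     (\<forall>i j. i < j \<and> eps i + res (nu lam mu i) = eps j + res (nu lam mu j) \<longrightarrow>
        mu j < mu i + int CARD('n) \<and> nu lam mu j < nu lam mu i + int CARD('n))"

text \<open>
  In both equivalences the permutation need not have finite support: the infinitely many
  rows of length 0 also carry colors and marks.
\<close>

fun row_equivalent :: "'n::finite mcp \<Rightarrow> 'n mcp \<Rightarrow> bool" where
  "row_equivalent (lam, eps, mu) (alpha, beta, gamma) \<longleftrightarrow>
     (\<exists>s. bij s \<and> (\<forall>i. lam (s i) = lam i) \<and>
          alpha = lam \<and> beta = eps \<circ> s \<and> gamma = mu \<circ> s)"

fun weakly_equivalent :: "'n::finite mcp \<Rightarrow> 'n mcp \<Rightarrow> bool" where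
  "weakly_equivalent (lam, eps, mu) (alpha, beta, gamma) \<longleftrightarrow>
     (\<exists>s. bij s \<and> alpha = lam \<circ> s \<and> beta = eps \<circ> s \<and>
          (\<forall>i. gamma i > 0 \<or> mu (s i) > 0 \<longrightarrow> gamma i = mu (s i)))"

definition weak_rel :: "('n::finite mod_ring \<Rightarrow> nat) \<Rightarrow> ('n mcp \<times> 'n mcp) set" where
  "weak_rel f = {(P, Q). P \<in> mcps f \<and> Q \<in> mcps f \<and> weakly_equivalent P Q}"

definition striped_classes :: "('n::finite mod_ring \<Rightarrow> nat) \<Rightarrow> 'n mcp set set" where
  "striped_classes f = {C \<in> mcps f // weak_rel f. \<exists>Q \<in> C. striped Q}"

fun rho :: "'n::finite mod_ring \<Rightarrow> 'n mcp \<Rightarrow> 'n mcp" where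
  "rho m (lam, eps, mu) =
     (lam, eps, \<lambda>i. GREATEST k. k \<le> mu i \<and> eps i + res (int (lam i) - k) = m)"


section \<open>Colored vector spaces\<close>

text \<open>
  The space is the whole type \<open>'v\<close>, finite-dimensional over the field \<open>'f\<close>, and is the
  direct sum of the family \<open>V\<close>.
\<close>

locale colored_space = vector_space scale
  for scale :: "'f::field \<Rightarrow> 'v::ab_group_add \<Rightarrow> 'v" +
  fixes V :: "'n::finite mod_ring \<Rightarrow> 'v set"
  assumes finite_dimensional: "\<exists>B. finite B \<and> span B = UNIV"
    and subspace_V: "subspace (V c)"
    and direct_sum: "\<exists>!u. (\<forall>c. u c \<in> V c) \<and> v = (\<Sum>c\<in>UNIV. u c)"
begin

definition space_signature :: "'n mod_ring \<Rightarrow> nat" where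
  "space_signature c = dim (V c)"

definition homogeneous :: "'v set" where
  "homogeneous = (\<Union>c. V c)"

definition K_group :: "('v \<Rightarrow> 'v) set" where
  "K_group = {k. Vector_Spaces.linear scale scale k \<and> bij k \<and> (\<forall>c. k ` V c = V c)}"

definition nil_cone :: "('v \<Rightarrow> 'v) set" where
  "nil_cone = {x. Vector_Spaces.linear scale scale x \<and> (\<exists>m. x ^^ m = (\<lambda>_. 0)) \<and>
                  (\<forall>c. x ` V c \<subseteq> V (c + res 1))}"

fun K_act :: "('v \<Rightarrow> 'v) \<Rightarrow> 'v \<times> ('v \<Rightarrow> 'v) \<Rightarrow> 'v \<times> ('v \<Rightarrow> 'v)" where
  "K_act k (v, x) = (k v, k \<circ> x \<circ> inv_into UNIV k)"

definition K_orbit :: "'v \<times> ('v \<Rightarrow> 'v) \<Rightarrow> ('v \<times> ('v \<Rightarrow> 'v)) set" where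
  "K_orbit p = (\<lambda>k. K_act k p) ` K_group"

definition K_orbits :: "('v \<times> ('v \<Rightarrow> 'v)) set \<Rightarrow> ('v \<times> ('v \<Rightarrow> 'v)) set set" where
  "K_orbits A = K_orbit ` A"

text \<open>The values of a basis \<open>b\<close> outside \<open>boxes lam\<close> are irrelevant.\<close>

definition colored_jordan_basis ::
    "('v \<Rightarrow> 'v) \<Rightarrow> (nat \<Rightarrow> nat) \<Rightarrow> (nat \<Rightarrow> 'n mod_ring) \<Rightarrow> (nat \<Rightarrow> int \<Rightarrow> 'v) \<Rightarrow> bool" where
  "colored_jordan_basis x lam eps b \<longleftrightarrow>
     colored_partition lam eps \<and> signature lam eps = space_signature \<and>
     inj_on (\<lambda>(i, j). b i j) (boxes lam) \<and>
     independent ((\<lambda>(i, j). b i j) ` boxes lam) \<and>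
     span ((\<lambda>(i, j). b i j) ` boxes lam) = UNIV \<and>
     (\<forall>(i, j) \<in> boxes lam.
        b i j \<in> V (eps i + res (int (lam i) - j)) \<and>
        x (b i j) = (if j > 1 then b i (j - 1) else 0))"

definition colored_jordan_type ::
    "('v \<Rightarrow> 'v) \<Rightarrow> (nat \<Rightarrow> nat) \<Rightarrow> (nat \<Rightarrow> 'n mod_ring) \<Rightarrow> bool" where
  "colored_jordan_type x lam eps \<longleftrightarrow> (\<exists>b. colored_jordan_basis x lam eps b)"

text \<open>The case distinction is the convention that basis vectors in columns \<open>j \<le> 0\<close> are 0.\<close>

definition marked_vector ::
    "(nat \<Rightarrow> nat) \<Rightarrow> (nat \<Rightarrow> int) \<Rightarrow> (nat \<Rightarrow> int \<Rightarrow> 'v) \<Rightarrow> 'v" where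
  "marked_vector lam mu b = (\<Sum>i<num_rows lam. if mu i \<le> 0 then 0 else b i (mu i))"

text \<open>Only meaningful on \<open>mcps space_signature\<close>, where the chosen pair exists.\<close>

fun Psi :: "'n mcp \<Rightarrow> ('v \<times> ('v \<Rightarrow> 'v)) set" where
  "Psi (lam, eps, mu) =
     (let (x, b) = (SOME (x, b). x \<in> nil_cone \<and> colored_jordan_basis x lam eps b)
      in K_orbit (marked_vector lam mu b, x))"

definition normal_basis :: "'v \<times> ('v \<Rightarrow> 'v) \<Rightarrow> (nat \<Rightarrow> int \<Rightarrow> 'v) \<Rightarrow> bool" where
  "normal_basis p b \<longleftrightarrow>
     (\<exists>lam eps mu. colored_jordan_basis (snd p) lam eps b \<and> marking lam mu \<and>
        fst p = marked_vector lam mu b \<and> generalized_striped (lam, eps, mu))"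

definition Psi_induced :: "'n mcp set \<Rightarrow> ('v \<times> ('v \<Rightarrow> 'v)) set" where
  "Psi_induced C = the_elem (Psi ` C)"

end

end

theory Submission
  imports Defs
begin

text \<open>
  A colored Jordan basis is determined by the top vectors \<open>w\<^sub>i\<close> of its rows, and
  \<open>v = \<Sum> x\<^bsup>\<nu>\<^sub>i\<^esup> w\<^sub>i\<close>. If rows s and j have marked vectors of the same color,
  \<open>\<mu>\<^sub>j \<le> \<mu>\<^sub>s\<close> and \<open>\<nu>\<^sub>s \<le> \<nu>\<^sub>j\<close>, then a multiple \<open>x\<^bsup>\<nu>\<^sub>j - \<nu>\<^sub>s\<^esup> w\<^sub>j\<close> can be added to \<open>w\<^sub>s\<close>, so the
  mark of row j can be removed or introduced at will. Hence every mark can be raised to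
  the largest value of its residue class that is dominated by some mark of the same color, and these
  maximal marks satisfy the striped inequalities. A homogeneous v is first brought into the form of a
  marked vector by multiplying each \<open>w\<^sub>i\<close> by a unit of the centralizer of x.

  Conversely, if the marks are striped and all marked vectors have color m, then every image of v
  under an endomorphism of degree 0 commuting with x lies in the span of the \<open>v\<^bsub>j,k\<^esub>\<close> with
  \<open>k \<le> \<mu>\<^sub>j\<close>. Two striped markings describing the same orbit therefore bound each other.
\<close>


section \<open>Residues, partitions and marks\<close>

text \<open>The vector does not see nonpositive marks: a row with \<open>mu i \<le> 0\<close>
  contributes 0. For v \<noteq> 0 a striped marking nevertheless determines these marks, because
  every row must have the color of v. This fixes each mark modulo n, and the inequalities, each with
  slack n, leave a single value. For v = 0 every color remains possible; each one gives a striped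
  marking with values in (-n, 0], and all of these are weakly equivalent. This is why the bijection
  concerns classes and not markings. One construction carries both halves of the proof: the linear
  map taking a Jordan basis to another one of the same type. It shows that \<open>Psi\<close> does
  not depend on the chosen basis, and it supplies the automorphism by which two markings of the same
  vector are compared.\<close>

lemma res_add: "(res (a + b) :: 'n::finite mod_ring) = res a + res b"
  by transfer (simp add: mod_add_eq)

lemma res_zero: "(res 0 :: 'n::finite mod_ring) = 0"
  by transfer simp

lemma res_eq_iff: "(res a :: 'n::finite mod_ring) = res b \<longleftrightarrow> a mod int CARD('n) = b mod int CARD('n)"
  by transfer simp

lemma res_surj: "\<exists>a. (c :: 'n::finite mod_ring) = res a"
  by (metis of_int_mod_ring_to_int_mod_ring)

text \<open>Subsets of \<open>nat\<close> are finite or countably infinite, so fibres of equal size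
  admit bijections, and these glue because fibres are disjoint. The infinite alternative serves the
  rows of length 0, where every color occurs infinitely often.\<close>

lemma ex_bij_comp_if_fibres:
  fixes f g :: "nat \<Rightarrow> 'a"
  assumes fib: "\<And>y. (finite {i. f i = y} \<and> finite {i. g i = y} \<and> card {i. f i = y} = card {i. g i = y})
       \<or> (infinite {i. f i = y} \<and> infinite {i. g i = y})"
  shows "\<exists>s. bij s \<and> g = f \<circ> s"
proof -
  have "\<exists>h. bij_betw h {i. g i = y} {i. f i = y}" for y
  proof (cases "finite {i. f i = y}")
    case True
    then show ?thesis using fib[of y] finite_same_card_bij by metis
  next
    case False
    then have inf: "infinite {i. f i = y}" "infinite {i. g i = y}" using fib[of y] by auto
    obtain p where "bij_betw p (UNIV::nat set) {i. f i = y}"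
      using inf(1) bij_enumerate by blast
    moreover obtain q where "bij_betw q (UNIV::nat set) {i. g i = y}"
      using inf(2) bij_enumerate by blast
    ultimately show ?thesis using bij_betw_trans bij_betw_inv by metis
  qed
  then obtain h where h: "\<And>y. bij_betw (h y) {i. g i = y} {i. f i = y}" by metis
  define s where "s i = h (g i) i" for i
  have fs: "f (s i) = g i" for i using h[of "g i"] by (auto simp: s_def bij_betw_def)
  have "inj s"
  proof (rule injI)
    fix i j assume e: "s i = s j"
    then have "g i = g j" using fs by metis
    then show "i = j" using e h[of "g i"] by (auto simp: s_def bij_betw_def inj_on_def)
  qed
  moreover have "surj s"
  proof -
    have "\<exists>i. j = s i" for j
    proof -
      have "j \<in> h (f j) ` {i. g i = f j}" using h[of "f j"] by (auto simp: bij_betw_def)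
      then obtain x where "j = h (f j) x" "g x = f j" by blast
      then have "j = s x" by (simp add: s_def)
      then show ?thesis ..
    qed
    then show ?thesis by auto
  qed
  ultimately show ?thesis using fs by (auto simp: bij_def fun_eq_iff)
qed

section \<open>Partitions, their level sets and their cells\<close>

lemma finite_rows:
  assumes "is_partition lam"
  shows "finite {i. lam i > 0}"
proof -
  obtain N where "\<forall>i\<ge>N. lam i = 0"
    using assms unfolding is_partition_def eventually_sequentially by blast
  then have "i < N" if "lam i > 0" for i
    using that by (cases "i < N") auto
  then have "{i. lam i > 0} \<subseteq> {..<N}"
    by blast
  then show ?thesis by (rule finite_subset) simp
qed

lemma rows_eq: "is_partition lam \<Longrightarrow> {i. lam i > 0} = {..<num_rows lam}"
proof -
  assume p: "is_partition lam"
  let ?A = "{i. lam i > 0}"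
  have down: "j \<in> ?A" if "i \<in> ?A" "j \<le> i" for i j
    using p that by (auto simp: is_partition_def antimono_def order.strict_trans2)
  have fin: "finite ?A" using finite_rows[OF p] .
  have "\<exists>m. ?A = {..<m}"
  proof (cases "?A = {}")
    case False
    then have "?A = {..<Suc (Max ?A)}"
      using down[OF Max_in[OF fin False]] Max_ge[OF fin] unfolding less_Suc_eq_le lessThan_def by blast
    then show ?thesis by blast
  qed auto
  then show ?thesis unfolding num_rows_def by (metis card_lessThan)
qed

text \<open>A decreasing sequence is recovered from the sizes of its level sets
  \<open>{j. lam j \<ge> a}\<close>, and a permutation preserves these sizes. Hence a permutation
  between two partitions moves rows only among rows of equal length.\<close>

lemma antimono_comp_bij_eq:
  fixes lam :: "nat \<Rightarrow> nat"
  assumes p: "is_partition lam" and q: "is_partition (lam \<circ> s)" and s: "bij s"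
  shows "lam \<circ> s = lam"
proof -
  have ini: "i < card {j. lam' j \<ge> a} \<longleftrightarrow> lam' i \<ge> a" if "is_partition lam'" "a > 0" for lam' i a
  proof -
    \<comment> \<open>Lowering all rows by a - 1 turns the level set at a into the set of nonempty
      rows, which is an initial segment.\<close>
    have "is_partition (\<lambda>i. lam' i - (a - 1))"
      using that(1) unfolding is_partition_def
      by (auto simp: antimono_def diff_le_mono elim: eventually_mono)
    from rows_eq[OF this] have "{i. lam' i - (a - 1) > 0} = {..<num_rows (\<lambda>i. lam' i - (a - 1))}" .
    moreover have "lam' i - (a - 1) > 0 \<longleftrightarrow> a \<le> lam' i" for i
      using that(2) by arith
    ultimately have "{i. a \<le> lam' i} = {..<num_rows (\<lambda>i. lam' i - (a - 1))}" by simp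
    then show ?thesis by (metis card_lessThan lessThan_iff mem_Collect_eq)
  qed
  have cardeq: "card {j. (lam \<circ> s) j \<ge> a} = card {j. lam j \<ge> a}" for a
  proof -
    have "bij_betw s {j. (lam \<circ> s) j \<ge> a} {j. lam j \<ge> a}"
      by (rule bij_betw_byWitness[where f' = "inv_into UNIV s"])
        (use s in \<open>auto simp: bij_is_inj bij_is_surj surj_f_inv_f inv_f_f\<close>)
    then show ?thesis by (rule bij_betw_same_card)
  qed
  have "a \<le> (lam \<circ> s) i \<longleftrightarrow> a \<le> lam i" if "a > 0" for a i
    using ini[OF p that, of i] ini[OF q that, of i] cardeq[of a] by simp
  then have "(lam \<circ> s) i = lam i" for i
    by (metis le_antisym le_refl neq0_conv le_0_eq)
  then show ?thesis by auto
qed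

text \<open>The cell (i, k) is the box of row i in column \<open>lam i - k\<close>, so k counts from the right end.\<close>

definition cells :: "(nat \<Rightarrow> nat) \<Rightarrow> (nat \<times> nat) set" where
  "cells lam = {(i, k). k < lam i}"

lemma finite_cells: "is_partition lam \<Longrightarrow> finite (cells lam)"
proof -
  assume p: "is_partition lam"
  have "cells lam = Sigma {i. lam i > 0} (\<lambda>i. {..<lam i})" by (auto simp: cells_def)
  then show ?thesis using finite_rows[OF p] by simp
qed

lemma bij_cells_boxes: "bij_betw (\<lambda>(i, k). (i, int (lam i) - int k)) (cells lam) (boxes lam)"
  by (rule bij_betw_byWitness[where f' = "\<lambda>(i, j). (i, nat (int (lam i) - j))"])
     (auto simp: cells_def boxes_def)

lemma signature_cells:
  "signature lam eps m = card {(i, k) \<in> cells lam. eps i + res (int k) = m}"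
proof -
  have "bij_betw (\<lambda>(i, k). (i, int (lam i) - int k)) {(i, k) \<in> cells lam. eps i + res (int k) = m}
     {(i, j) \<in> boxes lam. eps i + res (int (lam i) - j) = m}"
    by (rule bij_betw_byWitness[where f' = "\<lambda>(i, j). (i, nat (int (lam i) - j))"])
     (auto simp: cells_def boxes_def)
  from bij_betw_same_card[OF this] show ?thesis unfolding signature_def by simp
qed

text \<open>Jordan strings are constructed without any order on their lengths; this puts them in
  decreasing order. Only the first r rows have to be sorted, the others being empty.\<close>

lemma ex_bij_antimono_comp:
  fixes l :: "nat \<Rightarrow> nat"
  assumes "\<And>i. i \<ge> r \<Longrightarrow> l i = 0"
  shows "\<exists>p. bij p \<and> is_partition (l \<circ> p)"
proof -
  define xs where "xs = rev (sort_key l [0..<r])"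
  have xs: "length xs = r" "distinct xs" "set xs = {..<r}" by (auto simp: xs_def atLeast0LessThan)
  have srt: "l (xs ! j) \<le> l (xs ! i)" if "i \<le> j" "j < r" for i j
  proof -
    have "sorted (map l (sort_key l [0..<r]))" by simp
    then have "l (sort_key l [0..<r] ! (r - Suc j)) \<le> l (sort_key l [0..<r] ! (r - Suc i))"
      using that sorted_nth_mono[of "map l (sort_key l [0..<r])" "r - Suc j" "r - Suc i"] by simp
    then show ?thesis using that by (simp add: xs_def rev_nth)
  qed
  define p where "p i = (if i < r then xs ! i else i)" for i
  have "bij_betw (\<lambda>i. xs ! i) {..<r} {..<r}"
    using bij_betw_nth[OF xs(2)] xs(1,3) by simp
  then have "bij_betw p {..<r} {..<r}"
    by (rule bij_betw_cong[THEN iffD1, rotated]) (simp add: p_def)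
  moreover have "bij_betw p {r..} {r..}"
    by (rule bij_betw_cong[THEN iffD1, of _ id]) (simp_all add: p_def)
  moreover have "{..<r} \<inter> {r..} = ({}::nat set)" "{..<r} \<union> {r..} = (UNIV::nat set)" by auto
  ultimately have bp: "bij p" using bij_betw_combine[of p "{..<r}" "{..<r}" "{r..}" "{r..}"] by simp
  have "antimono (l \<circ> p)"
    unfolding antimono_def using srt assms by (auto simp: p_def)
  moreover have "\<forall>\<^sub>F i in sequentially. (l \<circ> p) i = 0"
    unfolding eventually_sequentially by (rule exI[of _ r]) (simp add: p_def assms)
  ultimately show ?thesis using bp unfolding is_partition_def by blast
qed

section \<open>Residue classes of colors and marks\<close>

lemma infinite_res_fibre: "infinite {i. i \<ge> r \<and> res (int i) = (c :: 'n::finite mod_ring)}"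
proof -
  obtain a where a: "c = res a" using res_surj by blast
  define b where "b = nat (a mod int CARD('n))"
  have "res (int (b + CARD('n) * (r + k))) = c" for k
    unfolding a res_eq_iff b_def by simp
  moreover have ge: "r \<le> b + CARD('n) * (r + k)" for k
  proof -
    have "r \<le> 1 * (r + k)" by simp
    also have "\<dots> \<le> CARD('n) * (r + k)"
      using Suc_leI[OF zero_less_card_finite[where 'a = 'n]] by (intro mult_le_mono1) simp
    also have "\<dots> \<le> b + CARD('n) * (r + k)" by (rule le_add2)
    finally show ?thesis .
  qed
  ultimately have "range (\<lambda>k. b + CARD('n) * (r + k)) \<subseteq> {i. i \<ge> r \<and> res (int i) = c}"
    using ge by blast
  moreover have "infinite (range (\<lambda>k. b + CARD('n) * (r + k)))"
    by (rule range_inj_infinite) (auto simp: inj_def)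
  ultimately show ?thesis using infinite_super by blast
qed

text \<open>Congruent integers differ by a multiple of n, and a multiple of n below n is at most 0.
  This is how the slack n in the striped inequalities disappears once residue classes agree.\<close>

lemma res_eq_imp_le:
  assumes "(res a :: 'n::finite mod_ring) = res b" "a < b + int CARD('n)"
  shows "a \<le> b"
proof -
  have "int CARD('n) dvd a - b" using assms(1) by (simp add: res_eq_iff mod_eq_dvd_iff)
  then obtain q where q: "a - b = int CARD('n) * q" by blast
  have n: "0 < int CARD('n)" by simp
  have "int CARD('n) * q < int CARD('n) * 1" using q assms(2) by linarith
  then have "q < 1" unfolding mult_less_cancel_left_pos[OF n] .
  then have "int CARD('n) * q \<le> 0" using n by (simp add: mult_le_0_iff)
  then show ?thesis using q by simp
qed

lemma greatest_mark:
  fixes c m :: "'n::finite mod_ring" and L y :: int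
  defines "g \<equiv> GREATEST k. k \<le> y \<and> c + res (L - k) = m"
  shows "g \<le> y" "y < g + int CARD('n)" "c + res (L - g) = m"
    "\<And>k. k \<le> y \<Longrightarrow> c + res (L - k) = m \<Longrightarrow> k \<le> g"
proof -
  obtain a where a: "m - c = res a" using res_surj by blast
  \<comment> \<open>The color condition says that L - k is congruent to a, hence y - k to a - L + y.
    So the largest k \<le> y arises by subtracting the remainder from y.\<close>
  define g' where "g' = y - (a - L + y) mod int CARD('n)"
  have n: "0 < int CARD('n)" by simp
  have lo: "g' \<le> y" "y < g' + int CARD('n)" using n by (auto simp: g'_def)
  have "res (L - g') = (res a :: 'n mod_ring)"
  proof -
    have "L - g' = (L - y) + (a - L + y) mod int CARD('n)" by (simp add: g'_def)
    also have "\<dots> mod int CARD('n) = a mod int CARD('n)" unfolding mod_add_right_eq by simp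
    finally show ?thesis unfolding res_eq_iff .
  qed
  then have col: "c + res (L - g') = m" using a by (simp add: algebra_simps)
  have max: "k \<le> g'" if "k \<le> y" "c + res (L - k) = m" for k
  proof -
    have "(res (L - k) :: 'n mod_ring) = res (L - g')" using that(2) col by (metis add_left_cancel)
    then have "(res k :: 'n mod_ring) = res g'"
      by (simp add: res_eq_iff mod_eq_dvd_iff) (simp add: dvd_diff_commute)
    then show ?thesis using res_eq_imp_le that(1) lo(2) by (metis le_less_trans)
  qed
  have "g = g'" unfolding g_def by (rule Greatest_equality) (use lo col max in auto)
  then show "g \<le> y" "y < g + int CARD('n)" "c + res (L - g) = m"
    "\<And>k. k \<le> y \<Longrightarrow> c + res (L - k) = m \<Longrightarrow> k \<le> g"
    using lo col max by auto
qed

text \<open>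
  Comparing rows by length instead of by index makes the condition invariant under permutations of
  rows.
\<close>

definition striped_marks :: "(nat \<Rightarrow> nat) \<Rightarrow> (nat \<Rightarrow> 'n::finite mod_ring) \<Rightarrow> (nat \<Rightarrow> int) \<Rightarrow> bool" where
  "striped_marks lam eps mu \<longleftrightarrow>
     (\<forall>i. mu i > - int CARD('n)) \<and>
     (\<forall>i j. lam j \<le> lam i \<longrightarrow> mu j < mu i + int CARD('n) \<and> nu lam mu j < nu lam mu i + int CARD('n)) \<and>
     (\<forall>i j. eps i + res (nu lam mu i) = eps j + res (nu lam mu j))"

lemma striped_iff:
  "striped (lam, eps, mu) \<longleftrightarrow> marked_colored_partition (lam, eps, mu) \<and> striped_marks lam eps mu"
  (is "?L \<longleftrightarrow> ?R")
proof
  assume L: ?L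
  let ?n = "int CARD('a)"
  have "mu j < mu i + ?n \<and> nu lam mu j < nu lam mu i + ?n" if le: "lam j \<le> lam i" for i j
  proof -
    consider "i < j" | "i = j" | "j < i" by linarith
    then show ?thesis
    proof cases
      \<comment> \<open>Rows of equal length in reversed order: subtracting marks from the common
        length exchanges the \<open>mu\<close> inequality and the \<open>nu\<close> inequality of
        the swapped pair.\<close>
      case 3
      then have "lam i \<le> lam j"
        using L by (simp add: colored_partition_def is_partition_def antimono_def)
      then have "lam i = lam j" using le by simp
      moreover have "mu i < mu j + ?n \<and> nu lam mu i < nu lam mu j + ?n" using L 3 by simp
      ultimately show ?thesis by (simp add: nu_def)
    qed (use L in simp_all)
  qed
  then show ?R using L unfolding striped_marks_def striped.simps by blast
next
  assume R: ?R
  then have "lam j \<le> lam i" if "i < j" for i j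
    using that by (simp add: colored_partition_def is_partition_def antimono_def)
  then show ?L using R unfolding striped_marks_def striped.simps by blast
qed

section \<open>Row permutations and weak equivalence\<close>

lemma striped_marks_reindex:
  assumes "striped_marks lam eps mu"
  shows "striped_marks (lam \<circ> s) (eps \<circ> s) (mu \<circ> s)"
  using assms unfolding striped_marks_def by (simp add: nu_def)

lemma nu_reindex: "nu (lam \<circ> s) (mu \<circ> s) i = nu lam mu (s i)"
  by (simp add: nu_def)

lemma row_equivalent_imp_weakly_equivalent:
  "row_equivalent Q Q' \<Longrightarrow> weakly_equivalent Q Q'"
  by (cases Q; cases Q') (fastforce simp: fun_eq_iff)

text \<open>The clause on marks amounts to corresponding marks being equal or both nonpositive, a
  form in which symmetry and transitivity are visible.\<close>

lemma equiv_weak_rel: "equiv (mcps f) (weak_rel f)"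
proof (rule equivI)
  show "weak_rel f \<subseteq> mcps f \<times> mcps f" by (auto simp: weak_rel_def)
  show "refl_on (mcps f) (weak_rel f)"
    by (auto simp: refl_on_def weak_rel_def intro!: exI[of _ id])
  show "sym (weak_rel f)"
  proof (rule symI)
    fix P Q assume PQ: "(P, Q) \<in> weak_rel f"
    obtain lam eps mu alpha beta gamma where eq: "P = (lam, eps, mu)" "Q = (alpha, beta, gamma)"
      by (metis prod_cases3)
    obtain s where s: "bij s" "alpha = lam \<circ> s" "beta = eps \<circ> s"
      "\<And>i. gamma i > 0 \<or> mu (s i) > 0 \<Longrightarrow> gamma i = mu (s i)"
      using PQ by (auto simp: weak_rel_def eq)
    let ?t = "inv_into UNIV s"
    have t: "s (?t i) = i" for i using s(1) by (simp add: bij_is_surj surj_f_inv_f)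
    have "weakly_equivalent Q P" unfolding eq weakly_equivalent.simps
    proof (intro exI[of _ ?t] conjI allI impI)
      show "bij ?t" using s(1) by (rule bij_imp_bij_inv)
      show "lam = alpha \<circ> ?t" "eps = beta \<circ> ?t" using t by (auto simp: s(2,3))
      show "mu i = gamma (?t i)" if "mu i > 0 \<or> gamma (?t i) > 0" for i
        using s(4)[of "?t i"] that t[of i] by auto
    qed
    then show "(Q, P) \<in> weak_rel f" using PQ by (simp add: weak_rel_def)
  qed
  show "trans (weak_rel f)"
  proof (rule transI)
    fix P Q R assume PQ: "(P, Q) \<in> weak_rel f" and QR: "(Q, R) \<in> weak_rel f"
    obtain lam eps mu alpha beta gamma lam' eps' mu'
      where eq: "P = (lam, eps, mu)" "Q = (alpha, beta, gamma)" "R = (lam', eps', mu')"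
      by (metis prod_cases3)
    obtain s where s: "bij s" "alpha = lam \<circ> s" "beta = eps \<circ> s"
      "\<And>i. gamma i > 0 \<or> mu (s i) > 0 \<Longrightarrow> gamma i = mu (s i)"
      using PQ by (auto simp: weak_rel_def eq)
    obtain t where t: "bij t" "lam' = alpha \<circ> t" "eps' = beta \<circ> t"
      "\<And>i. mu' i > 0 \<or> gamma (t i) > 0 \<Longrightarrow> mu' i = gamma (t i)"
      using QR by (auto simp: weak_rel_def eq)
    have "weakly_equivalent P R" unfolding eq weakly_equivalent.simps
    proof (intro exI[of _ "s \<circ> t"] conjI allI impI)
      show "bij (s \<circ> t)" using s(1) t(1) by (simp add: bij_comp)
      show "lam' = lam \<circ> (s \<circ> t)" "eps' = eps \<circ> (s \<circ> t)" by (auto simp: s(2,3) t(2,3))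
      show "mu' i = mu ((s \<circ> t) i)" if "mu' i > 0 \<or> mu ((s \<circ> t) i) > 0" for i
        using s(4)[of "t i"] t(4)[of i] that by auto
    qed
    then show "(P, R) \<in> weak_rel f" using PQ QR by (simp add: weak_rel_def)
  qed
qed


section \<open>Finite families of vectors\<close>

text \<open>Families are used instead of sets because strings are indexed by cells, and their
  members may coincide or vanish as long as independence has not been shown.\<close>

locale vector_families = vector_space scale
  for scale :: "'a::field \<Rightarrow> 'b::ab_group_add \<Rightarrow> 'b"
begin

definition fam_indep :: "('i \<Rightarrow> 'b) \<Rightarrow> 'i set \<Rightarrow> bool" where
  "fam_indep g I \<longleftrightarrow> (\<forall>f. (\<Sum>a\<in>I. scale (f a) (g a)) = 0 \<longrightarrow> (\<forall>a\<in>I. f a = 0))"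

definition fam_basis :: "('i \<Rightarrow> 'b) \<Rightarrow> 'i set \<Rightarrow> bool" where
  "fam_basis g I \<longleftrightarrow> finite I \<and> fam_indep g I \<and> span (g ` I) = UNIV"

text \<open>Coordinates with respect to a basis. The value 0 outside I makes additivity and
  homogeneity valid at every index.\<close>

definition coef :: "('i \<Rightarrow> 'b) \<Rightarrow> 'i set \<Rightarrow> 'b \<Rightarrow> 'i \<Rightarrow> 'a" where
  "coef g I v = (SOME f. (\<forall>a. a \<notin> I \<longrightarrow> f a = 0) \<and> v = (\<Sum>a\<in>I. scale (f a) (g a)))"

lemma fam_indep_inj:
  assumes "finite I" "fam_indep g I"
  shows "inj_on g I"
proof (rule inj_onI, rule ccontr)
  fix a b assume ab: "a \<in> I" "b \<in> I" "g a = g b" "a \<noteq> b"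
  define f :: "'c \<Rightarrow> 'a" where "f z = (if z = a then 1 else if z = b then - 1 else 0)" for z
  have "(\<Sum>z\<in>I. scale (f z) (g z)) = (\<Sum>z\<in>{a, b}. scale (f z) (g z))"
    using ab assms(1) by (intro sum.mono_neutral_right) (auto simp: f_def)
  also have "\<dots> = 0" using ab by (simp add: f_def)
  finally have "f a = 0" using assms(2) ab(1) unfolding fam_indep_def by blast
  then show False by (simp add: f_def)
qed

lemma fam_indep_iff:
  assumes "finite I"
  shows "fam_indep g I \<longleftrightarrow> inj_on g I \<and> independent (g ` I)"
proof
  assume f: "fam_indep g I"
  then have inj: "inj_on g I" using assms fam_indep_inj by blast
  have "independent (g ` I)"
  proof (rule independent_if_scalars_zero)
    fix u v assume u: "(\<Sum>x\<in>g ` I. scale (u x) x) = 0" and v: "v \<in> g ` I"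
    from u have "(\<Sum>a\<in>I. scale (u (g a)) (g a)) = 0" using inj by (simp add: sum.reindex)
    then have "\<forall>a\<in>I. u (g a) = 0" using f unfolding fam_indep_def by fast
    then show "u v = 0" using v by blast
  qed (use assms in simp)
  then show "inj_on g I \<and> independent (g ` I)" using inj by simp
next
  assume i: "inj_on g I \<and> independent (g ` I)"
  show "fam_indep g I" unfolding fam_indep_def
  proof (intro allI impI ballI)
    fix f a assume f: "(\<Sum>a\<in>I. scale (f a) (g a)) = 0" and a: "a \<in> I"
    define u where "u v = f (inv_into I g v)" for v
    have "(\<Sum>v\<in>g ` I. scale (u v) v) = (\<Sum>a\<in>I. scale (f a) (g a))"
      using i by (simp add: sum.reindex u_def)
    then have "(\<Sum>v\<in>g ` I. scale (u v) v) = 0" using f by simp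
    then have "u (g a) = 0"
      using i a assms dependent_finite[of "g ` I"] by blast
    then show "f a = 0" using i a by (simp add: u_def)
  qed
qed

lemma span_image_coeffs:
  assumes "finite I" "v \<in> span (g ` I)"
  shows "\<exists>f. v = (\<Sum>a\<in>I. scale (f a) (g a))"
  using assms(2)
proof (induction rule: span_induct_alt)
  case base
  have "0 = (\<Sum>a\<in>I. scale (0::'a) (g a))" by simp
  then show ?case by (rule exI[of _ "\<lambda>_. 0"])
next
  case (step c x y)
  then obtain a f where a: "a \<in> I" "x = g a" and f: "y = (\<Sum>a\<in>I. scale (f a) (g a))" by blast
  have "scale c x = (\<Sum>z\<in>I. scale (if z = a then c else 0) (g z))"
    using a assms(1) by (simp add: if_distrib[of "\<lambda>s. scale s _"] sum.delta cong: if_cong)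
  then have "scale c x + y = (\<Sum>z\<in>I. scale ((if z = a then c else 0) + f z) (g z))"
    using f by (simp add: scale_left_distrib sum.distrib)
  then show ?case by (rule exI[of _ "\<lambda>z. (if z = a then c else 0) + f z"])
qed

lemma sum_in_span_image: "(\<Sum>a\<in>I. scale (f a) (g a)) \<in> span (g ` I)"
  by (intro span_sum span_scale span_base) auto

context
  fixes g :: "'i \<Rightarrow> 'b" and I
  assumes basis: "fam_basis g I"
begin

lemma coef_spec: "(\<forall>a. a \<notin> I \<longrightarrow> coef g I v a = 0) \<and> v = (\<Sum>a\<in>I. scale (coef g I v a) (g a))"
proof -
  obtain f where f: "v = (\<Sum>a\<in>I. scale (f a) (g a))"
    using basis span_image_coeffs[of I v g] unfolding fam_basis_def by auto
  have "(\<forall>a. a \<notin> I \<longrightarrow> (if a \<in> I then f a else 0) = 0) \<and>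
     v = (\<Sum>a\<in>I. scale (if a \<in> I then f a else 0) (g a))"
    unfolding f by simp
  then show ?thesis unfolding coef_def by (rule someI[of _ "\<lambda>a. if a \<in> I then f a else 0"])
qed

lemma coef_outside: "a \<notin> I \<Longrightarrow> coef g I v a = 0"
  using coef_spec by blast

lemma coef_expand: "(\<Sum>a\<in>I. scale (coef g I v a) (g a)) = v"
  using coef_spec by metis

lemma coef_unique:
  assumes "v = (\<Sum>a\<in>I. scale (f a) (g a))" "a \<in> I"
  shows "coef g I v a = f a"
proof -
  have "(\<Sum>a\<in>I. scale (coef g I v a - f a) (g a)) = 0"
    using coef_expand[of v] assms(1) by (simp add: scale_left_diff_distrib sum_subtractf)
  then have "coef g I v a - f a = 0"
    using basis assms(2) unfolding fam_basis_def fam_indep_def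
    by (auto dest: spec[of _ "\<lambda>a. coef g I v a - f a"])
  then show ?thesis by simp
qed

lemma coef_add: "coef g I (u + v) a = coef g I u a + coef g I v a"
proof (cases "a \<in> I")
  case True
  have "u + v = (\<Sum>a\<in>I. scale (coef g I u a + coef g I v a) (g a))"
    by (simp add: scale_left_distrib sum.distrib coef_expand)
  from coef_unique[OF this True] show ?thesis .
qed (simp add: coef_outside)

lemma coef_scale: "coef g I (scale c v) a = c * coef g I v a"
proof (cases "a \<in> I")
  case True
  have "scale c v = (\<Sum>a\<in>I. scale (c * coef g I v a) (g a))"
    using coef_expand[of v] by (simp add: scale_sum_right[symmetric] flip: scale_scale)
  from coef_unique[OF this True] show ?thesis .
qed (simp add: coef_outside)

lemma coef_sum: "coef g I (\<Sum>s\<in>S. h s) a = (\<Sum>s\<in>S. coef g I (h s) a)"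
proof (induction S rule: infinite_finite_induct)
  case empty
  then show ?case using coef_scale[of 0 0] by simp
next
  case (infinite S)
  then show ?case using coef_scale[of 0 0] by simp
qed (simp add: coef_add)

lemma coef_basis:
  assumes "b \<in> I"
  shows "coef g I (g b) a = (if a = b then 1 else 0)"
proof (cases "a \<in> I")
  case True
  have "finite I" using basis unfolding fam_basis_def by simp
  then have "g b = (\<Sum>a\<in>I. scale (if a = b then 1 else 0) (g a))"
    using assms by (simp add: if_distrib[of "\<lambda>s. scale s _"] sum.delta cong: if_cong)
  from coef_unique[OF this True] show ?thesis .
qed (use assms in \<open>auto simp: coef_outside\<close>)

lemma linear_extension:
  "Vector_Spaces.linear scale scale (\<lambda>v. \<Sum>a\<in>I. scale (coef g I v a) (h a))"
  unfolding Vector_Spaces.linear_iff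
proof (intro conjI allI vector_space_axioms)
  show "(\<Sum>a\<in>I. scale (coef g I (u + v) a) (h a)) =
      (\<Sum>a\<in>I. scale (coef g I u a) (h a)) + (\<Sum>a\<in>I. scale (coef g I v a) (h a))" for u v
    by (simp only: coef_add scale_left_distrib sum.distrib)
  show "(\<Sum>a\<in>I. scale (coef g I (scale c v) a) (h a)) =
      scale c (\<Sum>a\<in>I. scale (coef g I v a) (h a))" for c v
    by (simp only: coef_scale scale_sum_right scale_scale)
qed

lemma extension_basis: "b \<in> I \<Longrightarrow> (\<Sum>a\<in>I. scale (coef g I (g b) a) (h a)) = h b"
  using basis unfolding fam_basis_def
  by (simp add: coef_basis if_distrib[of "\<lambda>s. scale s _"] sum.delta cong: if_cong)

end

text \<open>The submodule generated by W when the space is regarded as a module over polynomials in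
  x. Replacing Jordan generators by others then only requires expressing the old ones through the
  new.\<close>

definition xspan :: "('b \<Rightarrow> 'b) \<Rightarrow> 'b set \<Rightarrow> 'b set" where
  "xspan x W = span (\<Union>k. (x ^^ k) ` W)"

interpretation vp: vector_space_pair scale scale ..

lemma linear_funpow:
  assumes "Vector_Spaces.linear scale scale x"
  shows "Vector_Spaces.linear scale scale (x ^^ k)"
proof (induction k)
  case 0
  then show ?case using vector_space_axioms by (simp add: Vector_Spaces.linear_iff)
next
  case (Suc k)
  then show ?case using assms by (simp add: Vector_Spaces.linear_iff)
qed

lemma xspan_funpow:
  assumes x: "Vector_Spaces.linear scale scale x" and u: "u \<in> xspan x W"
  shows "(x ^^ j) u \<in> xspan x W"
proof -
  have "(x ^^ j) ` span (\<Union>k. (x ^^ k) ` W) = span ((x ^^ j) ` (\<Union>k. (x ^^ k) ` W))"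
    using vp.linear_span_image[OF linear_funpow[OF x]] by metis
  also have "\<dots> \<subseteq> span (\<Union>k. (x ^^ k) ` W)"
  proof (rule span_mono, rule image_subsetI)
    fix v assume "v \<in> (\<Union>k. (x ^^ k) ` W)"
    then obtain k w where "w \<in> W" "v = (x ^^ k) w" by blast
    then have "(x ^^ j) v = (x ^^ (j + k)) w" by (simp add: funpow_add)
    then show "(x ^^ j) v \<in> (\<Union>k. (x ^^ k) ` W)" using \<open>w \<in> W\<close> by blast
  qed
  finally show ?thesis using u unfolding xspan_def by blast
qed

lemma xspan_subset:
  assumes x: "Vector_Spaces.linear scale scale x" and W: "W \<subseteq> xspan x W'"
  shows "xspan x W \<subseteq> xspan x W'"
  unfolding xspan_def[of x W]
proof (rule span_minimal)
  show "(\<Union>k. (x ^^ k) ` W) \<subseteq> xspan x W'"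
    using xspan_funpow[OF x] W by blast
qed (simp add: xspan_def)

lemma xspan_base: "w \<in> W \<Longrightarrow> w \<in> xspan x W"
  unfolding xspan_def by (rule span_base) (metis UN_I UNIV_I funpow_0 imageI)

lemma subspace_xspan: "subspace (xspan x W)"
  by (simp add: xspan_def)

text \<open>Powers from \<open>lam i\<close> on kill \<open>w i\<close>, so only the cells
  contribute to the generated submodule. For \<open>lam i = 0\<close> the hypothesis reads
  \<open>w i = 0\<close>: empty rows generate nothing.\<close>

lemma span_cells:
  assumes x: "Vector_Spaces.linear scale scale x" and k: "\<And>i. (x ^^ lam i) (w i) = 0"
  shows "span ((\<lambda>(i, k). (x ^^ k) (w i)) ` cells lam) = xspan x (range w)"
proof -
  have z: "(x ^^ k) (w i) = 0" if "k \<ge> lam i" for i k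
  proof -
    have "(x ^^ k) (w i) = (x ^^ (k - lam i)) ((x ^^ lam i) (w i))"
      using that by (simp flip: funpow_add comp_apply[of "x ^^ (k - lam i)" "x ^^ lam i"])
    then show ?thesis using k vp.linear_0[OF linear_funpow[OF x]] by simp
  qed
  have "(\<Union>k. (x ^^ k) ` range w) \<subseteq> span ((\<lambda>(i, k). (x ^^ k) (w i)) ` cells lam)"
  proof clarify
    fix i k
    show "(x ^^ k) (w i) \<in> span ((\<lambda>(i, k). (x ^^ k) (w i)) ` cells lam)"
    proof (cases "k < lam i")
      case True
      then show ?thesis by (intro span_base) (force simp: cells_def)
    next
      case False
      then show ?thesis using z[of i k] by (simp add: span_zero)
    qed
  qed
  moreover have "(\<lambda>(i, k). (x ^^ k) (w i)) ` cells lam \<subseteq> (\<Union>k. (x ^^ k) ` range w)"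
    by auto
  ultimately show ?thesis unfolding xspan_def
    by (metis span_mono span_span subset_antisym)
qed

lemma fam_basisD:
  assumes "fam_basis g I" "(\<Sum>a\<in>I. scale (f a) (g a)) = 0" "a \<in> I"
  shows "f a = 0"
  using assms unfolding fam_basis_def fam_indep_def by auto

lemma fam_basis_reindex:
  assumes "fam_basis g I" "bij_betw h J I"
  shows "fam_basis (g \<circ> h) J"
proof -
  have "finite J" using assms bij_betw_finite unfolding fam_basis_def by blast
  moreover have "(g \<circ> h) ` J = g ` I" using assms(2) by (auto simp: bij_betw_def)
  moreover have "inj_on (g \<circ> h) J"
    using assms fam_indep_iff[of I g] unfolding fam_basis_def bij_betw_def by (metis comp_inj_on)
  ultimately show ?thesis using assms(1) fam_indep_iff[of I g] fam_indep_iff[of J "g \<circ> h"]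
    unfolding fam_basis_def by simp
qed

lemma funpow_eq_0_mono:
  assumes "Vector_Spaces.linear scale scale x" "(x ^^ l) v = 0" "l \<le> k"
  shows "(x ^^ k) v = 0"
proof -
  have "(x ^^ k) v = (x ^^ (k - l)) ((x ^^ l) v)"
    using assms(3) by (metis comp_apply funpow_add le_add_diff_inverse2)
  then show ?thesis using assms(2) vp.linear_0[OF linear_funpow[OF assms(1)]] by simp
qed

end

sublocale colored_space \<subseteq> vector_families ..


section \<open>Colored spaces\<close>

context colored_space
begin

interpretation vp: vector_space_pair scale scale ..

lemma finite_dim_locale: "\<exists>B. finite_dimensional_vector_space scale B"
proof -
  obtain B where B: "finite B" "span B = UNIV" using finite_dimensional by blast
  obtain C where C: "C \<subseteq> B" "independent C" "B \<subseteq> span C"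
    using maximal_independent_subset[of B] by blast
  have "span C = UNIV" using B(2) C(3) by (metis span_mono span_span top.extremum_uniqueI)
  then have "finite_dimensional_vector_space scale C"
    using C B(1) finite_subset by unfold_locales auto
  then show ?thesis ..
qed

lemma graded_unique:
  assumes "\<And>c. u c \<in> V c" "\<And>c. u' c \<in> V c" "(\<Sum>c\<in>UNIV. u c) = (\<Sum>c\<in>UNIV. u' c)"
  shows "u = u'"
  using assms direct_sum[of "\<Sum>c\<in>UNIV. u c"] by blast

text \<open>Grouping the summands by color gives one decomposition of the sum, and the sum itself
  placed in color c gives another; they agree by directness. As 0 has every color, this also splits
  a linear relation between homogeneous vectors into parts of a single color.\<close>

lemma homogeneous_part:
  assumes A: "finite A" and g: "\<And>a. a \<in> A \<Longrightarrow> g a \<in> V (col a)" and c: "(\<Sum>a\<in>A. g a) \<in> V c"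
  shows "(\<Sum>a\<in>{a \<in> A. col a = d}. g a) = (if d = c then \<Sum>a\<in>A. g a else 0)"
proof -
  define u where "u d = (\<Sum>a\<in>{a \<in> A. col a = d}. g a)" for d
  define u' where "u' d = (if d = c then \<Sum>a\<in>A. g a else 0)" for d
  have "u = u'"
  proof (rule graded_unique)
    show "u d \<in> V d" for d unfolding u_def
      by (rule subspace_sum[OF subspace_V]) (use g in auto)
    show "u' d \<in> V d" for d using c subspace_0[OF subspace_V] by (auto simp: u'_def)
    have "(\<Sum>d\<in>UNIV. u d) = (\<Sum>a\<in>A. g a)" unfolding u_def
      by (rule sum.group[OF A]) auto
    also have "\<dots> = (\<Sum>d\<in>UNIV. u' d)" by (simp add: u'_def)
    finally show "(\<Sum>d\<in>UNIV. u d) = (\<Sum>d\<in>UNIV. u' d)" .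
  qed
  then show ?thesis by (metis u_def u'_def)
qed

lemma graded_basis:
  assumes B: "\<And>c. independent (B c)" "\<And>c. span (B c) = V c"
  shows "c \<noteq> d \<Longrightarrow> B c \<inter> B d = {}" "independent (\<Union>c. B c)" "span (\<Union>c. B c) = UNIV"
    "finite (B c)"
proof -
  obtain Bas where "finite_dimensional_vector_space scale Bas" using finite_dim_locale ..
  then interpret fd: finite_dimensional_vector_space scale Bas .
  show fin: "finite (B c)" for c using B(1) fd.finiteI_independent by blast
  have BV: "B c \<subseteq> V c" for c using B(2) span_superset by blast
  have disj: "B c \<inter> B d = {}" if "c \<noteq> d" for c d
  proof (rule ccontr)
    assume "B c \<inter> B d \<noteq> {}"
    then obtain b where b: "b \<in> B c" "b \<in> B d" by blast
    \<comment> \<open>The vector b, assigned the color c, is its own sum and also lies in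
      \<open>V d\<close>; its part of color c is therefore 0.\<close>
    have "(\<Sum>a\<in>{a \<in> {b}. c = c}. a) = (if c = d then \<Sum>a\<in>{b}. a else 0)"
      by (rule homogeneous_part) (use b BV in auto)
    then have "b = 0" using that by simp
    then show False using b B(1) dependent_zero by blast
  qed
  then show "c \<noteq> d \<Longrightarrow> B c \<inter> B d = {}" .
  show "independent (\<Union>c. B c)"
  proof (rule independent_if_scalars_zero)
    show "finite (\<Union>c. B c)" using fin by simp
    fix f b assume f: "(\<Sum>x\<in>(\<Union>c. B c). scale (f x) x) = 0" and "b \<in> (\<Union>c. B c)"
    then obtain c where b: "b \<in> B c" by blast
    define col where "col b = (SOME c. b \<in> B c)" for b
    have col: "b \<in> B (col b)" if "b \<in> B d" for b d
      unfolding col_def using that by (rule someI)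
    have colB: "{b \<in> (\<Union>c. B c). col b = c} = B c" for c
      using col disj by blast
    have "(\<Sum>x\<in>{b \<in> (\<Union>c. B c). col b = c}. scale (f x) x)
       = (if c = c then (\<Sum>x\<in>(\<Union>c. B c). scale (f x) x) else 0)"
    proof (rule homogeneous_part)
      show "finite (\<Union>c. B c)" using fin by simp
      show "scale (f a) a \<in> V (col a)" if "a \<in> (\<Union>c. B c)" for a
        using col BV that by (intro subspace_scale[OF subspace_V]) blast
      show "(\<Sum>x\<in>(\<Union>c. B c). scale (f x) x) \<in> V c" using f subspace_0[OF subspace_V] by simp
    qed
    then have "(\<Sum>x\<in>B c. scale (f x) x) = 0" using f colB by simp
    then show "f b = 0" using B(1)[of c] b dependent_finite[OF fin[of c]] by blast
  qed
  show "span (\<Union>c. B c) = UNIV"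
  proof -
    have "v \<in> span (\<Union>c. B c)" for v
    proof -
      obtain u where u: "\<And>c. u c \<in> V c" "v = (\<Sum>c\<in>UNIV. u c)" using direct_sum[of v] by blast
      have "u c \<in> span (\<Union>c. B c)" for c
        using u(1)[of c] B(2)[of c] span_mono[of "B c" "\<Union>c. B c"] by blast
      then show ?thesis unfolding u(2) by (rule span_sum)
    qed
    then show ?thesis by blast
  qed
qed

lemma ex_graded_basis:
  "\<exists>B. (\<forall>c. independent (B c) \<and> span (B c) = V c \<and> card (B c) = space_signature c)"
proof -
  have "\<exists>B. independent B \<and> span B = V c \<and> card B = space_signature c" for c
  proof -
    obtain B where B: "B \<subseteq> V c" "independent B" "V c \<subseteq> span B" "card B = dim (V c)"
      using basis_exists by blast
    then have "span B = V c" using subspace_V span_minimal by (metis subset_antisym)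
    then show ?thesis using B unfolding space_signature_def by blast
  qed
  then show ?thesis by metis
qed

lemma dim_UNIV_eq: "dim UNIV = (\<Sum>c\<in>UNIV. space_signature c)"
proof -
  obtain B where B: "\<And>c. independent (B c)" "\<And>c. span (B c) = V c" "\<And>c. card (B c) = space_signature c"
    using ex_graded_basis by blast
  have "dim UNIV = card (\<Union>c. B c)"
    using graded_basis(2,3)[OF B(1,2)] by (metis dim_eq_card_independent dim_span)
  also have "\<dots> = (\<Sum>c\<in>UNIV. card (B c))"
    using graded_basis(1,4)[OF B(1,2)] by (intro card_UN_disjoint) auto
  finally show ?thesis using B(3) by simp
qed


subsection \<open>Generators of Jordan strings\<close>

lemma nil_cone_linear: "x \<in> nil_cone \<Longrightarrow> Vector_Spaces.linear scale scale x"
  by (simp add: nil_cone_def)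

lemma nil_cone_funpow_color:
  assumes "x \<in> nil_cone" "v \<in> V c"
  shows "(x ^^ k) v \<in> V (c + res (int k))"
proof (induction k)
  case 0
  then show ?case using assms by (simp add: res_zero)
next
  case (Suc k)
  then have "x ((x ^^ k) v) \<in> V (c + res (int k) + res 1)"
    using assms(1) unfolding nil_cone_def by blast
  then show ?case by (simp add: res_add add.assoc flip: of_nat_Suc) (metis add.commute of_nat_Suc res_add)
qed

lemma coef_color:
  assumes b: "fam_basis g I" and g: "\<And>a. a \<in> I \<Longrightarrow> g a \<in> V (col a)"
    and v: "v \<in> V c" and nz: "coef g I v a \<noteq> 0"
  shows "col a = c"
proof (rule ccontr)
  assume ne: "col a \<noteq> c"
  have a: "a \<in> I" using nz coef_outside[OF b] by blast
  have fin: "finite I" using b unfolding fam_basis_def by simp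
  have "(\<Sum>z\<in>I. scale (if col z = col a then coef g I v z else 0) (g z)) =
     (\<Sum>z\<in>{z \<in> I. col z = col a}. scale (coef g I v z) (g z))"
    using fin by (intro sum.mono_neutral_cong_right) auto
  also have "\<dots> = (if col a = c then \<Sum>z\<in>I. scale (coef g I v z) (g z) else 0)"
    by (rule homogeneous_part)
      (use fin g subspace_scale[OF subspace_V] v coef_expand[OF b] in auto)
  also have "\<dots> = 0" using ne by simp
  finally have "(if col a = col a then coef g I v a else 0) = 0"
    by (rule fam_basisD[OF b]) (rule a)
  then show False using a nz by auto
qed

text \<open>W is spanned by the basis vectors satisfying Q, because its elements have no coordinates
  elsewhere. Color components and kernels of powers of x are both measured this way, by counting
  cells.\<close>

lemma dim_basis_part:
  assumes b: "fam_basis g I" and W: "subspace W"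
    and in_W: "\<And>a. a \<in> I \<Longrightarrow> Q a \<Longrightarrow> g a \<in> W"
    and only: "\<And>v a. v \<in> W \<Longrightarrow> coef g I v a \<noteq> 0 \<Longrightarrow> Q a"
  shows "dim W = card {a \<in> I. Q a}"
proof -
  let ?J = "{a \<in> I. Q a}"
  have fin: "finite I" and ind: "inj_on g I" "independent (g ` I)"
    using b fam_indep_iff[of I g] unfolding fam_basis_def by auto
  have "W \<subseteq> span (g ` ?J)"
  proof
    fix v assume v: "v \<in> W"
    have "v = (\<Sum>a\<in>I. scale (coef g I v a) (g a))" using coef_expand[OF b] by simp
    also have "\<dots> = (\<Sum>a\<in>?J. scale (coef g I v a) (g a))"
      using fin only[OF v] by (intro sum.mono_neutral_right) auto
    also have "\<dots> \<in> span (g ` ?J)" by (rule sum_in_span_image)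
    finally show "v \<in> span (g ` ?J)" .
  qed
  moreover have "g ` ?J \<subseteq> W" using in_W by auto
  moreover have "independent (g ` ?J)" using ind(2) by (rule independent_mono) auto
  ultimately have "card (g ` ?J) = dim W" by (intro basis_card_eq_dim)
  moreover have "inj_on g ?J" using ind(1) by (rule inj_on_subset) auto
  ultimately show ?thesis by (simp add: card_image)
qed

lemma finite_cells_colored: "colored_partition lam eps \<Longrightarrow> finite (cells lam)"
  unfolding colored_partition_def using finite_cells by blast

text \<open>
  The vector \<open>w i\<close> is \<open>v\<^sub>i\<^sub>,\<^sub>j\<close> for \<open>j = lam i\<close>, and \<open>v\<^sub>i\<^sub>,\<^sub>j\<close> is \<open>(x ^^ (lam i - j)) (w i)\<close>. This vanishes for
  \<open>j \<le> 0\<close>, so the convention on nonpositive columns holds automatically. Linear independence is not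
  required because it follows from the signature.
\<close>

definition jordan_gens ::
    "('v \<Rightarrow> 'v) \<Rightarrow> (nat \<Rightarrow> nat) \<Rightarrow> (nat \<Rightarrow> 'n mod_ring) \<Rightarrow> (nat \<Rightarrow> 'v) \<Rightarrow> bool" where
  "jordan_gens x lam eps w \<longleftrightarrow> x \<in> nil_cone \<and> colored_partition lam eps \<and>
     signature lam eps = space_signature \<and> (\<forall>i. w i \<in> V (eps i)) \<and>
     (\<forall>i. (x ^^ lam i) (w i) = 0) \<and> xspan x (range w) = UNIV"

abbreviation chain :: "('v \<Rightarrow> 'v) \<Rightarrow> (nat \<Rightarrow> 'v) \<Rightarrow> nat \<times> nat \<Rightarrow> 'v" where
  "chain x w \<equiv> \<lambda>(i, k). (x ^^ k) (w i)"

lemma jordan_gensD: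
  assumes "jordan_gens x lam eps w"
  shows "x \<in> nil_cone" "Vector_Spaces.linear scale scale x" "colored_partition lam eps" "is_partition lam"
    "signature lam eps = space_signature" "w i \<in> V (eps i)" "(x ^^ lam i) (w i) = 0"
    "xspan x (range w) = UNIV" "finite (cells lam)"
  using assms nil_cone_linear finite_cells_colored
  unfolding jordan_gens_def colored_partition_def by auto

lemma sum_signature:
  fixes eps :: "nat \<Rightarrow> 'n mod_ring"
  assumes "finite (cells lam)"
  shows "(\<Sum>c\<in>UNIV. signature lam eps c) = card (cells lam)"
proof -
  have eq: "{(i, k) \<in> cells lam. eps i + res (int k) = c} = {a \<in> cells lam. (\<lambda>(i, k). eps i + res (int k)) a = c}" for c
    by auto
  have "(\<Sum>c\<in>UNIV. card {a \<in> cells lam. (\<lambda>(i, k). eps i + res (int k)) a = c}) = card (cells lam)"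
    using sum.group[OF assms, of UNIV "\<lambda>(i, k). eps i + res (int k)" "\<lambda>_. 1::nat"] by simp
  then show ?thesis unfolding signature_cells eq .
qed

text \<open>Summing the signature over all colors shows that there are as many cells as the
  dimension, and a spanning family with that many members is a basis.\<close>

lemma jordan_gens_basis:
  assumes "jordan_gens x lam eps w"
  shows "fam_basis (chain x w) (cells lam)"
proof -
  note J = jordan_gensD[OF assms]
  obtain Bas where "finite_dimensional_vector_space scale Bas" using finite_dim_locale ..
  then interpret fd: finite_dimensional_vector_space scale Bas .
  let ?S = "chain x w ` cells lam"
  have sp: "span ?S = UNIV" using span_cells[OF J(2,7)] J(8) by simp
  have d: "card (cells lam) = dim UNIV"
    using sum_signature[OF J(9), of eps] J(5) dim_UNIV_eq by simp
  have "dim UNIV \<le> card ?S" using sp J(9) by (intro dim_le_card) auto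
  then have c: "card ?S = card (cells lam)" using d card_image_le[OF J(9), of "chain x w"] by linarith
  then have "inj_on (chain x w) (cells lam)" using J(9) eq_card_imp_inj_on by blast
  moreover have "independent ?S"
    using fd.card_eq_dim[of ?S UNIV] c d sp J(9) by simp
  ultimately show ?thesis unfolding fam_basis_def using sp J(9) fam_indep_iff by blast
qed

text \<open>On each string x acts as the shift to the next cell, and whatever leaves the row
  vanishes. Different rows never mix.\<close>

lemma coef_funpow:
  assumes x: "Vector_Spaces.linear scale scale x" and b: "fam_basis (chain x w) (cells lam)"
    and z: "\<And>i. (x ^^ lam i) (w i) = 0" and a: "(i, k) \<in> cells lam"
  shows "coef (chain x w) (cells lam) ((x ^^ p) v) (i, k) =
     (if p \<le> k then coef (chain x w) (cells lam) v (i, k - p) else 0)"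
proof -
  let ?c = "coef (chain x w) (cells lam) v"
  have fin: "finite (cells lam)" using b unfolding fam_basis_def by simp
  have "(x ^^ p) v = (x ^^ p) (\<Sum>a\<in>cells lam. scale (?c a) (chain x w a))"
    using coef_expand[OF b] by simp
  also have "\<dots> = (\<Sum>a\<in>cells lam. scale (?c a) ((x ^^ p) (chain x w a)))"
    by (simp add: vp.linear_sum[OF linear_funpow[OF x]] vp.linear_scale[OF linear_funpow[OF x]])
  also have "\<dots> = (\<Sum>(j, l)\<in>cells lam. scale (?c (j, l)) ((x ^^ (p + l)) (w j)))"
    by (intro sum.cong) (auto simp: funpow_add)
  also have "\<dots> = (\<Sum>(j, l)\<in>{(j, l). p + l < lam j}. scale (?c (j, l)) ((x ^^ (p + l)) (w j)))"
  proof (rule sum.mono_neutral_right[OF fin])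
    show "\<forall>a\<in>cells lam - {(j, l). p + l < lam j}. (case a of (j, l) \<Rightarrow> scale (?c (j, l)) ((x ^^ (p + l)) (w j))) = 0"
    proof
      fix a assume a: "a \<in> cells lam - {(j, l). p + l < lam j}"
      obtain j l where jl: "a = (j, l)" by (cases a)
      then have "(x ^^ (p + l)) (w j) = 0" using a funpow_eq_0_mono[OF x z, of j "p + l"] by simp
      then show "(case a of (j, l) \<Rightarrow> scale (?c (j, l)) ((x ^^ (p + l)) (w j))) = 0"
        by (simp add: jl)
    qed
  qed (auto simp: cells_def)
  also have "\<dots> = (\<Sum>(j, l)\<in>{(j, l)\<in>cells lam. p \<le> l}. scale (?c (j, l - p)) ((x ^^ l) (w j)))"
    by (rule sum.reindex_bij_witness[where i = "\<lambda>(j, l). (j, l - p)" and j = "\<lambda>(j, l). (j, p + l)"])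
       (auto simp: cells_def)
  also have "\<dots> = (\<Sum>a\<in>cells lam. scale (case a of (j, l) \<Rightarrow> if p \<le> l then ?c (j, l - p) else 0) (chain x w a))"
    by (rule sum.mono_neutral_cong_left[OF fin]) (auto split: if_splits)
  finally show ?thesis using coef_unique[OF b _ a] by fastforce
qed

lemma dim_ker:
  assumes J: "jordan_gens x lam eps w"
  shows "dim {v \<in> V c. (x ^^ p) v = 0} =
    card {a \<in> cells lam. (\<lambda>(i, k). lam i \<le> k + p \<and> eps i + res (int k) = c) a}"
proof (rule dim_basis_part[OF jordan_gens_basis[OF J]])
  note D = jordan_gensD[OF J] and b = jordan_gens_basis[OF J]
  note lin = linear_funpow[OF D(2)]
  show "subspace {v \<in> V c. (x ^^ p) v = 0}"
    unfolding subspace_def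
    using subspace_0[OF subspace_V] subspace_add[OF subspace_V] subspace_scale[OF subspace_V]
    by (auto simp: vp.linear_0[OF lin] vp.linear_add[OF lin] vp.linear_scale[OF lin])
  have col: "chain x w a \<in> V ((\<lambda>(i, k). eps i + res (int k)) a)" for a
    using nil_cone_funpow_color[OF D(1,6)] by (cases a) auto
  show "chain x w a \<in> {v \<in> V c. (x ^^ p) v = 0}"
    if Q: "(\<lambda>(i, k). lam i \<le> k + p \<and> eps i + res (int k) = c) a" for a
  proof -
    obtain i k where a: "a = (i, k)" by (cases a)
    have "(x ^^ p) ((x ^^ k) (w i)) = (x ^^ (p + k)) (w i)" by (simp add: funpow_add)
    then show ?thesis using col[of a] Q a funpow_eq_0_mono[OF D(2,7), of i "p + k"] by auto
  qed
  show "(\<lambda>(i, k). lam i \<le> k + p \<and> eps i + res (int k) = c) a"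
    if v: "v \<in> {v \<in> V c. (x ^^ p) v = 0}" and nz: "coef (chain x w) (cells lam) v a \<noteq> 0" for v a
  proof -
    obtain i k where a: "a = (i, k)" by (cases a)
    have "eps i + res (int k) = c" using coef_color[OF b col _ nz] v a by auto
    moreover have "lam i \<le> k + p"
    proof (rule ccontr)
      assume n: "\<not> lam i \<le> k + p"
      \<comment> \<open>In a longer row the nonzero coordinate at (i, k) would reappear in
        \<open>(x ^^ p) v\<close> at (i, k + p), although that vector is 0.\<close>
      then have "(i, k + p) \<in> cells lam" by (simp add: cells_def)
      from coef_funpow[OF D(2) b D(7) this, of p v] have "coef (chain x w) (cells lam) v a = coef (chain x w) (cells lam) 0 (i, k + p)"
        using v a by simp
      then show False using nz coef_scale[OF b, of 0 0] by simp
    qed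
    ultimately show ?thesis using a by simp
  qed
qed

text \<open>A basis of homogeneous vectors distributes over the color components, so the signature
  of its shape is forced.\<close>

lemma space_signature_eq:
  assumes x: "x \<in> nil_cone" and w: "\<And>i. w i \<in> V (eps i)" and b: "fam_basis (chain x w) (cells lam)"
  shows "signature lam eps = space_signature"
proof
  fix c
  have col: "chain x w a \<in> V ((\<lambda>(i, k). eps i + res (int k)) a)" for a
    using nil_cone_funpow_color[OF x w] by (cases a) auto
  have "dim (V c) = card {a \<in> cells lam. (\<lambda>(i, k). eps i + res (int k)) a = c}"
  proof (rule dim_basis_part[OF b subspace_V])
    show "chain x w a \<in> V c" if "(\<lambda>(i, k). eps i + res (int k)) a = c" for a
      using col[of a] that by simp
    show "(\<lambda>(i, k). eps i + res (int k)) a = c" if "v \<in> V c" "coef (chain x w) (cells lam) v a \<noteq> 0" for v a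
      using coef_color[OF b col that] .
  qed
  moreover have "{a \<in> cells lam. (\<lambda>(i, k). eps i + res (int k)) a = c} = {(i, k) \<in> cells lam. eps i + res (int k) = c}"
    by auto
  ultimately show "signature lam eps c = space_signature c"
    unfolding signature_cells space_signature_def by simp
qed

text \<open>
  \<open>dim {v \<in> V c. (x ^^ p) v = 0}\<close> counts the boxes of color c in columns \<open>1..p\<close>; hence the first
  difference counts boxes in column l, and the second one rows ending there.
\<close>

lemma card_rows_of_type:
  assumes J: "jordan_gens x lam eps w" and l: "l > 0"
  shows "card {i. lam i = l \<and> eps i = c} =
    (dim {v \<in> V c. (x ^^ l) v = 0} - dim {v \<in> V c. (x ^^ (l - 1)) v = 0}) -
    (dim {v \<in> V (c - res 1). (x ^^ Suc l) v = 0} - dim {v \<in> V (c - res 1). (x ^^ l) v = 0})"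
proof -
  define R where "R p c = {i. lam i \<ge> p \<and> eps i + res (int (lam i) - int p) = c}" for p c
  have finR: "finite (R p c)" if "p > 0" for p c
    by (rule finite_subset[OF _ finite_rows[OF jordan_gensD(4)[OF J]]]) (use that in \<open>auto simp: R_def\<close>)
  define N where "N p c = {a \<in> cells lam. (\<lambda>(i, k). lam i \<le> k + p \<and> eps i + res (int k) = c) a}" for p c
  have finN: "finite (N p c)" for p c using jordan_gensD(9)[OF J] by (simp add: N_def)
  have step: "card (N (Suc p) c) - card (N p c) = card (R (Suc p) c)" for p c
  proof -
    let ?h = "\<lambda>i. (i, lam i - Suc p)"
    have "N (Suc p) c = N p c \<union> ?h ` R (Suc p) c"
    proof (rule Set.set_eqI)
      fix a :: "nat \<times> nat"
      obtain i k where a: "a = (i, k)" by (cases a)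
      have "a \<in> ?h ` R (Suc p) c \<longleftrightarrow> lam i = Suc (k + p) \<and> eps i + res (int k) = c"
        unfolding a R_def image_iff
        by (auto intro!: bexI[of _ i] simp: of_nat_diff algebra_simps)
      then show "a \<in> N (Suc p) c \<longleftrightarrow> a \<in> N p c \<union> ?h ` R (Suc p) c"
        unfolding a N_def by (auto simp: cells_def)
    qed
    moreover have "N p c \<inter> ?h ` R (Suc p) c = {}"
      by (auto simp: N_def R_def)
    moreover have "card (?h ` R (Suc p) c) = card (R (Suc p) c)"
      by (intro card_image inj_onI) simp
    ultimately have "card (N (Suc p) c) = card (N p c) + card (R (Suc p) c)"
      using finN finR by (simp add: card_Un_disjoint)
    then show ?thesis by simp
  qed
  \<comment> \<open>A row with a box of color c in column l either ends there, and then c is the row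
    color, or goes on to column l + 1, where the color is lower by 1.\<close>
  have "R l c = {i. lam i = l \<and> eps i = c} \<union> R (Suc l) (c - res 1)"
  proof (rule Set.set_eqI)
    fix i
    show "i \<in> R l c \<longleftrightarrow> i \<in> {i. lam i = l \<and> eps i = c} \<union> R (Suc l) (c - res 1)"
    proof (cases "lam i \<le> l")
      case True
      then show ?thesis by (auto simp: R_def res_zero)
    next
      case False
      have "res (int (lam i) - int l) = (res (int (lam i) - int (Suc l)) :: 'n mod_ring) + res 1"
        by (simp flip: res_add)
      then show ?thesis using False by (auto simp: R_def algebra_simps)
    qed
  qed
  moreover have "{i. lam i = l \<and> eps i = c} \<inter> R (Suc l) (c - res 1) = {}"
    by (auto simp: R_def)
  moreover have "finite {i. lam i = l \<and> eps i = c}"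
    by (rule finite_subset[OF _ finite_rows[OF jordan_gensD(4)[OF J]]]) (use l in auto)
  ultimately have "card (R l c) = card {i. lam i = l \<and> eps i = c} + card (R (Suc l) (c - res 1))"
    using finR[of "Suc l"] by (simp add: card_Un_disjoint)
  then have "card {i. lam i = l \<and> eps i = c} = card (R l c) - card (R (Suc l) (c - res 1))" by simp
  also have "\<dots> = (card (N l c) - card (N (l - 1) c)) - (card (N (Suc l) (c - res 1)) - card (N l (c - res 1)))"
    using step[of "l - 1" c] step[of l "c - res 1"] l by simp
  finally show ?thesis unfolding dim_ker[OF J] N_def by simp
qed

lemma infinite_zero_rows:
  assumes "colored_partition lam eps"
  shows "infinite {i. lam i = 0 \<and> eps i = c}"
proof
  assume "finite {i. lam i = 0 \<and> eps i = c}"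
  moreover have "finite {i. lam i > 0}" using assms finite_rows unfolding colored_partition_def by blast
  moreover have "{i. eps i = c} \<subseteq> {i. lam i = 0 \<and> eps i = c} \<union> {i. lam i > 0}" by auto
  ultimately have "finite {i. eps i = c}" by (meson finite_UnI finite_subset)
  then show False using assms unfolding colored_partition_def by blast
qed

text \<open>The number of rows of given positive length and color is expressed by dimensions that
  involve only x, and rows of length 0 occur infinitely often in each color for either type. So the
  two sequences of rows have fibres of the same size.\<close>

lemma jordan_type_unique:
  assumes J: "jordan_gens x lam eps w" and J': "jordan_gens x lam' eps' w'"
  shows "lam' = lam \<and> (\<exists>s. bij s \<and> lam \<circ> s = lam \<and> eps' = eps \<circ> s)"
proof -
  have "\<exists>s. bij s \<and> (\<lambda>i. (lam' i, eps' i)) = (\<lambda>i. (lam i, eps i)) \<circ> s"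
  proof (rule ex_bij_comp_if_fibres)
    fix y :: "nat \<times> 'n mod_ring"
    obtain l c where y: "y = (l, c)" by (cases y)
    have eq: "{i. (lam i, eps i) = y} = {i. lam i = l \<and> eps i = c}"
      "{i. (lam' i, eps' i) = y} = {i. lam' i = l \<and> eps' i = c}" by (auto simp: y)
    show "(finite {i. (lam i, eps i) = y} \<and> finite {i. (lam' i, eps' i) = y} \<and> card {i. (lam i, eps i) = y} = card {i. (lam' i, eps' i) = y}) \<or>
      (infinite {i. (lam i, eps i) = y} \<and> infinite {i. (lam' i, eps' i) = y})"
    proof (cases "l > 0")
      case True
      have "finite {i. lam i = l \<and> eps i = c}"
        by (rule finite_subset[OF _ finite_rows[OF jordan_gensD(4)[OF J]]]) (use True in auto)
      moreover have "finite {i. lam' i = l \<and> eps' i = c}"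
        by (rule finite_subset[OF _ finite_rows[OF jordan_gensD(4)[OF J']]]) (use True in auto)
      ultimately show ?thesis unfolding eq
        using card_rows_of_type[OF J True] card_rows_of_type[OF J' True] by simp
    next
      case False
      then show ?thesis unfolding eq
        using infinite_zero_rows[OF jordan_gensD(3)[OF J], of c]
          infinite_zero_rows[OF jordan_gensD(3)[OF J'], of c] by simp
    qed
  qed
  then obtain s where s: "bij s" "\<And>i. lam' i = lam (s i)" "\<And>i. eps' i = eps (s i)"
    by (auto simp: fun_eq_iff)
  have "lam' = lam \<circ> s" using s by auto
  moreover have "lam \<circ> s = lam"
    using antimono_comp_bij_eq[of lam s] s(1) jordan_gensD(4)[OF J] jordan_gensD(4)[OF J'] calculation by simp
  moreover have "eps' = eps \<circ> s" using s(3) by auto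
  ultimately show ?thesis using s(1) by auto
qed


subsection \<open>The orbit attached to a marked colored partition\<close>

lemma linear_eq_on_basis:
  assumes "fam_basis g I" "Vector_Spaces.linear scale scale f" "Vector_Spaces.linear scale scale h"
    and "\<And>a. a \<in> I \<Longrightarrow> f (g a) = h (g a)"
  shows "f v = h v"
  by (rule vp.linear_eq_on[of f h _ "g ` I"]) (use assms in \<open>auto simp: fam_basis_def\<close>)

lemma linear_extension_color:
  assumes b: "fam_basis g I" and g: "\<And>a. a \<in> I \<Longrightarrow> g a \<in> V (col a)"
    and h: "\<And>a. a \<in> I \<Longrightarrow> h a \<in> V (col a + d)" and v: "v \<in> V c"
  shows "(\<Sum>a\<in>I. scale (coef g I v a) (h a)) \<in> V (c + d)"
proof (rule subspace_sum[OF subspace_V])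
  fix a assume a: "a \<in> I"
  show "scale (coef g I v a) (h a) \<in> V (c + d)"
  proof (cases "coef g I v a = 0")
    case True
    then show ?thesis using subspace_0[OF subspace_V] by simp
  next
    case False
    then have "col a = c" using coef_color[OF b g v] by blast
    then show ?thesis using h[OF a] subspace_scale[OF subspace_V] by blast
  qed
qed

lemma chain_color: "jordan_gens x lam eps w \<Longrightarrow> chain x w a \<in> V ((\<lambda>(i, k). eps i + res (int k)) a)"
  using nil_cone_funpow_color jordan_gensD(1,6) by (cases a) auto

lemma chain_eq_0: "jordan_gens x lam eps w \<Longrightarrow> a \<notin> cells lam \<Longrightarrow> chain x w a = 0"
  using funpow_eq_0_mono jordan_gensD(2,7) by (cases a) (fastforce simp: cells_def not_less)

text \<open>Sending one Jordan basis to the other respects colors, since corresponding cells have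
  the same color, and intertwines the operators, since both act as the same shift. For x = x' this
  is an automorphism commuting with x.\<close>

lemma ex_transfer:
  assumes J: "jordan_gens x lam eps w" and J': "jordan_gens x' lam eps w'"
  shows "\<exists>k\<in>K_group. (\<forall>i. k (w i) = w' i) \<and> (\<forall>v. k (x v) = x' (k v))"
proof -
  \<comment> \<open>Both families are parameters, so that exchanging them gives the inverse.\<close>
  define T where "T x w x' w' v = (\<Sum>a\<in>cells lam. scale (coef (chain x w) (cells lam) v a) (chain x' w' a))"
    for x w x' w' v
  have T: "Vector_Spaces.linear scale scale (T x w x' w') \<and> (\<forall>a. T x w x' w' (chain x w a) = chain x' w' a) \<and>
      (\<forall>c. \<forall>v\<in>V c. T x w x' w' v \<in> V c)"
    if J: "jordan_gens x lam eps w" and J': "jordan_gens x' lam eps w'" for x w x' w'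
  proof (intro conjI allI ballI)
    note b = jordan_gens_basis[OF J]
    show lin: "Vector_Spaces.linear scale scale (T x w x' w')"
      unfolding T_def by (rule linear_extension[OF b])
    show "T x w x' w' (chain x w a) = chain x' w' a" for a
    proof (cases "a \<in> cells lam")
      case True
      show ?thesis unfolding T_def by (rule extension_basis[OF b True])
    next
      case False
      then show ?thesis
        using chain_eq_0[OF J False] chain_eq_0[OF J' False] vp.linear_0[OF lin] by simp
    qed
    show "T x w x' w' v \<in> V c" if "v \<in> V c" for c v
    proof -
      have "T x w x' w' v \<in> V (c + 0)" unfolding T_def
        by (rule linear_extension_color[OF b chain_color[OF J]]) (use chain_color[OF J'] that in auto)
      then show ?thesis by simp
    qed
  qed
  have inverse: "T x' w' x w (T x w x' w' v) = v"
    if J: "jordan_gens x lam eps w" and J': "jordan_gens x' lam eps w'" for x w x' w' v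
  proof -
    have "Vector_Spaces.linear scale scale (T x' w' x w \<circ> T x w x' w')"
      using T[OF J J'] T[OF J' J] Vector_Spaces.linear_compose by blast
    from linear_eq_on_basis[OF jordan_gens_basis[OF J] this linear_id]
    show ?thesis using T[OF J J'] T[OF J' J] by simp
  qed
  let ?k = "T x w x' w'" and ?l = "T x' w' x w"
  have "?k \<in> K_group" unfolding K_group_def
  proof (intro CollectI conjI allI)
    show "Vector_Spaces.linear scale scale ?k" using T[OF J J'] by simp
    show "bij ?k"
      by (rule bij_betw_byWitness[where f' = ?l]) (use inverse[OF J J'] inverse[OF J' J] in auto)
    show "?k ` V c = V c" for c
    proof
      show "?k ` V c \<subseteq> V c" using T[OF J J'] by blast
      show "V c \<subseteq> ?k ` V c" using T[OF J' J] inverse[OF J' J] by (metis image_eqI subsetI)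
    qed
  qed
  moreover have "?k (w i) = w' i" for i
  proof -
    have "?k (chain x w (i, 0)) = chain x' w' (i, 0)" using T[OF J J'] by blast
    then show ?thesis by simp
  qed
  moreover have "?k (x v) = x' (?k v)" for v
  proof -
    note lx = jordan_gensD(2)[OF J] and lx' = jordan_gensD(2)[OF J']
    have l1: "Vector_Spaces.linear scale scale (?k \<circ> x)" "Vector_Spaces.linear scale scale (x' \<circ> ?k)"
      using T[OF J J'] lx lx' Vector_Spaces.linear_compose by blast+
    have "(?k \<circ> x) v = (x' \<circ> ?k) v"
    proof (rule linear_eq_on_basis[OF jordan_gens_basis[OF J] l1])
      fix a :: "nat \<times> nat"
      obtain i k where a: "a = (i, k)" by (cases a)
      have "?k (chain x w (i, Suc k)) = chain x' w' (i, Suc k)" "?k (chain x w (i, k)) = chain x' w' (i, k)"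
        using T[OF J J'] by blast+
      then show "(?k \<circ> x) (chain x w a) = (x' \<circ> ?k) (chain x w a)" by (simp add: a)
    qed
    then show ?thesis by simp
  qed
  ultimately show ?thesis by blast
qed

section \<open>The group action and its orbits\<close>

lemma K_id: "id \<in> K_group"
  by (simp add: K_group_def linear_id)

lemma K_comp: "k \<in> K_group \<Longrightarrow> l \<in> K_group \<Longrightarrow> k \<circ> l \<in> K_group"
  unfolding K_group_def using Vector_Spaces.linear_compose bij_comp
  by (smt (verit) image_comp mem_Collect_eq)

lemma K_inv:
  assumes "k \<in> K_group"
  shows "inv_into UNIV k \<in> K_group"
proof -
  obtain Bas where "finite_dimensional_vector_space scale Bas" using finite_dim_locale ..
  then interpret fd: finite_dimensional_vector_space scale Bas .
  have k: "Vector_Spaces.linear scale scale k" "bij k" "\<And>c. k ` V c = V c"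
    using assms unfolding K_group_def by auto
  have "inv_into UNIV k ` V c = V c" for c
    using k(2,3) by (metis bij_is_inj image_inv_f_f)
  then show ?thesis unfolding K_group_def
    using k(2) fd.inj_linear_imp_inv_linear[OF k(1) bij_is_inj[OF k(2)]] bij_imp_bij_inv by auto
qed

lemma K_act_comp: "k \<in> K_group \<Longrightarrow> l \<in> K_group \<Longrightarrow> K_act k (K_act l p) = K_act (k \<circ> l) p"
  by (cases p) (auto simp: K_group_def o_inv_distrib bij_is_inj bij_is_surj comp_assoc)

lemma K_act_id: "K_act id p = p"
  by (cases p) (simp add: inv_id)

lemma K_orbit_self: "p \<in> K_orbit p"
  unfolding K_orbit_def using K_act_id K_id by (metis imageI)

lemma K_orbit_eq:
  assumes "k \<in> K_group"
  shows "K_orbit (K_act k p) = K_orbit p"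
proof -
  have sub: "K_orbit (K_act k p) \<subseteq> K_orbit p" if "k \<in> K_group" for k p
    unfolding K_orbit_def using K_act_comp K_comp that by auto
  have "K_act (inv_into UNIV k) (K_act k p) = p"
    using assms K_inv K_act_comp K_act_id
    by (metis (no_types, lifting) K_group_def bij_is_inj inv_o_cancel mem_Collect_eq)
  then show ?thesis using sub[OF assms, of p] sub[OF K_inv[OF assms], of "K_act k p"] by auto
qed

lemma K_orbit_eq_mem: "q \<in> K_orbit p \<Longrightarrow> K_orbit q = K_orbit p"
  using K_orbit_eq by (metis K_orbit_def imageE)

lemma K_orbit_eqD: "K_orbit q = K_orbit p \<Longrightarrow> \<exists>k\<in>K_group. q = K_act k p"
  using K_orbit_self[of q] unfolding K_orbit_def by auto

text \<open>Under \<open>marking\<close> the exponents \<open>nu\<close> are nonnegative, so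
  \<open>nat\<close> loses nothing. A mark \<le> 0 makes the exponent at least \<open>lam i\<close>,
  so for Jordan generators the summand vanishes without a case distinction.\<close>

definition marked_sum :: "('v \<Rightarrow> 'v) \<Rightarrow> (nat \<Rightarrow> nat) \<Rightarrow> (nat \<Rightarrow> int) \<Rightarrow> (nat \<Rightarrow> 'v) \<Rightarrow> 'v" where
  "marked_sum x lam mu w = (\<Sum>i | lam i > 0. (x ^^ nat (nu lam mu i)) (w i))"

lemma K_conj_funpow:
  assumes "bij k"
  shows "(k \<circ> x \<circ> inv_into UNIV k) ^^ m = k \<circ> (x ^^ m) \<circ> inv_into UNIV k"
proof (induction m)
  case 0
  show ?case using assms by (auto simp: bij_is_surj surj_f_inv_f)
next
  case (Suc m)
  then show ?case using assms by (auto simp: fun_eq_iff bij_is_inj)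
qed

lemma jordan_gens_act:
  assumes k: "k \<in> K_group" and J: "jordan_gens x lam eps w"
  shows "jordan_gens (k \<circ> x \<circ> inv_into UNIV k) lam eps (k \<circ> w)"
    "marked_sum (k \<circ> x \<circ> inv_into UNIV k) lam mu (k \<circ> w) = k (marked_sum x lam mu w)"
proof -
  let ?x = "k \<circ> x \<circ> inv_into UNIV k"
  note D = jordan_gensD[OF J]
  have K: "Vector_Spaces.linear scale scale k" "bij k" "\<And>c. k ` V c = V c"
    using k unfolding K_group_def by auto
  have I: "Vector_Spaces.linear scale scale (inv_into UNIV k)" "\<And>c. inv_into UNIV k ` V c = V c"
    using K_inv[OF k] unfolding K_group_def by auto
  have pow: "(?x ^^ m) (k v) = k ((x ^^ m) v)" for m v
    using K(2) by (simp add: K_conj_funpow bij_is_inj)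
  have xn: "\<exists>m. x ^^ m = (\<lambda>_. 0)" "\<And>c. x ` V c \<subseteq> V (c + res 1)"
    using D(1) unfolding nil_cone_def by auto
  have "?x \<in> nil_cone" unfolding nil_cone_def
  proof (intro CollectI conjI allI)
    show "Vector_Spaces.linear scale scale ?x"
      using K(1) D(2) I(1) Vector_Spaces.linear_compose by blast
    obtain m where "x ^^ m = (\<lambda>_. 0)" using xn(1) ..
    then have "?x ^^ m = (\<lambda>_. 0)"
      using vp.linear_0[OF K(1)] by (simp add: K_conj_funpow[OF K(2)] fun_eq_iff)
    then show "\<exists>m. ?x ^^ m = (\<lambda>_. 0)" ..
    show "?x ` V c \<subseteq> V (c + res 1)" for c
      using K(3) I(2) xn(2) unfolding image_comp[symmetric] by (metis image_mono)
  qed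
  moreover have "xspan ?x (range (k \<circ> w)) = UNIV"
  proof -
    have "(?x ^^ m) \<circ> (k \<circ> w) = k \<circ> (x ^^ m \<circ> w)" for m
      by (rule ext) (simp only: comp_apply pow)
    then have "(\<Union>m. (?x ^^ m) ` range (k \<circ> w)) = k ` (\<Union>m. (x ^^ m) ` range w)"
      by (simp only: image_UN image_comp)
    then have "xspan ?x (range (k \<circ> w)) = k ` xspan x (range w)"
      unfolding xspan_def using vp.linear_span_image[OF K(1)] by simp
    then show ?thesis using D(8) K(2) by (simp add: bij_is_surj)
  qed
  moreover have "(k \<circ> w) i \<in> V (eps i)" for i using D(6) K(3) by auto
  moreover have "(?x ^^ lam i) ((k \<circ> w) i) = 0" for i
    using D(7) pow vp.linear_0[OF K(1)] by simp
  ultimately show "jordan_gens ?x lam eps (k \<circ> w)"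
    using D(3,5) unfolding jordan_gens_def by blast
  show "marked_sum ?x lam mu (k \<circ> w) = k (marked_sum x lam mu w)"
    unfolding marked_sum_def by (simp add: pow vp.linear_sum[OF K(1)])
qed

text \<open>The last box of each row serves as generator. Empty rows get 0, because \<open>b\<close>
  is unconstrained outside the boxes while \<open>jordan_gens\<close> demands a vector killed by
  \<open>x ^^ 0\<close>.\<close>

lemma jordan_basis_imp_gens:
  assumes x: "x \<in> nil_cone" and b: "colored_jordan_basis x lam eps b"
  defines "w \<equiv> \<lambda>i. if lam i = 0 then 0 else b i (int (lam i))"
  shows "jordan_gens x lam eps w" "marking lam mu \<Longrightarrow> marked_vector lam mu b = marked_sum x lam mu w"
proof -
  note lin = nil_cone_linear[OF x]
  have B: "colored_partition lam eps" "signature lam eps = space_signature"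
    "span ((\<lambda>(i, j). b i j) ` boxes lam) = UNIV"
    "\<And>i j. (i, j) \<in> boxes lam \<Longrightarrow> b i j \<in> V (eps i + res (int (lam i) - j))"
    "\<And>i j. (i, j) \<in> boxes lam \<Longrightarrow> x (b i j) = (if j > 1 then b i (j - 1) else 0)"
    using b unfolding colored_jordan_basis_def by blast+
  have pow: "k < lam i \<Longrightarrow> (x ^^ k) (w i) = b i (int (lam i) - int k)" for i k
  proof (induction k)
    case 0
    then show ?case by (simp add: w_def)
  next
    case (Suc k)
    then show ?case using B(5)[of i "int (lam i) - int k"]
      by (auto simp: boxes_def algebra_simps)
  qed
  have zero: "(x ^^ lam i) (w i) = 0" for i
  proof (cases "lam i")
    case 0
    then show ?thesis by (simp add: w_def)
  next
    case (Suc k)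
    then show ?thesis using pow[of k i] B(5)[of i 1] by (simp add: boxes_def)
  qed
  have wV: "w i \<in> V (eps i)" for i
    using B(4)[of i "int (lam i)"] subspace_0[OF subspace_V]
    by (auto simp: w_def boxes_def res_zero)
  have "(\<lambda>(i, j). b i j) ` boxes lam \<subseteq> xspan x (range w)"
  proof clarify
    fix i j assume "(i, j) \<in> boxes lam"
    then have "b i j = (x ^^ nat (int (lam i) - j)) (w i)"
      using pow[of "nat (int (lam i) - j)" i] by (auto simp: boxes_def)
    then show "b i j \<in> xspan x (range w)" using xspan_funpow[OF lin] xspan_base by simp
  qed
  then have "xspan x (range w) = UNIV"
    using B(3) span_minimal[OF _ subspace_xspan] by blast
  then show J: "jordan_gens x lam eps w" unfolding jordan_gens_def using x B(1,2) wV zero by blast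
  show "marked_vector lam mu b = marked_sum x lam mu w" if m: "marking lam mu"
    unfolding marked_vector_def marked_sum_def rows_eq[OF jordan_gensD(4)[OF J]]
  proof (rule sum.cong[OF refl])
    fix i
    have mi: "mu i \<le> int (lam i)" using m unfolding marking_def by blast
    show "(if mu i \<le> 0 then 0 else b i (mu i)) = (x ^^ nat (nu lam mu i)) (w i)"
    proof (cases "mu i \<le> 0")
      case True
      then have "(x ^^ nat (nu lam mu i)) (w i) = 0"
        by (intro funpow_eq_0_mono[OF lin zero]) (simp add: nu_def)
      then show ?thesis using True by simp
    next
      case False
      then show ?thesis using pow[of "nat (nu lam mu i)" i] mi by (simp add: nu_def)
    qed
  qed
qed

lemma jordan_gens_imp_basis:
  assumes J: "jordan_gens x lam eps w"
  shows "colored_jordan_basis x lam eps (\<lambda>i j. (x ^^ nat (int (lam i) - j)) (w i))" (is "colored_jordan_basis _ _ _ ?b")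
    "marking lam mu \<Longrightarrow> marked_vector lam mu (\<lambda>i j. (x ^^ nat (int (lam i) - j)) (w i)) = marked_sum x lam mu w"
proof -
  note D = jordan_gensD[OF J]
  define h where "h = (\<lambda>(i::nat, k). (i, int (lam i) - int k))"
  have h: "bij_betw h (cells lam) (boxes lam)" unfolding h_def by (rule bij_cells_boxes)
  have bh: "(\<lambda>(i, j). ?b i j) (h a) = chain x w a" for a
    by (auto simp: h_def split: prod.split)
  have img: "(\<lambda>(i, j). ?b i j) ` boxes lam = chain x w ` cells lam"
    using h bh unfolding bij_betw_def by (metis (no_types, lifting) image_cong image_image)
  have fb: "inj_on (chain x w) (cells lam)" "independent (chain x w ` cells lam)" "span (chain x w ` cells lam) = UNIV"
    using jordan_gens_basis[OF J] fam_indep_iff unfolding fam_basis_def by blast+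
  have "inj_on (\<lambda>(i, j). ?b i j) (boxes lam)"
  proof -
    have "inj_on ((\<lambda>(i, j). ?b i j) \<circ> h) (cells lam)"
      using fb(1) bh by (metis (no_types, lifting) comp_apply inj_on_cong)
    then show ?thesis using h inj_on_imageI[of "\<lambda>(i, j). ?b i j" h "cells lam"] unfolding bij_betw_def by simp
  qed
  moreover have "?b i j \<in> V (eps i + res (int (lam i) - j)) \<and> x (?b i j) = (if j > 1 then ?b i (j - 1) else 0)"
    if "(i, j) \<in> boxes lam" for i j
  proof -
    have j: "1 \<le> j" "j \<le> int (lam i)" using that by (auto simp: boxes_def)
    have "?b i j \<in> V (eps i + res (int (lam i) - j))"
      using nil_cone_funpow_color[OF D(1) D(6)[of i], of "nat (int (lam i) - j)"] j by simp
    moreover have "nat (int (lam i) - (j - 1)) = Suc (nat (int (lam i) - j))" using j by linarith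
    then have "x (?b i j) = (x ^^ nat (int (lam i) - (j - 1))) (w i)" by simp
    moreover have "\<not> j > 1 \<Longrightarrow> (x ^^ nat (int (lam i) - (j - 1))) (w i) = 0"
      using j D(7) by simp
    ultimately show ?thesis by auto
  qed
  ultimately show "colored_jordan_basis x lam eps ?b"
    unfolding colored_jordan_basis_def using D(3,5) fb img by auto
  show "marked_vector lam mu ?b = marked_sum x lam mu w" if m: "marking lam mu"
    unfolding marked_vector_def marked_sum_def rows_eq[OF D(4)]
  proof (rule sum.cong[OF refl])
    fix i
    show "(if mu i \<le> 0 then 0 else ?b i (mu i)) = (x ^^ nat (nu lam mu i)) (w i)"
      using funpow_eq_0_mono[OF D(2,7), of i "nat (nu lam mu i)"] by (auto simp: nu_def)
  qed
qed

text \<open>Equality of signatures lets a homogeneous basis be distributed over the cells color by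
  color; x is then defined as the shift along the rows. This makes the choice inside
  \<open>Psi\<close> possible for every marked colored partition of the right signature.\<close>

lemma ex_jordan_gens:
  assumes cp: "colored_partition lam eps" and sig: "signature lam eps = space_signature"
  shows "\<exists>x w. jordan_gens x lam eps w"
proof -
  obtain B where B: "\<And>c. independent (B c)" "\<And>c. span (B c) = V c" "\<And>c. card (B c) = space_signature c"
    using ex_graded_basis by blast
  note gb = graded_basis[OF B(1,2)]
  define col where "col = (\<lambda>(i, k). eps i + res (int k))"
  have fin: "finite (cells lam)" using cp finite_cells_colored by blast
  have "\<exists>h. bij_betw h {a \<in> cells lam. col a = c} (B c)" for c
  proof (rule finite_same_card_bij)
    have "{(i, k) \<in> cells lam. eps i + res (int k) = c} = {a \<in> cells lam. col a = c}"
      by (auto simp: col_def)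
    then show "card {a \<in> cells lam. col a = c} = card (B c)"
      using B(3)[of c] fun_cong[OF sig, of c] unfolding signature_cells by simp
  qed (use fin gb(4) in auto)
  then obtain h where h: "\<And>c. bij_betw (h c) {a \<in> cells lam. col a = c} (B c)" by metis
  define g where "g a = h (col a) a" for a
  have gB: "g a \<in> B (col a)" if "a \<in> cells lam" for a
    using h[of "col a"] that by (auto simp: g_def bij_betw_def)
  have gV: "g a \<in> V (col a)" if "a \<in> cells lam" for a
    using gB[OF that] B(2)[of "col a"] span_base by blast
  have "inj_on g (cells lam)"
  proof (rule inj_onI)
    fix a b assume ab: "a \<in> cells lam" "b \<in> cells lam" "g a = g b"
    then have "col a = col b" using gB[of a] gB[of b] gb(1)[of "col a" "col b"] by auto
    moreover have "inj_on (h (col a)) {z \<in> cells lam. col z = col a}"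
      using h bij_betw_def by blast
    ultimately show "a = b" using ab by (auto simp: g_def dest: inj_onD)
  qed
  moreover have "g ` cells lam = (\<Union>c. B c)"
  proof
    show "g ` cells lam \<subseteq> (\<Union>c. B c)" using gB by blast
    show "(\<Union>c. B c) \<subseteq> g ` cells lam"
    proof
      fix b assume "b \<in> (\<Union>c. B c)"
      then obtain c where "b \<in> h c ` {a \<in> cells lam. col a = c}"
        using h unfolding bij_betw_def by blast
      then show "b \<in> g ` cells lam" by (auto simp: g_def)
    qed
  qed
  ultimately have b: "fam_basis g (cells lam)"
    unfolding fam_basis_def using fin gb(2,3) fam_indep_iff by metis
  define next' where "next' = (\<lambda>(i, k). if Suc k < lam i then g (i, Suc k) else 0)"
  define x where "x v = (\<Sum>a\<in>cells lam. scale (coef g (cells lam) v a) (next' a))" for v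
  define w where "w i = (if lam i = 0 then 0 else g (i, 0))" for i
  have lin: "Vector_Spaces.linear scale scale x" unfolding x_def by (rule linear_extension[OF b])
  have xg: "x (g a) = next' a" if "a \<in> cells lam" for a
    unfolding x_def by (rule extension_basis[OF b that])
  have pow: "(x ^^ k) (w i) = (if k < lam i then g (i, k) else 0)" for i k
  proof (induction k)
    case 0
    show ?case by (simp add: w_def)
  next
    case (Suc k)
    then show ?case using xg[of "(i, k)"] vp.linear_0[OF lin] by (simp add: next'_def cells_def)
  qed
  \<comment> \<open>Row 0 is the longest, so its length bounds the nilpotency order of x.\<close>
  have le: "lam i \<le> lam 0" for i
    using cp unfolding colored_partition_def is_partition_def antimono_def by blast
  have x: "x \<in> nil_cone" unfolding nil_cone_def
  proof (intro CollectI conjI allI)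
    show "Vector_Spaces.linear scale scale x" by (rule lin)
    have zero: "Vector_Spaces.linear scale scale (\<lambda>_. 0)"
      unfolding Vector_Spaces.linear_iff using vector_space_axioms by simp
    have "(x ^^ lam 0) v = 0" for v
    proof (rule linear_eq_on_basis[OF b linear_funpow[OF lin] zero])
      fix a assume a: "a \<in> cells lam"
      obtain i k where ik: "a = (i, k)" by (cases a)
      have "g a = (x ^^ k) (w i)" using a by (simp add: ik pow cells_def)
      then have "(x ^^ lam 0) (g a) = (x ^^ (lam 0 + k)) (w i)" by (simp add: funpow_add)
      also have "\<dots> = 0" using le[of i] by (simp add: pow)
      finally show "(x ^^ lam 0) (g a) = 0" .
    qed
    then show "\<exists>m. x ^^ m = (\<lambda>_. 0)" by (intro exI[of _ "lam 0"]) (auto simp: fun_eq_iff)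
    show "x ` V c \<subseteq> V (c + res 1)" for c
    proof (rule image_subsetI)
      fix v assume v: "v \<in> V c"
      show "x v \<in> V (c + res 1)" unfolding x_def
      proof (rule linear_extension_color[OF b gV _ v])
        fix a assume "a \<in> cells lam"
        obtain i k where ik: "a = (i, k)" by (cases a)
        have "col (i, Suc k) = col (i, k) + res 1"
          by (simp add: col_def add.assoc flip: res_add) (simp add: add.commute)
        then show "next' a \<in> V (col a + res 1)"
          using gV[of "(i, Suc k)"] subspace_0[OF subspace_V] by (auto simp: ik next'_def cells_def)
      qed
    qed
  qed
  moreover have "w i \<in> V (eps i)" for i
    using gV[of "(i, 0)"] subspace_0[OF subspace_V] by (auto simp: w_def cells_def col_def res_zero)
  moreover have "xspan x (range w) = UNIV"
  proof -
    have "chain x w a = g a" if "a \<in> cells lam" for a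
      using that by (auto simp: pow cells_def)
    then have "chain x w ` cells lam = g ` cells lam" by (intro image_cong) auto
    then show ?thesis using span_cells[OF lin, of lam w] b by (simp add: pow fam_basis_def)
  qed
  moreover have "(x ^^ lam i) (w i) = 0" for i by (simp add: pow)
  ultimately show ?thesis using cp sig unfolding jordan_gens_def by blast
qed

text \<open>Whatever pair is chosen in \<open>Psi\<close>, \<open>ex_transfer\<close> moves it to
  the given one by an element of the group, so the orbit does not depend on the choice.\<close>

lemma Psi_eq:
  assumes J: "jordan_gens x lam eps w" and m: "marking lam mu"
  shows "Psi (lam, eps, mu) = K_orbit (marked_sum x lam mu w, x)"
proof -
  let ?P = "\<lambda>(x, b). x \<in> nil_cone \<and> colored_jordan_basis x lam eps b"
  obtain x0 b0 where s: "(SOME p. ?P p) = (x0, b0)" by (cases "SOME p. ?P p")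
  have "?P (SOME p. ?P p)"
    by (rule someI[of ?P "(x, _)"]) (use jordan_gensD(1)[OF J] jordan_gens_imp_basis(1)[OF J] in simp)
  then have P: "x0 \<in> nil_cone" "colored_jordan_basis x0 lam eps b0" unfolding s by auto
  from jordan_basis_imp_gens[OF P] m obtain w0 where
    w0: "jordan_gens x0 lam eps w0" "marked_vector lam mu b0 = marked_sum x0 lam mu w0" by blast
  obtain k where k: "k \<in> K_group" "\<And>i. k (w0 i) = w i" "\<And>v. k (x0 v) = x (k v)"
    using ex_transfer[OF w0(1) J] by blast
  have "bij k" using k(1) unfolding K_group_def by blast
  then have kx: "k \<circ> x0 \<circ> inv_into UNIV k = x"
    using k(3) by (auto simp: fun_eq_iff bij_is_surj surj_f_inv_f)
  moreover have "k (marked_sum x0 lam mu w0) = marked_sum x lam mu w"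
    using jordan_gens_act(2)[OF k(1) w0(1), of mu] kx k(2) by (simp add: comp_def)
  ultimately have "K_act k (marked_sum x0 lam mu w0, x0) = (marked_sum x lam mu w, x)" by simp
  then have "K_orbit (marked_sum x lam mu w, x) = K_orbit (marked_sum x0 lam mu w0, x0)"
    using K_orbit_eq[OF k(1)] by metis
  then show ?thesis unfolding Psi.simps s using w0(2) by simp
qed

lemma Psi_obtain:
  assumes "(lam, eps, mu) \<in> mcps space_signature"
  shows "\<exists>x w. jordan_gens x lam eps w \<and> Psi (lam, eps, mu) = K_orbit (marked_sum x lam mu w, x)"
  using assms ex_jordan_gens Psi_eq unfolding mcps_def by fastforce

text \<open>Jordan generators are carried along the orbit, so every point of it, and not just a
  representative, has the prescribed form.\<close>

lemma Psi_eq_orbitD: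
  assumes Q: "(lam, eps, mu) \<in> mcps space_signature" and P: "Psi (lam, eps, mu) = K_orbit (v, x)"
  shows "\<exists>w. jordan_gens x lam eps w \<and> v = marked_sum x lam mu w"
proof -
  obtain x0 w0 where J: "jordan_gens x0 lam eps w0" and "K_orbit (v, x) = K_orbit (marked_sum x0 lam mu w0, x0)"
    using Psi_obtain[OF Q] P by metis
  then obtain k where k: "k \<in> K_group" "(v, x) = K_act k (marked_sum x0 lam mu w0, x0)"
    using K_orbit_eqD by blast
  then show ?thesis using jordan_gens_act[OF k(1) J] by auto
qed


subsection \<open>Existence of the colored Jordan type\<close>

lemma chain_basis_reindex:
  assumes "fam_basis (chain x w) (cells lam)" "bij p"
  shows "fam_basis (chain x (w \<circ> p)) (cells (lam \<circ> p))"
proof -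
  have h: "bij_betw (\<lambda>(i, k). (p i, k)) (cells (lam \<circ> p)) (cells lam)"
    by (rule bij_betw_byWitness[where f' = "\<lambda>(i, k). (inv_into UNIV p i, k)"])
      (use assms(2) in \<open>auto simp: cells_def bij_is_inj bij_is_surj surj_f_inv_f\<close>)
  have "chain x w \<circ> (\<lambda>(i, k). (p i, k)) = chain x (w \<circ> p)" by (auto simp: fun_eq_iff)
  then show ?thesis using fam_basis_reindex[OF assms(1) h] by simp
qed

lemma jordan_gens_reindex:
  assumes J: "jordan_gens x lam eps w" and s: "bij s" and p: "is_partition (lam \<circ> s)"
  shows "jordan_gens x (lam \<circ> s) (eps \<circ> s) (w \<circ> s)"
proof -
  note D = jordan_gensD[OF J]
  have "infinite {i. (eps \<circ> s) i = c}" for c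
  proof -
    have "s ` {i. (eps \<circ> s) i = c} = {i. eps i = c}"
      using s by (auto simp: image_iff) (metis bij_pointE)
    then show ?thesis using D(3) unfolding colored_partition_def by (metis finite_imageI)
  qed
  then have "colored_partition (lam \<circ> s) (eps \<circ> s)"
    using p unfolding colored_partition_def by blast
  moreover have "signature (lam \<circ> s) (eps \<circ> s) = space_signature"
    by (rule space_signature_eq[OF D(1) _ chain_basis_reindex[OF jordan_gens_basis[OF J] s]])
      (use D(6) in simp)
  moreover have "range (w \<circ> s) = range w"
    using s by (metis bij_is_surj fun.set_map)
  ultimately show ?thesis using D unfolding jordan_gens_def by simp
qed

text \<open>
  Among the spanning families of homogeneous strings with a fixed number of strings, take one of
  minimal total length. A linear relation, multiplied by a power of x, becomes a relation between the
  last vectors of the strings, and then a shortest string involved can be made shorter.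
\<close>

lemma ex_chain_basis:
  assumes x: "x \<in> nil_cone"
  shows "\<exists>r l eps w. (\<forall>i. w i \<in> V (eps i)) \<and> (\<forall>i. (x ^^ l i) (w i) = 0) \<and> (\<forall>i\<ge>r. l i = 0) \<and>
    (\<forall>i\<ge>r. eps i = res (int i)) \<and> fam_basis (chain x w) (cells l)"
proof -
  note lin = nil_cone_linear[OF x]
  obtain M where M: "x ^^ M = (\<lambda>_. 0)" using x unfolding nil_cone_def by blast
  obtain B where B: "\<And>c. independent (B c)" "\<And>c. span (B c) = V c" using ex_graded_basis by blast
  note gb = graded_basis[OF B]
  define r where "r = card (\<Union>c. B c)"
  have "finite (\<Union>c. B c)" using gb(4) by simp
  then obtain e where e: "bij_betw e {0..<r} (\<Union>c. B c)"
    unfolding r_def using ex_bij_betw_nat_finite by blast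
  have "\<forall>i. \<exists>c. i < r \<longrightarrow> e i \<in> V c"
    using e B(2) span_base unfolding bij_betw_def by (metis UN_E atLeastLessThan_iff image_eqI zero_le)
  then obtain ec where ec: "\<And>i. i < r \<Longrightarrow> e i \<in> V (ec i)" by metis
  \<comment> \<open>The colors stay fixed while lengths and generators vary. Beyond the r strings
    they run cyclically through all residues, so the empty rows supply every color infinitely
    often.\<close>
  define eps where "eps i = (if i < r then ec i else res (int i))" for i
  define P where "P = (\<lambda>(l, w). (\<forall>i. w i \<in> V (eps i)) \<and> (\<forall>i. (x ^^ l i) (w i) = 0) \<and>
     (\<forall>i\<ge>r. l i = 0) \<and> xspan x (range w) = UNIV)"
  define w0 where "w0 i = (if i < r then e i else 0)" for i
  have "P (\<lambda>i. if i < r then M else 0, w0)"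
  proof -
    have "(\<Union>c. B c) \<subseteq> xspan x (range w0)"
    proof
      fix b assume "b \<in> (\<Union>c. B c)"
      then have "b \<in> e ` {0..<r}" using e unfolding bij_betw_def by simp
      then obtain i where "i < r" "b = e i" by auto
      then have "b \<in> range w0" by (auto simp: w0_def)
      then show "b \<in> xspan x (range w0)" by (rule xspan_base)
    qed
    then have "xspan x (range w0) = UNIV"
      using gb(3) span_minimal[OF _ subspace_xspan] by (metis top.extremum_uniqueI)
    then show ?thesis
      unfolding P_def using ec subspace_0[OF subspace_V] M by (auto simp: w0_def eps_def)
  qed
  then obtain lw where lw: "P lw" "\<And>y. P y \<Longrightarrow> sum (fst lw) {..<r} \<le> sum (fst y) {..<r}"
    using ex_has_least_nat[of P _ "\<lambda>y. sum (fst y) {..<r}"] by metis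
  obtain l w where lw': "lw = (l, w)" by (cases lw)
  have w: "\<And>i. w i \<in> V (eps i)" "\<And>i. (x ^^ l i) (w i) = 0" "\<And>i. i \<ge> r \<Longrightarrow> l i = 0"
    "xspan x (range w) = UNIV"
    using lw(1) unfolding lw' P_def by auto
  have "cells l \<subseteq> Sigma {..<r} (\<lambda>i. {..<l i})"
  proof
    fix a assume "a \<in> cells l"
    then obtain i k where a: "a = (i, k)" "k < l i" by (auto simp: cells_def)
    then show "a \<in> Sigma {..<r} (\<lambda>i. {..<l i})" using w(3)[of i] by (cases "i < r") auto
  qed
  then have fin: "finite (cells l)" by (rule finite_subset) simp
  have sp: "span (chain x w ` cells l) = UNIV" using span_cells[OF lin w(2)] w(4) by simp
  have "fam_indep (chain x w) (cells l)"
  proof (rule ccontr)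
    assume "\<not> fam_indep (chain x w) (cells l)"
    then obtain f a0 where f: "(\<Sum>a\<in>cells l. scale (f a) (chain x w a)) = 0" and a0: "a0 \<in> cells l" "f a0 \<noteq> 0"
      unfolding fam_indep_def by blast
    define col where "col = (\<lambda>(i, k). eps i + res (int k))"
    define Z where "Z = {a \<in> cells l. col a = col a0 \<and> f a \<noteq> 0}"
    have Z: "finite Z" "a0 \<in> Z" using fin a0 by (auto simp: Z_def)
    \<comment> \<open>The vanishing sum is taken as an element of \<open>V 0\<close>; any color
      would do, as both branches of the conditional are 0.\<close>
    have "(\<Sum>a\<in>{a \<in> cells l. col a = col a0}. scale (f a) (chain x w a))
       = (if col a0 = 0 then \<Sum>a\<in>cells l. scale (f a) (chain x w a) else 0)"
    proof (rule homogeneous_part[OF fin])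
      show "scale (f a) (chain x w a) \<in> V (col a)" for a
        using nil_cone_funpow_color[OF x w(1)] subspace_scale[OF subspace_V]
        by (cases a) (auto simp: col_def)
    qed (use f subspace_0[OF subspace_V] in simp)
    moreover have "(\<Sum>a\<in>Z. scale (f a) (chain x w a)) = (\<Sum>a\<in>{a \<in> cells l. col a = col a0}. scale (f a) (chain x w a))"
      using fin by (intro sum.mono_neutral_left) (auto simp: Z_def)
    ultimately have fZ: "(\<Sum>a\<in>Z. scale (f a) (chain x w a)) = 0" using f by simp
    \<comment> \<open>t is the largest distance from a cell of the relation to the end of its row.
      Applying \<open>x ^^ t\<close> kills all terms except those at distance exactly t, which
      become last vectors; each row in I below has one such term.\<close>
    define t where "t = Max ((\<lambda>(i, k). l i - Suc k) ` Z)"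
    have t_ge: "l i - Suc k \<le> t" if "(i, k) \<in> Z" for i k
      unfolding t_def using Z(1) that by (intro Max_ge) force+
    have "t \<in> (\<lambda>(i, k). l i - Suc k) ` Z" unfolding t_def using Z by (intro Max_in) auto
    then obtain i1 k1 where i1: "(i1, k1) \<in> Z" "t = l i1 - Suc k1" by auto
    define I where "I = {i. t < l i \<and> (i, l i - Suc t) \<in> Z}"
    define c where "c i = f (i, l i - Suc t)" for i
    have "finite I"
      by (rule finite_subset[of _ "fst ` Z"]) (use Z(1) in \<open>force simp: I_def\<close>)+
    have "i1 \<in> I" using i1 by (auto simp: I_def Z_def cells_def)
    have "(\<Sum>i\<in>I. scale (c i) ((x ^^ (l i - 1)) (w i))) = (x ^^ t) (\<Sum>a\<in>Z. scale (f a) (chain x w a))"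
    proof -
      have "(x ^^ t) (\<Sum>a\<in>Z. scale (f a) (chain x w a)) = (\<Sum>a\<in>Z. scale (f a) ((x ^^ t) (chain x w a)))"
        by (simp add: vp.linear_sum[OF linear_funpow[OF lin]] vp.linear_scale[OF linear_funpow[OF lin]])
      also have "\<dots> = (\<Sum>a\<in>(\<lambda>i. (i, l i - Suc t)) ` I. scale (f a) ((x ^^ t) (chain x w a)))"
      proof (rule sum.mono_neutral_right[OF Z(1)])
        show "\<forall>a\<in>Z - (\<lambda>i. (i, l i - Suc t)) ` I. scale (f a) ((x ^^ t) (chain x w a)) = 0"
        proof
          fix a assume a: "a \<in> Z - (\<lambda>i. (i, l i - Suc t)) ` I"
          obtain i k where ik: "a = (i, k)" by (cases a)
          have "l i \<le> t + k"
          proof (rule ccontr)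
            assume "\<not> l i \<le> t + k"
            then have "k = l i - Suc t" "t < l i" using t_ge[of i k] a ik by auto
            then have "a \<in> (\<lambda>i. (i, l i - Suc t)) ` I" using a ik by (auto simp: I_def)
            then show False using a by simp
          qed
          then have "(x ^^ (t + k)) (w i) = 0" by (rule funpow_eq_0_mono[OF lin w(2)])
          then show "scale (f a) ((x ^^ t) (chain x w a)) = 0" by (simp add: ik funpow_add)
        qed
      qed (auto simp: I_def)
      also have "\<dots> = (\<Sum>i\<in>I. scale (c i) ((x ^^ t) ((x ^^ (l i - Suc t)) (w i))))"
        by (subst sum.reindex) (auto simp: inj_on_def c_def)
      also have "\<dots> = (\<Sum>i\<in>I. scale (c i) ((x ^^ (l i - 1)) (w i)))"
      proof (rule sum.cong[OF refl])
        fix i assume "i \<in> I"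
        then have "l i - 1 = t + (l i - Suc t)" by (auto simp: I_def)
        then show "scale (c i) ((x ^^ t) ((x ^^ (l i - Suc t)) (w i))) = scale (c i) ((x ^^ (l i - 1)) (w i))"
          by (metis comp_apply funpow_add)
      qed
      finally show ?thesis by simp
    qed
    then have socle: "(\<Sum>i\<in>I. scale (c i) ((x ^^ (l i - 1)) (w i))) = 0"
      using fZ vp.linear_0[OF linear_funpow[OF lin]] by simp
    have "\<exists>i0. i0 \<in> I \<and> (\<forall>i\<in>I. l i0 \<le> l i)"
      using ex_has_least_nat[of "\<lambda>i. i \<in> I" i1 l] \<open>i1 \<in> I\<close> by blast
    then obtain i0 where i0: "i0 \<in> I" "\<And>i. i \<in> I \<Longrightarrow> l i0 \<le> l i" by blast
    have pos: "l i0 > 0" "c i0 \<noteq> 0" using i0(1) by (auto simp: I_def c_def Z_def)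
    \<comment> \<open>The relation between last vectors is lifted by \<open>l i0 - 1\<close> powers
      of x to the level of \<open>w i0\<close>; the remaining exponents are differences of lengths,
      and row i0 is a shortest one. The new generator y is thus killed by
      \<open>x ^^ (l i0 - 1)\<close>.\<close>
    define y where "y = (\<Sum>i\<in>I. scale (c i) ((x ^^ (l i - l i0)) (w i)))"
    define w' where "w' = w(i0 := y)"
    define l' where "l' = l(i0 := l i0 - 1)"
    have y0: "(x ^^ (l i0 - 1)) y = 0"
    proof -
      have "(x ^^ (l i0 - 1)) y = (\<Sum>i\<in>I. scale (c i) ((x ^^ (l i0 - 1)) ((x ^^ (l i - l i0)) (w i))))"
        unfolding y_def
        by (simp add: vp.linear_sum[OF linear_funpow[OF lin]] vp.linear_scale[OF linear_funpow[OF lin]])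
      also have "\<dots> = (\<Sum>i\<in>I. scale (c i) ((x ^^ (l i - 1)) (w i)))"
      proof (rule sum.cong[OF refl])
        fix i assume "i \<in> I"
        then have "l i - 1 = (l i0 - 1) + (l i - l i0)" using i0(2)[of i] pos by auto
        then show "scale (c i) ((x ^^ (l i0 - 1)) ((x ^^ (l i - l i0)) (w i))) = scale (c i) ((x ^^ (l i - 1)) (w i))"
          by (metis comp_apply funpow_add)
      qed
      finally show ?thesis using socle by simp
    qed
    \<comment> \<open>The surviving cells share a color and a distance to the end, so all rows of I
      have the same color just past their end. Hence y is homogeneous of color
      \<open>eps i0\<close>.\<close>
    have colI: "eps i + res (int (l i)) = col a0 + res (int (Suc t))" if "i \<in> I" for i
    proof -
      have "eps i + res (int (l i - Suc t)) = col a0" "t < l i" using that by (auto simp: I_def Z_def col_def)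
      moreover have "int (l i) = int (l i - Suc t) + int (Suc t)" using \<open>t < l i\<close> by simp
      ultimately show ?thesis by (metis add.assoc res_add)
    qed
    have yV: "y \<in> V (eps i0)" unfolding y_def
    proof (rule subspace_sum[OF subspace_V])
      fix i assume i: "i \<in> I"
      have "eps i + res (int (l i - l i0)) + res (int (l i0)) = eps i0 + res (int (l i0))"
        using colI[OF i] colI[OF i0(1)] i0(2)[OF i] by (simp add: add.assoc flip: res_add)
      then have "eps i + res (int (l i - l i0)) = eps i0" by simp
      then show "scale (c i) ((x ^^ (l i - l i0)) (w i)) \<in> V (eps i0)"
        using nil_cone_funpow_color[OF x w(1)[of i], of "l i - l i0"] subspace_scale[OF subspace_V] by simp
    qed
    have old: "w i \<in> xspan x (range w')" if "i \<noteq> i0" for i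
      using xspan_base[of "w' i" "range w'"] that by (simp add: w'_def)
    \<comment> \<open>In y the vector \<open>w i0\<close> occurs with exponent 0 and nonzero
      coefficient, and all other terms come from unchanged generators.\<close>
    have "w i0 \<in> xspan x (range w')"
    proof -
      have "y = scale (c i0) (w i0) + (\<Sum>i\<in>I - {i0}. scale (c i) ((x ^^ (l i - l i0)) (w i)))"
        unfolding y_def using \<open>finite I\<close> i0(1) by (subst sum.remove[of _ i0]) auto
      then have "scale (c i0) (w i0) = y - (\<Sum>i\<in>I - {i0}. scale (c i) ((x ^^ (l i - l i0)) (w i)))"
        by simp
      moreover have "y \<in> xspan x (range w')"
        using xspan_base[of "w' i0" "range w'"] by (simp add: w'_def)
      moreover have "(\<Sum>i\<in>I - {i0}. scale (c i) ((x ^^ (l i - l i0)) (w i))) \<in> xspan x (range w')"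
        by (rule subspace_sum[OF subspace_xspan])
          (use old xspan_funpow[OF lin] subspace_scale[OF subspace_xspan] in blast)
      ultimately have "scale (c i0) (w i0) \<in> xspan x (range w')"
        by (simp add: subspace_diff[OF subspace_xspan])
      from subspace_scale[OF subspace_xspan this, of "inverse (c i0)"]
      show ?thesis using pos(2) by simp
    qed
    then have "w i \<in> xspan x (range w')" for i using old by (cases "i = i0") auto
    then have "range w \<subseteq> xspan x (range w')" by blast
    then have "xspan x (range w') = UNIV" using xspan_subset[OF lin] w(4) by blast
    then have "P (l', w')"
      unfolding P_def using w yV y0 by (auto simp: w'_def l'_def)
    then have "sum l {..<r} \<le> sum l' {..<r}" using lw(2) unfolding lw' by force
    moreover have "i0 < r" using w(3)[of i0] pos by (cases "i0 < r") auto
    then have "sum l' {..<r} < sum l {..<r}"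
      by (intro sum_strict_mono_ex1) (use pos in \<open>auto simp: l'_def intro!: bexI[of _ i0]\<close>)
    ultimately show False by simp
  qed
  then have "fam_basis (chain x w) (cells l)" unfolding fam_basis_def using fin sp by blast
  moreover have "\<forall>i\<ge>r. eps i = res (int i)" by (simp add: eps_def)
  ultimately show ?thesis using w(1-3) by blast
qed

lemma ex_jordan_type:
  assumes x: "x \<in> nil_cone"
  shows "\<exists>lam eps w. jordan_gens x lam eps w"
proof -
  obtain r l eps w where w: "\<And>i. w i \<in> V (eps i)" "\<And>i. (x ^^ l i) (w i) = 0" "\<And>i. i \<ge> r \<Longrightarrow> l i = 0"
    "\<And>i. i \<ge> r \<Longrightarrow> eps i = res (int i)" and b: "fam_basis (chain x w) (cells l)"
    using ex_chain_basis[OF x] by blast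
  obtain p where p: "bij p" "is_partition (l \<circ> p)" using ex_bij_antimono_comp w(3) by blast
  have "infinite {i. (eps \<circ> p) i = c}" for c
  proof
    assume "finite {i. (eps \<circ> p) i = c}"
    then have "finite (p ` {i. (eps \<circ> p) i = c})" by simp
    moreover have "{i. i \<ge> r \<and> res (int i) = c} \<subseteq> p ` {i. (eps \<circ> p) i = c}"
      using p(1) w(4) by (auto simp: image_iff) (metis bij_pointE)
    ultimately show False using infinite_res_fibre[of r c] finite_subset by blast
  qed
  then have "colored_partition (l \<circ> p) (eps \<circ> p)" using p(2) unfolding colored_partition_def by blast
  moreover note b' = chain_basis_reindex[OF b p(1)]
  moreover have "signature (l \<circ> p) (eps \<circ> p) = space_signature"
    by (rule space_signature_eq[OF x _ b']) (simp add: w(1))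
  moreover have "xspan x (range (w \<circ> p)) = UNIV"
    using span_cells[OF nil_cone_linear[OF x], of "l \<circ> p" "w \<circ> p"] b' w(2) unfolding fam_basis_def by simp
  ultimately have "jordan_gens x (l \<circ> p) (eps \<circ> p) (w \<circ> p)"
    unfolding jordan_gens_def using x w(1,2) by simp
  then show ?thesis by blast
qed


subsection \<open>Normal bases\<close>

text \<open>Colors and lengths are kept, so generating the old tops is enough: independence then
  comes from counting.\<close>

lemma jordan_gens_change:
  assumes J: "jordan_gens x lam eps w" and "\<And>i. w' i \<in> V (eps i)" "\<And>i. (x ^^ lam i) (w' i) = 0"
    and "\<And>i. w i \<in> xspan x (range w')"
  shows "jordan_gens x lam eps w'"
proof -
  have "xspan x (range w') = UNIV"
    using xspan_subset[OF jordan_gensD(2)[OF J], of "range w" "range w'"] jordan_gensD(8)[OF J] assms(4)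
    by blast
  then show ?thesis using assms(1-3) unfolding jordan_gens_def by blast
qed

text \<open>By homogeneity the exponents occurring in one row of v agree modulo n. Splitting off the
  least power \<open>x ^^ kap i\<close> leaves a polynomial in x with nonzero constant term and
  exponents divisible by n. It preserves colors and is invertible, and applied to \<open>w i\<close>
  it gives the new generator.\<close>

lemma homogeneous_normal:
  assumes J: "jordan_gens x lam eps w" and v: "v \<in> V m"
  shows "\<exists>w' mu. jordan_gens x lam eps w' \<and> marking lam mu \<and> v = marked_sum x lam mu w' \<and>
    (\<forall>i. eps i + res (nu lam mu i) = m)"
proof -
  note D = jordan_gensD[OF J] and b = jordan_gens_basis[OF J]
  note lin = D(2) and linp = linear_funpow[OF D(2)]
  define c where "c i k = coef (chain x w) (cells lam) v (i, k)" for i k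
  have ccol: "eps i + res (int k) = m" if "c i k \<noteq> 0" for i k
    using coef_color[OF b chain_color[OF J] v, of "(i, k)"] that unfolding c_def by simp
  have ccell: "k < lam i" if "c i k \<noteq> 0" for i k
    using coef_outside[OF b, of "(i, k)" v] that unfolding c_def cells_def by auto
  \<comment> \<open>A row that does not occur in v still needs a mark of color m. An exponent at
    least \<open>lam i\<close> in the right residue class makes this mark nonpositive, hence
    invisible.\<close>
  have "\<exists>k. if \<exists>k. c i k \<noteq> 0 then c i k \<noteq> 0 \<and> (\<forall>k'. c i k' \<noteq> 0 \<longrightarrow> k \<le> k')
     else lam i \<le> k \<and> eps i + res (int k) = m" for i
  proof (cases "\<exists>k. c i k \<noteq> 0")
    case True
    then show ?thesis using exists_least_iff[of "\<lambda>k. c i k \<noteq> 0"] by (auto simp: not_less[symmetric])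
  next
    case False
    obtain k where "k \<ge> lam i" "res (int k) = m - eps i"
      using infinite_res_fibre[of "lam i" "m - eps i"] by (metis (mono_tags, lifting) finite.emptyI mem_Collect_eq equals0I)
    then have "lam i \<le> k \<and> eps i + res (int k) = m" by simp
    then show ?thesis using False by auto
  qed
  then obtain kap where kap: "\<And>i. if \<exists>k. c i k \<noteq> 0 then c i (kap i) \<noteq> 0 \<and> (\<forall>k'. c i k' \<noteq> 0 \<longrightarrow> kap i \<le> k')
     else lam i \<le> kap i \<and> eps i + res (int (kap i)) = m" by metis
  define mu where "mu i = int (lam i) - int (kap i)" for i
  define w' where "w' i = (if \<exists>k. c i k \<noteq> 0 then \<Sum>k\<in>{kap i..<lam i}. scale (c i k) ((x ^^ (k - kap i)) (w i)) else w i)" for i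
  have nu: "nu lam mu i = int (kap i)" for i by (simp add: nu_def mu_def)
  have mk: "marking lam mu" by (simp add: marking_def mu_def)
  have kcol: "eps i + res (nu lam mu i) = m" for i
    using kap[of i] ccol[of i "kap i"] by (auto simp: nu split: if_splits)
  have w'V: "w' i \<in> V (eps i)" for i
  proof (cases "\<exists>k. c i k \<noteq> 0")
    case True
    have "scale (c i k) ((x ^^ (k - kap i)) (w i)) \<in> V (eps i)" if "kap i \<le> k" for k
    proof (cases "c i k = 0")
      case True
      then show ?thesis using subspace_0[OF subspace_V] by simp
    next
      case False
      have "eps i + res (int (k - kap i)) + res (int (kap i)) = eps i + res (int k)"
        using that by (simp add: add.assoc flip: res_add)
      also have "\<dots> = eps i + res (int (kap i))" using ccol[OF False] kcol[of i] by (simp add: nu)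
      finally have "eps i + res (int (k - kap i)) = eps i" by simp
      then show ?thesis
        using nil_cone_funpow_color[OF D(1) D(6)[of i], of "k - kap i"] subspace_scale[OF subspace_V] by simp
    qed
    then show ?thesis using True unfolding w'_def by (auto intro!: subspace_sum[OF subspace_V])
  qed (simp add: w'_def D(6))
  have w'0: "(x ^^ lam i) (w' i) = 0" for i
  proof (cases "\<exists>k. c i k \<noteq> 0")
    case True
    have "(x ^^ lam i) ((x ^^ (k - kap i)) (w i)) = 0" for k
      using funpow_eq_0_mono[OF lin D(7), of i "lam i + (k - kap i)"] by (simp add: funpow_add)
    then show ?thesis using True unfolding w'_def
      by (simp add: vp.linear_sum[OF linp] vp.linear_scale[OF linp])
  qed (simp add: w'_def D(7))
  have wx: "w i \<in> xspan x (range w')" for i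
  proof (cases "\<exists>k. c i k \<noteq> 0")
    case True': True
    note kp = kap[of i, unfolded if_P[OF True']]
    \<comment> \<open>The unit is inverted by descending induction on the exponent:
      \<open>(x ^^ j) (w' i)\<close> is a nonzero multiple of \<open>(x ^^ j) (w i)\<close> plus
      higher powers, which are already covered.\<close>
    have "(x ^^ j) (w i) \<in> xspan x (range w')" for j
    proof (induction "lam i - j" arbitrary: j rule: less_induct)
      case less
      show ?case
      proof (cases "lam i \<le> j")
        case True
        then show ?thesis using funpow_eq_0_mono[OF lin D(7)] subspace_0[OF subspace_xspan] by metis
      next
        case False
        let ?S = "\<Sum>k\<in>{Suc (kap i)..<lam i}. scale (c i k) ((x ^^ (j + (k - kap i))) (w i))"
        have "(x ^^ j) (w' i) = (\<Sum>k\<in>{kap i..<lam i}. scale (c i k) ((x ^^ (j + (k - kap i))) (w i)))"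
          unfolding w'_def if_P[OF True']
          by (simp only: vp.linear_sum[OF linp] vp.linear_scale[OF linp] funpow_add comp_apply)
        also have "\<dots> = scale (c i (kap i)) ((x ^^ j) (w i)) + ?S"
          using ccell[of i "kap i"] kp by (subst sum.atLeast_Suc_lessThan) auto
        finally have "scale (c i (kap i)) ((x ^^ j) (w i)) = (x ^^ j) (w' i) - ?S" by simp
        moreover have "?S \<in> xspan x (range w')"
        proof (rule subspace_sum[OF subspace_xspan])
          fix k assume "k \<in> {Suc (kap i)..<lam i}"
          then have "lam i - (j + (k - kap i)) < lam i - j" using False by auto
          from less[OF this] show "scale (c i k) ((x ^^ (j + (k - kap i))) (w i)) \<in> xspan x (range w')"
            by (rule subspace_scale[OF subspace_xspan])
        qed
        moreover have "(x ^^ j) (w' i) \<in> xspan x (range w')"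
          by (rule xspan_funpow[OF lin xspan_base]) simp
        ultimately have "scale (c i (kap i)) ((x ^^ j) (w i)) \<in> xspan x (range w')"
          by (simp add: subspace_diff[OF subspace_xspan])
        from subspace_scale[OF subspace_xspan this, of "inverse (c i (kap i))"]
        show ?thesis using kp by simp
      qed
    qed
    from this[of 0] show ?thesis by simp
  next
    case False
    then have "w i = w' i" by (simp add: w'_def)
    then show ?thesis using xspan_base[of "w' i"] by simp
  qed
  have "v = marked_sum x lam mu w'"
  proof -
    have cells: "cells lam = Sigma {i. lam i > 0} (\<lambda>i. {..<lam i})" by (auto simp: cells_def)
    have "v = (\<Sum>a\<in>cells lam. scale (case a of (i, k) \<Rightarrow> c i k) (chain x w a))"
      using coef_expand[OF b, of v] unfolding c_def by simp
    also have "\<dots> = (\<Sum>i | lam i > 0. \<Sum>k<lam i. scale (c i k) ((x ^^ k) (w i)))"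
      unfolding cells using finite_rows[OF D(4)]
      by (subst sum.Sigma) (auto intro!: sum.cong)
    also have "\<dots> = marked_sum x lam mu w'" unfolding marked_sum_def
    proof (rule sum.cong[OF refl])
      fix i
      show "(\<Sum>k<lam i. scale (c i k) ((x ^^ k) (w i))) = (x ^^ nat (nu lam mu i)) (w' i)"
      proof (cases "\<exists>k. c i k \<noteq> 0")
        case True
        note kp = kap[of i, unfolded if_P[OF True]]
        have "(\<Sum>k<lam i. scale (c i k) ((x ^^ k) (w i))) = (\<Sum>k\<in>{kap i..<lam i}. scale (c i k) ((x ^^ k) (w i)))"
          by (rule sum.mono_neutral_right) (use kp in force)+
        also have "\<dots> = (\<Sum>k\<in>{kap i..<lam i}. scale (c i k) ((x ^^ kap i) ((x ^^ (k - kap i)) (w i))))"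
        proof (rule sum.cong[OF refl])
          fix k assume "k \<in> {kap i..<lam i}"
          then have "k = kap i + (k - kap i)" by simp
          then show "scale (c i k) ((x ^^ k) (w i)) = scale (c i k) ((x ^^ kap i) ((x ^^ (k - kap i)) (w i)))"
            by (metis comp_apply funpow_add)
        qed
        also have "\<dots> = (x ^^ kap i) (w' i)"
          using True unfolding w'_def
          by (simp add: vp.linear_sum[OF linp] vp.linear_scale[OF linp])
        finally show ?thesis by (simp add: nu)
      next
        case False
        then have "lam i \<le> kap i" using kap[of i] by simp
        then have "(x ^^ kap i) (w i) = 0" by (rule funpow_eq_0_mono[OF lin D(7)])
        then show ?thesis using False by (simp add: nu w'_def)
      qed
    qed
    finally show ?thesis .
  qed
  then show ?thesis using jordan_gens_change[OF J w'V w'0 wx] mk kcol by blast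
qed

text \<open>Both q and q' stand for marks of row j dominated by the mark of row s:
  \<open>p \<le> q\<close> makes \<open>x ^^ (q - p)\<close> meaningful, and
  \<open>lam j + p \<le> lam s + q\<close>, which compares the marks, makes
  \<open>x ^^ lam s\<close> kill the added vector. Changing \<open>w s\<close> alone trades q for q'
  in the marked sum, so raising and lowering a mark are one statement.\<close>

lemma absorb:
  assumes J: "jordan_gens x lam eps w" and ne: "s \<noteq> j"
    and col: "eps j + res (int q) = eps s + res (int p)" "eps j + res (int q') = eps s + res (int p)"
    and le: "p \<le> q" "p \<le> q'" "lam j + p \<le> lam s + q" "lam j + p \<le> lam s + q'"
  shows "\<exists>w'. jordan_gens x lam eps w' \<and> (\<forall>i. i \<noteq> s \<longrightarrow> w' i = w i) \<and>
    (x ^^ p) (w' s) + (x ^^ q') (w' j) = (x ^^ p) (w s) + (x ^^ q) (w j)"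
proof -
  note D = jordan_gensD[OF J]
  note linp = linear_funpow[OF D(2)]
  define y where "y = (x ^^ (q - p)) (w j) - (x ^^ (q' - p)) (w j)"
  define w' where "w' = w(s := w s + y)"
  have part: "(x ^^ (r - p)) (w j) \<in> V (eps s) \<and> (x ^^ lam s) ((x ^^ (r - p)) (w j)) = 0"
    if "eps j + res (int r) = eps s + res (int p)" "p \<le> r" "lam j + p \<le> lam s + r" for r
  proof
    have "eps j + res (int (r - p)) + res (int p) = eps s + res (int p)"
      using that(1,2) by (simp add: add.assoc flip: res_add)
    then have "eps j + res (int (r - p)) = eps s" by simp
    then show "(x ^^ (r - p)) (w j) \<in> V (eps s)"
      using nil_cone_funpow_color[OF D(1) D(6)[of j], of "r - p"] by simp
    have "(x ^^ (lam s + (r - p))) (w j) = 0"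
      by (rule funpow_eq_0_mono[OF D(2,7)]) (use that in linarith)
    then show "(x ^^ lam s) ((x ^^ (r - p)) (w j)) = 0" by (simp add: funpow_add)
  qed
  note pq = part[OF col(1) le(1,3)] and pq' = part[OF col(2) le(2,4)]
  have y: "y \<in> V (eps s)" "(x ^^ lam s) y = 0"
    unfolding y_def using pq pq' by (auto simp: vp.linear_diff[OF linp] intro: subspace_diff[OF subspace_V])
  have wj: "w i \<in> xspan x (range w')" if "i \<noteq> s" for i
    using xspan_base[of "w' i" "range w'"] that by (simp add: w'_def)
  have "y \<in> xspan x (range w')"
    unfolding y_def using wj[of j] ne xspan_funpow[OF D(2)] subspace_diff[OF subspace_xspan] by metis
  moreover have "w s + y \<in> xspan x (range w')"
    using xspan_base[of "w' s" "range w'"] by (simp add: w'_def)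
  ultimately have "w s \<in> xspan x (range w')"
    using subspace_diff[OF subspace_xspan] by fastforce
  then have "w i \<in> xspan x (range w')" for i using wj by (cases "i = s") auto
  then have "jordan_gens x lam eps w'"
    by (intro jordan_gens_change[OF J])
      (use D(6,7) y in \<open>auto simp: w'_def vp.linear_add[OF linp] intro: subspace_add[OF subspace_V]\<close>)
  moreover have "(x ^^ p) y = (x ^^ q) (w j) - (x ^^ q') (w j)"
  proof -
    have "(x ^^ p) ((x ^^ (r - p)) (w j)) = (x ^^ r) (w j)" if "p \<le> r" for r
      using that by (metis comp_apply funpow_add le_add_diff_inverse)
    then show ?thesis unfolding y_def using le(1,2) by (simp add: vp.linear_diff[OF linp])
  qed
  then have "(x ^^ p) (w' s) + (x ^^ q') (w' j) = (x ^^ p) (w s) + (x ^^ q) (w j)"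
    using ne by (simp add: w'_def vp.linear_add[OF linp])
  moreover have "\<forall>i. i \<noteq> s \<longrightarrow> w' i = w i" by (simp add: w'_def)
  ultimately show ?thesis by blast
qed

lemma marked_sum_cong:
  assumes J: "jordan_gens x lam eps w"
    and e: "\<And>i. lam i > 0 \<Longrightarrow> mu i = mu' i \<or> mu i \<le> 0 \<and> mu' i \<le> 0"
  shows "marked_sum x lam mu w = marked_sum x lam mu' w"
  unfolding marked_sum_def
proof (rule sum.cong[OF refl])
  fix i assume "i \<in> {i. lam i > 0}"
  then have "mu i = mu' i \<or> mu i \<le> 0 \<and> mu' i \<le> 0" using e by simp
  then show "(x ^^ nat (nu lam mu i)) (w i) = (x ^^ nat (nu lam mu' i)) (w i)"
    using funpow_eq_0_mono[OF jordan_gensD(2,7)[OF J], of i] by (auto simp: nu_def)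
qed

text \<open>
  Rows are treated one at a time. A dominating row s may have been raised before, but then it
  dominates all the more.
\<close>

lemma raise_marks:
  assumes J: "jordan_gens x lam eps w" and mk: "marking lam mu" "marking lam mu'"
    and col: "\<And>i. eps i + res (nu lam mu' i) = eps i + res (nu lam mu i)"
    and up: "\<And>j. lam j > 0 \<Longrightarrow> mu j \<le> mu' j"
    and dom: "\<And>j. lam j > 0 \<Longrightarrow> mu' j \<le> 0 \<or> mu' j = mu j \<or>
      (\<exists>s. lam s > 0 \<and> s \<noteq> j \<and> eps s + res (nu lam mu s) = eps j + res (nu lam mu j) \<and>
           mu' j \<le> mu s \<and> nu lam mu s \<le> nu lam mu' j)"
    and A: "finite A" "A \<subseteq> {i. lam i > 0}"
  shows "\<exists>w'. jordan_gens x lam eps w' \<and> marked_sum x lam (\<lambda>i. if i \<in> A then mu' i else mu i) w' = marked_sum x lam mu w"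
  using A
proof (induction A rule: finite_induct)
  case empty
  then show ?case using J by auto
next
  case (insert j A)
  define ka where "ka i = (if i \<in> A then mu' i else mu i)" for i
  define kb where "kb i = (if i \<in> insert j A then mu' i else mu i)" for i
  obtain w1 where w1: "jordan_gens x lam eps w1" "marked_sum x lam ka w1 = marked_sum x lam mu w"
    using insert unfolding ka_def by blast
  have j: "lam j > 0" "ka j = mu j" "kb j = mu' j" using insert by (auto simp: ka_def kb_def)
  have kab: "kb i = ka i" if "i \<noteq> j" for i using that by (simp add: ka_def kb_def)
  have "\<exists>w'. jordan_gens x lam eps w' \<and> marked_sum x lam kb w' = marked_sum x lam ka w1"
  proof (cases "mu' j \<le> 0 \<or> mu' j = mu j")
    \<comment> \<open>Marks only go up, so \<open>mu' j \<le> 0\<close> forces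
      \<open>mu j \<le> 0\<close>: the summand is 0 before and after.\<close>
    case True
    then have "marked_sum x lam kb w1 = marked_sum x lam ka w1"
      using up[OF j(1)] j kab by (intro marked_sum_cong[OF w1(1)]) (metis order_trans)
    then show ?thesis using w1(1) by blast
  next
    case False
    then obtain s where s: "lam s > 0" "s \<noteq> j" "eps s + res (nu lam mu s) = eps j + res (nu lam mu j)"
      "mu' j \<le> mu s" "nu lam mu s \<le> nu lam mu' j" using dom[OF j(1)] by blast
    have mk': "\<And>i. mu i \<le> int (lam i)" "\<And>i. mu' i \<le> int (lam i)" using mk unfolding marking_def by auto
    define p where "p = nat (nu lam ka s)"
    define q where "q = nat (nu lam mu j)"
    define q' where "q' = nat (nu lam mu' j)"
    have ints: "int p = nu lam ka s" "int q = nu lam mu j" "int q' = nu lam mu' j"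
      unfolding p_def q_def q'_def using mk' by (auto simp: nu_def ka_def)
    have kas: "mu s \<le> ka s" using up[OF s(1)] by (simp add: ka_def)
    have pc: "eps s + res (nu lam ka s) = eps s + res (nu lam mu s)"
      using col by (simp add: ka_def nu_def)
    have "\<exists>w'. jordan_gens x lam eps w' \<and> (\<forall>i. i \<noteq> s \<longrightarrow> w' i = w1 i) \<and>
      (x ^^ p) (w' s) + (x ^^ q') (w' j) = (x ^^ p) (w1 s) + (x ^^ q) (w1 j)"
    proof (rule absorb[OF w1(1) s(2)])
      show "eps j + res (int q) = eps s + res (int p)" "eps j + res (int q') = eps s + res (int p)"
        unfolding ints using pc s(3) col[of j] by simp_all
      have *: "int p \<le> int q" "int p \<le> int q'" "int (lam j) + int p \<le> int (lam s) + int q"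
        "int (lam j) + int p \<le> int (lam s) + int q'"
        unfolding ints using s(4,5) kas up[OF j(1)] by (auto simp: nu_def)
      then show "p \<le> q" "p \<le> q'" "lam j + p \<le> lam s + q" "lam j + p \<le> lam s + q'"
        by linarith+
    qed
    then obtain w' where w': "jordan_gens x lam eps w'" "\<And>i. i \<noteq> s \<Longrightarrow> w' i = w1 i"
      "(x ^^ p) (w' s) + (x ^^ q') (w' j) = (x ^^ p) (w1 s) + (x ^^ q) (w1 j)" by blast
    let ?R = "{i. lam i > 0}"
    have R: "finite ?R" "s \<in> ?R" "j \<in> ?R - {s}" using finite_rows[OF jordan_gensD(4)[OF J]] s j by auto
    have split: "(\<Sum>i\<in>?R. f i) = f s + f j + (\<Sum>i\<in>?R - {s} - {j}. f i)" for f :: "nat \<Rightarrow> 'v"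
      using R by (simp add: sum.remove[of ?R s] sum.remove[of "?R - {s}" j] add.assoc)
    have "marked_sum x lam kb w' = (x ^^ p) (w' s) + (x ^^ q') (w' j)
        + (\<Sum>i\<in>?R - {s} - {j}. (x ^^ nat (nu lam kb i)) (w' i))"
      unfolding marked_sum_def split using kab[of s] s(2) j by (simp add: p_def q'_def nu_def)
    also have "\<dots> = (x ^^ p) (w1 s) + (x ^^ q) (w1 j)
        + (\<Sum>i\<in>?R - {s} - {j}. (x ^^ nat (nu lam ka i)) (w1 i))"
      unfolding w'(3) using w'(2) kab by (simp add: nu_def)
    also have "\<dots> = marked_sum x lam ka w1"
      unfolding marked_sum_def split using j by (simp add: p_def q_def nu_def)
    finally show ?thesis using w'(1) by blast
  qed
  then show ?case using w1(2) unfolding kb_def by auto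
qed

text \<open>In a row of length l the mark k is dominated by a pair (a, b) of values of
  \<open>mu\<close> and \<open>nu\<close> when k \<le> a and k \<le> l - b. Each color has its own
  set of pairs, and the new mark is the largest dominated k of the right residue class. Colors of
  marked vectors do not change, so a single common color is preserved.\<close>

lemma generalized_striped_form:
  assumes J: "jordan_gens x lam eps w" and mk: "marking lam mu"
  shows "\<exists>mu' w'. jordan_gens x lam eps w' \<and> marked_sum x lam mu' w' = marked_sum x lam mu w \<and>
    generalized_striped (lam, eps, mu') \<and>
    (\<forall>i. eps i + res (nu lam mu' i) = eps i + res (nu lam mu i))"
proof -
  note D = jordan_gensD[OF J]
  define m where "m i = eps i + res (nu lam mu i)" for i
  define R where "R = {i. lam i > 0}"
  have finR: "finite R" unfolding R_def by (rule finite_rows[OF D(4)])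
  define T where "T c = insert (0, 0) ((\<lambda>s. (mu s, nu lam mu s)) ` {s \<in> R. m s = c})" for c
  have T: "finite (T c)" "(0, 0) \<in> T c" for c using finR by (auto simp: T_def)
  have Tb: "b \<ge> 0" if "(a, b) \<in> T c" for a b c
    using that mk by (auto simp: T_def nu_def marking_def)
  \<comment> \<open>Both \<open>h c\<close> and \<open>l - h c l\<close> are monotone in l: these are the striped inequalities up to
    rounding within a residue class, which costs less than n. The pair (0, 0) keeps h nonnegative.\<close>
  define h where "h c l = Max ((\<lambda>(a, b). min a (l - b)) ` T c)" for c and l :: int
  have h_ge: "min a (l - b) \<le> h c l" if "(a, b) \<in> T c" for a b c l
    unfolding h_def using T(1) that by (intro Max_ge) force+
  have h_in: "\<exists>a b. (a, b) \<in> T c \<and> h c l = min a (l - b)" for c l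
  proof -
    have "h c l \<in> (\<lambda>(a, b). min a (l - b)) ` T c" unfolding h_def using T by (intro Max_in) auto
    then show ?thesis by auto
  qed
  have h_mono: "h c l \<le> h c l'" if "l \<le> l'" for c l l'
  proof -
    obtain a b where "(a, b) \<in> T c" "h c l = min a (l - b)" using h_in by blast
    then show ?thesis using h_ge[of a b c l'] that by linarith
  qed
  have h_lip: "l - h c l \<le> l' - h c l'" if "l \<le> l'" for c l l'
  proof -
    obtain a b where "(a, b) \<in> T c" "h c l' = min a (l' - b)" using h_in by blast
    then show ?thesis using h_ge[of a b c l] that by linarith
  qed
  have h_le: "h c l \<le> l" for c l using h_in[of c l] Tb by fastforce
  have h_0: "h c l \<ge> 0" if "l \<ge> 0" for c l using h_ge[OF T(2), of l c] that by simp
  define mu' where "mu' i = (GREATEST k. k \<le> h (m i) (int (lam i)) \<and> eps i + res (int (lam i) - k) = m i)" for i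
  have g1: "mu' i \<le> h (m i) (int (lam i))" "h (m i) (int (lam i)) < mu' i + int CARD('n)"
    "eps i + res (nu lam mu' i) = m i"
    and g2: "\<And>k. k \<le> h (m i) (int (lam i)) \<Longrightarrow> eps i + res (int (lam i) - k) = m i \<Longrightarrow> k \<le> mu' i" for i
    unfolding mu'_def nu_def using greatest_mark[where y = "h (m i) (int (lam i))" and c = "eps i" and L = "int (lam i)" and m = "m i"] by auto
  have mk': "marking lam mu'" unfolding marking_def using g1(1) h_le order_trans by blast
  have gs: "generalized_striped (lam, eps, mu')"
  proof -
    have "mu' i > - int CARD('n)" for i using g1(2)[of i] h_0[of "int (lam i)" "m i"] by linarith
    moreover have "mu' j < mu' i + int CARD('n) \<and> nu lam mu' j < nu lam mu' i + int CARD('n)"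
      if "i < j" "eps i + res (nu lam mu' i) = eps j + res (nu lam mu' j)" for i j
    proof -
      have "m i = m j" using that(2) g1(3) by metis
      moreover have "int (lam j) \<le> int (lam i)"
        using D(4) that(1) unfolding is_partition_def antimono_def by simp
      ultimately show ?thesis
        using g1(1,2)[of i] g1(1,2)[of j] h_mono[of "int (lam j)" "int (lam i)" "m i"]
          h_lip[of "int (lam j)" "int (lam i)" "m i"]
        unfolding nu_def by auto
    qed
    ultimately show ?thesis
      unfolding generalized_striped.simps marked_colored_partition.simps using D(3) mk' by blast
  qed
  have memT: "(mu s, nu lam mu s) \<in> T (m s)" if "lam s > 0" for s
    using that by (auto simp: T_def R_def)
  \<comment> \<open>Every row dominates itself.\<close>
  have up: "mu j \<le> mu' j" if "lam j > 0" for j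
  proof (rule g2)
    have "min (mu j) (int (lam j) - nu lam mu j) = mu j" unfolding nu_def by simp
    then show "mu j \<le> h (m j) (int (lam j))" using h_ge[OF memT[OF that], of "int (lam j)"] by metis
    show "eps j + res (int (lam j) - mu j) = m j" unfolding m_def nu_def ..
  qed
  have dom: "mu' j \<le> 0 \<or> mu' j = mu j \<or>
      (\<exists>s. lam s > 0 \<and> s \<noteq> j \<and> eps s + res (nu lam mu s) = eps j + res (nu lam mu j) \<and>
           mu' j \<le> mu s \<and> nu lam mu s \<le> nu lam mu' j)" if j: "lam j > 0" for j
  proof -
    obtain a b where ab: "(a, b) \<in> T (m j)" "h (m j) (int (lam j)) = min a (int (lam j) - b)"
      using h_in by blast
    have le: "mu' j \<le> a" "mu' j \<le> int (lam j) - b" using ab(2) g1(1)[of j] by auto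
    \<comment> \<open>The maximum comes from the pair (0, 0), and then the new mark is invisible, or
      from a row s; for s = j the row can only keep its mark.\<close>
    from ab(1) consider "a = 0" | s where "lam s > 0" "m s = m j" "a = mu s" "b = nu lam mu s"
      by (auto simp: T_def R_def)
    then show ?thesis
    proof cases
      case 1
      then show ?thesis using le by simp
    next
      case 2
      show ?thesis
      proof (cases "s = j")
        case True
        then show ?thesis using up[OF j] le 2 by simp
      next
        case False
        then show ?thesis using 2 le by (auto simp: m_def nu_def)
      qed
    qed
  qed
  have col: "eps i + res (nu lam mu' i) = eps i + res (nu lam mu i)" for i
    using g1(3)[of i] by (simp add: m_def)
  have "\<exists>w'. jordan_gens x lam eps w' \<and> marked_sum x lam (\<lambda>i. if i \<in> R then mu' i else mu i) w' = marked_sum x lam mu w"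
    by (rule raise_marks[OF J mk mk' col up dom finR]) (auto simp: R_def)
  moreover have "marked_sum x lam (\<lambda>i. if i \<in> R then mu' i else mu i) w' = marked_sum x lam mu' w'" for w'
    unfolding marked_sum_def R_def by (intro sum.cong) (auto simp: nu_def)
  ultimately obtain w' where "jordan_gens x lam eps w'" "marked_sum x lam mu' w' = marked_sum x lam mu w" by auto
  then show ?thesis using gs col by blast
qed


subsection \<open>Uniqueness of marks\<close>

lemma marked_sum_reindex:
  assumes "bij s"
  shows "marked_sum x (lam \<circ> s) (mu \<circ> s) (w \<circ> s) = marked_sum x lam mu w"
  unfolding marked_sum_def
  by (rule sum.reindex_bij_witness[where i = "inv_into UNIV s" and j = s])
    (use assms in \<open>auto simp: bij_is_inj bij_is_surj surj_f_inv_f nu_reindex\<close>)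

lemma marked_sum_color:
  assumes J: "jordan_gens x lam eps w" and mk: "marking lam mu" and m: "\<And>i. eps i + res (nu lam mu i) = m"
  shows "marked_sum x lam mu w \<in> V m"
  unfolding marked_sum_def
proof (rule subspace_sum[OF subspace_V])
  fix i
  have "nu lam mu i \<ge> 0" using mk by (simp add: nu_def marking_def)
  then show "(x ^^ nat (nu lam mu i)) (w i) \<in> V m"
    using nil_cone_funpow_color[OF jordan_gensD(1)[OF J] jordan_gensD(6)[OF J, of i], of "nat (nu lam mu i)"] m[of i]
    by simp
qed

lemma V_disjoint:
  assumes "v \<in> V c" "v \<in> V d" "v \<noteq> 0"
  shows "c = d"
  using homogeneous_part[of "{v}" "\<lambda>v. v" "\<lambda>_. c" d c] assms by (auto split: if_splits)

lemma coef_marked_sum: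
  assumes J: "jordan_gens x lam eps w" and mk: "marking lam mu" and jk: "(j, k) \<in> cells lam"
  shows "coef (chain x w) (cells lam) (marked_sum x lam mu w) (j, k) = (if int k = nu lam mu j then 1 else 0)"
proof -
  note D = jordan_gensD[OF J] and b = jordan_gens_basis[OF J]
  have nn: "nu lam mu i \<ge> 0" for i using mk by (simp add: nu_def marking_def)
  have "coef (chain x w) (cells lam) (marked_sum x lam mu w) (j, k) =
    (\<Sum>i | lam i > 0. coef (chain x w) (cells lam) ((x ^^ nat (nu lam mu i)) (w i)) (j, k))"
    unfolding marked_sum_def by (rule coef_sum[OF b])
  also have "\<dots> = (\<Sum>i | lam i > 0. if i = j then (if int k = nu lam mu j then 1 else 0) else 0)"
  proof (rule sum.cong[OF refl])
    fix i
    show "coef (chain x w) (cells lam) ((x ^^ nat (nu lam mu i)) (w i)) (j, k) =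
      (if i = j then (if int k = nu lam mu j then 1 else 0) else 0)"
    proof (cases "(i, nat (nu lam mu i)) \<in> cells lam")
      case True
      show ?thesis using coef_basis[OF b True, of "(j, k)"] nn[of j] by auto
    next
      case False
      then have "(x ^^ nat (nu lam mu i)) (w i) = 0" using chain_eq_0[OF J] by fastforce
      moreover have "\<not> (i = j \<and> int k = nu lam mu j)" using False jk by (metis nat_int)
      ultimately show ?thesis using coef_scale[OF b, of 0 0] by auto
    qed
  qed
  also have "\<dots> = (if int k = nu lam mu j then 1 else 0)"
    using finite_rows[OF D(4)] jk by (simp add: cells_def)
  finally show ?thesis .
qed

lemma marked_sum_eq_0_iff:
  assumes J: "jordan_gens x lam eps w" and mk: "marking lam mu"
  shows "marked_sum x lam mu w = 0 \<longleftrightarrow> (\<forall>i. mu i \<le> 0)"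
proof
  assume z: "marked_sum x lam mu w = 0"
  show "\<forall>i. mu i \<le> 0"
  proof (rule allI, rule ccontr)
    fix i assume i: "\<not> mu i \<le> 0"
    have ml: "mu i \<le> int (lam i)" using mk by (simp add: marking_def)
    have "(i, nat (nu lam mu i)) \<in> cells lam" using i ml by (auto simp: cells_def nu_def)
    from coef_marked_sum[OF J mk this] have "coef (chain x w) (cells lam) 0 (i, nat (nu lam mu i)) = 1"
      using ml z by (simp add: nu_def)
    then show False using coef_scale[OF jordan_gens_basis[OF J], of 0 0] by simp
  qed
next
  assume "\<forall>i. mu i \<le> 0"
  then have "marked_sum x lam mu w = marked_sum x lam (\<lambda>_. 0) w" by (intro marked_sum_cong[OF J]) simp
  also have "\<dots> = 0" unfolding marked_sum_def using jordan_gensD(7)[OF J] by (simp add: nu_def)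
  finally show "marked_sum x lam mu w = 0" .
qed

text \<open>
  An automorphism k commuting with x takes the second basis to the first. If the coefficient of
  \<open>k v\<close> at column \<open>mu' j\<close> of row j comes from the marked vector of row s, then
  \<open>mu' j \<le> mu s\<close> and \<open>nu lam mu s \<le> nu lam mu' j\<close>.
\<close>

lemma marks_le:
  assumes J: "jordan_gens x lam eps w" and J': "jordan_gens x lam eps w'"
    and mk: "marking lam mu" "marking lam mu'" and eq: "marked_sum x lam mu w = marked_sum x lam mu' w'"
    and st: "striped_marks lam eps mu"
    and col: "eps j + res (nu lam mu' j) = eps j + res (nu lam mu j)"
  shows "mu' j \<le> mu j"
proof -
  let ?n = "int CARD('n)"
  note D = jordan_gensD[OF J] and b = jordan_gens_basis[OF J]
  have "mu' j < mu j + ?n"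
  proof (cases "mu' j \<le> 0")
    case True
    then show ?thesis using st unfolding striped_marks_def by (smt (verit))
  next
    case False
    obtain k where k: "k \<in> K_group" "\<And>i. k (w' i) = w i" "\<And>v. k (x v) = x (k v)"
      using ex_transfer[OF J' J] by blast
    have lin: "Vector_Spaces.linear scale scale k" using k(1) by (simp add: K_group_def)
    have kp: "k ((x ^^ p) v) = (x ^^ p) (k v)" for p v by (induction p) (simp_all add: k(3))
    \<comment> \<open>The image of v under k is written in two ways: as the second marking on the
      first basis, and as the sum of the images of the first marked vectors.\<close>
    have "marked_sum x lam mu' w = k (marked_sum x lam mu' w')"
      unfolding marked_sum_def by (simp add: vp.linear_sum[OF lin] kp k(2))
    also have "\<dots> = (\<Sum>s | lam s > 0. (x ^^ nat (nu lam mu s)) (k (w s)))"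
      unfolding eq[symmetric] unfolding marked_sum_def by (simp add: vp.linear_sum[OF lin] kp)
    finally have g: "marked_sum x lam mu' w = (\<Sum>s | lam s > 0. (x ^^ nat (nu lam mu s)) (k (w s)))" .
    define r where "r = nat (nu lam mu' j)"
    have mk': "mu' j \<le> int (lam j)" "\<And>s. mu s \<le> int (lam s)" using mk by (auto simp: marking_def)
    have r: "int r = nu lam mu' j" "(j, r) \<in> cells lam"
      using False mk' by (auto simp: r_def nu_def cells_def)
    have "coef (chain x w) (cells lam) (marked_sum x lam mu' w) (j, r) \<noteq> 0"
      using coef_marked_sum[OF J mk(2) r(2)] r(1) by simp
    then obtain s where s: "coef (chain x w) (cells lam) ((x ^^ nat (nu lam mu s)) (k (w s))) (j, r) \<noteq> 0"
      unfolding g coef_sum[OF b] by (meson sum.not_neutral_contains_not_neutral)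
    \<comment> \<open>The summand lies in the image of \<open>x ^^ nat (nu lam mu s)\<close>, so in
      each row its coordinates start at that position.\<close>
    have 1: "nu lam mu s \<le> nu lam mu' j"
      using s coef_funpow[OF D(2) b D(7) r(2)] r(1) by (auto split: if_splits)
    have z: "(x ^^ lam s) (k (w s)) = 0"
      using kp[of "lam s" "w s"] D(7)[of s] vp.linear_0[OF lin] by simp
    have 2: "mu' j \<le> mu s"
    proof (rule ccontr)
      assume lt: "\<not> mu' j \<le> mu s"
      show False
      proof (cases "mu s \<le> 0")
        case True
        then have "(x ^^ nat (nu lam mu s)) (k (w s)) = 0"
          by (intro funpow_eq_0_mono[OF D(2) z]) (simp add: nu_def)
        then show False using s coef_scale[OF b, of 0 0] by simp
      next
        case False
        \<comment> \<open>The summand is killed by the power \<open>mu s\<close> of x, while a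
          coordinate in a column beyond \<open>mu s\<close> would survive it.\<close>
        let ?z = "(x ^^ nat (nu lam mu s)) (k (w s))" and ?p = "nat (mu s)"
        have "?p + nat (nu lam mu s) = lam s" using False mk'(2)[of s] by (simp add: nu_def)
        then have "(x ^^ ?p) ?z = 0" using z by (metis comp_apply funpow_add)
        moreover have "(j, r + ?p) \<in> cells lam"
          using lt False mk'(1) by (simp add: cells_def r_def nu_def)
        ultimately have "coef (chain x w) (cells lam) ?z (j, r) = coef (chain x w) (cells lam) 0 (j, r + ?p)"
          using coef_funpow[OF D(2) b D(7), of j "r + ?p" ?p ?z] by simp
        then show False using s coef_scale[OF b, of 0 0] by simp
      qed
    qed
    \<comment> \<open>The striped inequalities compare a shorter row with a longer one: the one for
      \<open>mu\<close> applies when row s is the shorter, the one for \<open>nu\<close> when row j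
      is.\<close>
    show ?thesis
    proof (cases "lam s \<le> lam j")
      case True
      then have "mu s < mu j + ?n" using st unfolding striped_marks_def by blast
      then show ?thesis using 2 by simp
    next
      case False
      then have "nu lam mu j < nu lam mu s + ?n" using st unfolding striped_marks_def by (meson linear)
      then show ?thesis using 1 by (simp add: nu_def)
    qed
  qed
  moreover have "(res (mu' j) :: 'n mod_ring) = res (mu j)"
  proof -
    have "(res (nu lam mu' j) :: 'n mod_ring) = res (nu lam mu j)" using col by simp
    then show ?thesis
      by (simp add: nu_def res_eq_iff mod_eq_dvd_iff) (simp add: dvd_diff_commute)
  qed
  ultimately show ?thesis using res_eq_imp_le by blast
qed

text \<open>Once the rows are aligned by the permutation between the two types, the color of the
  nonzero vector forces the same residue class on both marks of each row. Bounding each marking by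
  the other then gives equality, even for the marks of empty rows.\<close>

lemma striped_unique:
  assumes J: "jordan_gens x lam eps w" and J': "jordan_gens x lam' eps' w'"
    and st: "striped (lam, eps, mu)" and st': "striped (lam', eps', mu')"
    and eq: "marked_sum x lam mu w = marked_sum x lam' mu' w'" and nz: "marked_sum x lam mu w \<noteq> 0"
  shows "row_equivalent (lam, eps, mu) (lam', eps', mu')"
proof -
  obtain s where s: "lam' = lam" "bij s" "lam \<circ> s = lam" "eps' = eps \<circ> s"
    using jordan_type_unique[OF J J'] by blast
  have J2: "jordan_gens x lam eps' (w \<circ> s)"
    using jordan_gens_reindex[OF J s(2)] jordan_gensD(4)[OF J] s(3,4) by simp
  have eq2: "marked_sum x lam (mu \<circ> s) (w \<circ> s) = marked_sum x lam mu' w'"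
    using marked_sum_reindex[OF s(2), of x lam mu w] s(1,3) eq by simp
  have W: "striped_marks lam eps' (mu \<circ> s)" "striped_marks lam eps' mu'"
    using st st' striped_marks_reindex[of lam eps mu s] s unfolding striped_iff by auto
  have mk: "marking lam mu" "marking lam mu'" using st st' s(1) unfolding striped_iff by auto
  have mk2: "marking lam (mu \<circ> s)" using mk(1) s(3) unfolding marking_def by (metis comp_apply)
  have "marked_sum x lam (mu \<circ> s) (w \<circ> s) \<in> V (eps' 0 + res (nu lam (mu \<circ> s) 0))"
    by (rule marked_sum_color[OF J2 mk2]) (use W(1) in \<open>auto simp: striped_marks_def\<close>)
  moreover have "marked_sum x lam mu' w' \<in> V (eps' 0 + res (nu lam mu' 0))"
    by (rule marked_sum_color[OF J'[unfolded s(1)] mk(2)]) (use W(2) in \<open>auto simp: striped_marks_def\<close>)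
  ultimately have m: "eps' 0 + res (nu lam (mu \<circ> s) 0) = eps' 0 + res (nu lam mu' 0)"
    using V_disjoint eq2 eq nz s(1) by metis
  have col: "eps' j + res (nu lam mu' j) = eps' j + res (nu lam (mu \<circ> s) j)" for j
    using W m unfolding striped_marks_def by metis
  have "mu' = mu \<circ> s"
  proof
    fix j
    have "mu' j \<le> (mu \<circ> s) j"
      by (rule marks_le[OF J2 J'[unfolded s(1)] mk2 mk(2) eq2 W(1) col])
    moreover have "(mu \<circ> s) j \<le> mu' j"
      by (rule marks_le[OF J'[unfolded s(1)] J2 mk(2) mk2 eq2[symmetric] W(2) col[symmetric]])
    ultimately show "mu' j = (mu \<circ> s) j" by simp
  qed
  then show ?thesis using s by (auto simp: fun_eq_iff intro!: exI[of _ s])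
qed


subsection \<open>The map \<open>\<Psi>\<close>\<close>

lemma mcpsI: "jordan_gens x lam eps w \<Longrightarrow> marking lam mu \<Longrightarrow> (lam, eps, mu) \<in> mcps space_signature"
  using jordan_gensD(3,5) by (auto simp: mcps_def)

lemma mcpsD: "(lam, eps, mu) \<in> mcps f \<Longrightarrow> marking lam mu \<and> is_partition lam"
  by (auto simp: mcps_def colored_partition_def)

lemma Psi_respects: "Psi respects weak_rel space_signature"
proof (rule congruentI)
  fix P Q assume PQ: "(P, Q) \<in> weak_rel space_signature"
  obtain lam eps mu alpha beta gamma where eq: "P = (lam, eps, mu)" "Q = (alpha, beta, gamma)"
    by (metis prod_cases3)
  have mem: "P \<in> mcps space_signature" "Q \<in> mcps space_signature" using PQ by (auto simp: weak_rel_def)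
  obtain s where s: "bij s" "alpha = lam \<circ> s" "beta = eps \<circ> s"
    "\<And>i. gamma i > 0 \<or> mu (s i) > 0 \<Longrightarrow> gamma i = mu (s i)"
    using PQ by (auto simp: weak_rel_def eq)
  obtain x w where J: "jordan_gens x lam eps w" "Psi P = K_orbit (marked_sum x lam mu w, x)"
    using Psi_obtain mem(1) unfolding eq by blast
  have pa: "is_partition (lam \<circ> s)" "marking alpha gamma" using mcpsD mem(2) s(2) unfolding eq by auto
  have J': "jordan_gens x alpha beta (w \<circ> s)"
    using jordan_gens_reindex[OF J(1) s(1) pa(1)] s by simp
  have "marked_sum x alpha gamma (w \<circ> s) = marked_sum x alpha (mu \<circ> s) (w \<circ> s)"
  proof (rule marked_sum_cong[OF J'])
    show "gamma i = (mu \<circ> s) i \<or> gamma i \<le> 0 \<and> (mu \<circ> s) i \<le> 0" for i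
      using s(4)[of i] by (cases "gamma i > 0 \<or> mu (s i) > 0") auto
  qed
  also have "\<dots> = marked_sum x lam mu w" unfolding s(2) by (rule marked_sum_reindex[OF s(1)])
  finally show "Psi P = Psi Q"
    using Psi_eq[OF J' pa(2)] J(2) unfolding eq by simp
qed

lemma Psi_in_orbits: "Q \<in> mcps space_signature \<Longrightarrow> Psi Q \<in> K_orbits (UNIV \<times> nil_cone)"
proof -
  assume Q: "Q \<in> mcps space_signature"
  obtain lam eps mu where eq: "Q = (lam, eps, mu)" by (metis prod_cases3)
  obtain x w where "jordan_gens x lam eps w" "Psi Q = K_orbit (marked_sum x lam mu w, x)"
    using Psi_obtain Q unfolding eq by blast
  then show ?thesis using jordan_gensD(1) unfolding K_orbits_def by blast
qed

lemma ex_generalized_striped: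
  assumes Q: "Q \<in> mcps space_signature"
  shows "\<exists>Q'\<in>mcps space_signature. generalized_striped Q' \<and> Psi Q' = Psi Q"
proof -
  obtain lam eps mu where eq: "Q = (lam, eps, mu)" by (metis prod_cases3)
  obtain x w where J: "jordan_gens x lam eps w" "Psi Q = K_orbit (marked_sum x lam mu w, x)"
    using Psi_obtain Q unfolding eq by blast
  have mk: "marking lam mu" using mcpsD Q unfolding eq by blast
  obtain mu' w' where J': "jordan_gens x lam eps w'" "marked_sum x lam mu' w' = marked_sum x lam mu w"
    "generalized_striped (lam, eps, mu')"
    using generalized_striped_form[OF J(1) mk] by blast
  have mk': "marking lam mu'" using J'(3) by simp
  show ?thesis
    using mcpsI[OF J'(1) mk'] J'(3) Psi_eq[OF J'(1) mk'] J(2) J'(2) by metis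
qed

lemma striped_Psi_homogeneous:
  assumes Q: "Q \<in> mcps space_signature" "striped Q"
  shows "Psi Q \<in> K_orbits (homogeneous \<times> nil_cone)"
proof -
  obtain lam eps mu where eq: "Q = (lam, eps, mu)" by (metis prod_cases3)
  obtain x w where J: "jordan_gens x lam eps w" "Psi Q = K_orbit (marked_sum x lam mu w, x)"
    using Psi_obtain Q(1) unfolding eq by blast
  have "marked_sum x lam mu w \<in> V (eps 0 + res (nu lam mu 0))"
    by (rule marked_sum_color[OF J(1)]) (use Q(2) in \<open>auto simp: eq\<close>)
  then show ?thesis using J jordan_gensD(1)[OF J(1)] unfolding K_orbits_def homogeneous_def by blast
qed

text \<open>If all marked vectors have the same color, the condition on pairs in
  \<open>generalized_striped\<close> applies to every pair, so the form reached is striped.\<close>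

lemma homogeneous_ex_striped:
  assumes v: "v \<in> homogeneous" and x: "x \<in> nil_cone"
  shows "\<exists>Q\<in>mcps space_signature. striped Q \<and> Psi Q = K_orbit (v, x)"
proof -
  obtain m where m: "v \<in> V m" using v unfolding homogeneous_def by blast
  obtain lam eps w0 where J0: "jordan_gens x lam eps w0" using ex_jordan_type[OF x] by blast
  obtain w mu where J: "jordan_gens x lam eps w" "marking lam mu" "v = marked_sum x lam mu w"
    "\<And>i. eps i + res (nu lam mu i) = m" using homogeneous_normal[OF J0 m] by blast
  obtain mu' w' where J': "jordan_gens x lam eps w'" "marked_sum x lam mu' w' = v"
    "generalized_striped (lam, eps, mu')" "\<And>i. eps i + res (nu lam mu' i) = m"
    using generalized_striped_form[OF J(1,2)] J(3,4) by metis
  have mk: "marking lam mu'" using J'(3) by simp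
  have "striped (lam, eps, mu')"
    using J'(3,4) unfolding striped.simps generalized_striped.simps by metis
  then show ?thesis using mcpsI[OF J'(1) mk] Psi_eq[OF J'(1) mk] J'(2) by blast
qed

lemma striped_row_equivalent:
  assumes Q: "Q \<in> mcps space_signature" "striped Q" "Psi Q = K_orbit (v, x)"
    and Q': "Q' \<in> mcps space_signature" "striped Q'" "Psi Q' = K_orbit (v, x)" and v: "v \<noteq> 0"
  shows "row_equivalent Q Q'"
proof -
  obtain lam eps mu lam' eps' mu' where eq: "Q = (lam, eps, mu)" "Q' = (lam', eps', mu')"
    by (metis prod_cases3)
  obtain w where w: "jordan_gens x lam eps w" "v = marked_sum x lam mu w"
    using Psi_eq_orbitD Q(1,3) unfolding eq by blast
  obtain w' where w': "jordan_gens x lam' eps' w'" "v = marked_sum x lam' mu' w'"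
    using Psi_eq_orbitD Q'(1,3) unfolding eq by blast
  show ?thesis unfolding eq
    using striped_unique[OF w(1) w'(1)] Q(2) Q'(2) w(2) w'(2) v unfolding eq by metis
qed

lemma striped_Psi_eq_imp_weakly_equivalent:
  assumes Q: "Q \<in> mcps space_signature" "striped Q"
    and Q': "Q' \<in> mcps space_signature" "striped Q'" and PQ: "Psi Q = Psi Q'"
  shows "weakly_equivalent Q Q'"
proof -
  obtain lam eps mu lam' eps' mu' where eq: "Q = (lam, eps, mu)" "Q' = (lam', eps', mu')"
    by (metis prod_cases3)
  obtain x w where w: "jordan_gens x lam eps w" "Psi Q = K_orbit (marked_sum x lam mu w, x)"
    using Psi_obtain Q(1) unfolding eq by blast
  show ?thesis
  proof (cases "marked_sum x lam mu w = 0")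
    case False
    then show ?thesis
      using striped_row_equivalent[OF Q w(2) Q'] PQ w(2) row_equivalent_imp_weakly_equivalent by metis
  next
    case True
    obtain w' where w': "jordan_gens x lam' eps' w'" "marked_sum x lam mu w = marked_sum x lam' mu' w'"
      using Psi_eq_orbitD Q'(1) PQ w(2) unfolding eq by metis
    \<comment> \<open>Only nonpositive marks describe the zero vector, and weak equivalence ignores
      their values; matching row colors is enough.\<close>
    have "\<forall>i. mu i \<le> 0" "\<forall>i. mu' i \<le> 0"
      using marked_sum_eq_0_iff[OF w(1)] marked_sum_eq_0_iff[OF w'(1)] True w'(2) mcpsD Q(1) Q'(1) unfolding eq by metis+
    then have np: "\<not> mu i > 0" "\<not> mu' i > 0" for i by (simp_all add: not_less)
    obtain s where "lam' = lam" "bij s" "lam \<circ> s = lam" "eps' = eps \<circ> s"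
      using jordan_type_unique[OF w(1) w'(1)] by blast
    then show ?thesis unfolding eq using np by (auto intro!: exI[of _ s])
  qed
qed

lemma Psi_induced_eq:
  assumes C: "C \<in> mcps space_signature // weak_rel space_signature" and Q: "Q \<in> C"
  shows "Psi_induced C = Psi Q" "Q \<in> mcps space_signature"
    "C = weak_rel space_signature `` {Q}"
proof -
  note e = equiv_weak_rel[of space_signature]
  show Qm: "Q \<in> mcps space_signature" using in_quotient_imp_subset[OF e C] Q by blast
  obtain P where P: "C = weak_rel space_signature `` {P}" using C by (rule quotientE)
  then have "(P, Q) \<in> weak_rel space_signature" using Q by blast
  then show CQ: "C = weak_rel space_signature `` {Q}"
    unfolding P by (rule equiv_class_eq[OF e])
  have "Psi ` C = {Psi Q}"
  proof -
    have "Psi P = Psi Q" if "P \<in> C" for P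
      using that Psi_respects unfolding CQ congruent_def by auto
    then show ?thesis using Q by blast
  qed
  then show "Psi_induced C = Psi Q" unfolding Psi_induced_def by simp
qed

text \<open>Striped representatives of one class need not agree, so injectivity is reduced to weak
  equivalence of arbitrary striped representatives with the same orbit.\<close>

lemma Psi_induced_bij:
  "bij_betw Psi_induced (striped_classes space_signature) (K_orbits (homogeneous \<times> nil_cone))"
  unfolding bij_betw_def
proof
  note e = equiv_weak_rel[of space_signature]
  show "inj_on Psi_induced (striped_classes space_signature)"
  proof (rule inj_onI)
    fix C D assume CD: "C \<in> striped_classes space_signature" "D \<in> striped_classes space_signature"
      "Psi_induced C = Psi_induced D"
    obtain Q where Q: "C \<in> mcps space_signature // weak_rel space_signature" "Q \<in> C" "striped Q"
      using CD(1) unfolding striped_classes_def by blast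
    obtain R where R: "D \<in> mcps space_signature // weak_rel space_signature" "R \<in> D" "striped R"
      using CD(2) unfolding striped_classes_def by blast
    note Qe = Psi_induced_eq[OF Q(1,2)] and Re = Psi_induced_eq[OF R(1,2)]
    have "weakly_equivalent Q R"
      using striped_Psi_eq_imp_weakly_equivalent[OF Qe(2) Q(3) Re(2) R(3)] Qe(1) Re(1) CD(3) by simp
    then have "(Q, R) \<in> weak_rel space_signature" using Qe(2) Re(2) by (simp add: weak_rel_def)
    then show "C = D" using Qe(3) Re(3) equiv_class_eq[OF e] by metis
  qed
  show "Psi_induced ` striped_classes space_signature = K_orbits (homogeneous \<times> nil_cone)"
  proof
    show "Psi_induced ` striped_classes space_signature \<subseteq> K_orbits (homogeneous \<times> nil_cone)"
    proof (rule image_subsetI)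
      fix C assume "C \<in> striped_classes space_signature"
      then obtain Q where Q: "C \<in> mcps space_signature // weak_rel space_signature" "Q \<in> C" "striped Q"
        unfolding striped_classes_def by blast
      then show "Psi_induced C \<in> K_orbits (homogeneous \<times> nil_cone)"
        using Psi_induced_eq(1,2)[OF Q(1,2)] striped_Psi_homogeneous by simp
    qed
    show "K_orbits (homogeneous \<times> nil_cone) \<subseteq> Psi_induced ` striped_classes space_signature"
    proof
      fix O' assume "O' \<in> K_orbits (homogeneous \<times> nil_cone)"
      then obtain v x where "v \<in> homogeneous" "x \<in> nil_cone" "O' = K_orbit (v, x)"
        unfolding K_orbits_def by blast
      then obtain Q where Q: "Q \<in> mcps space_signature" "striped Q" "Psi Q = O'"
        using homogeneous_ex_striped by blast
      let ?C = "weak_rel space_signature `` {Q}"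
      have C: "?C \<in> mcps space_signature // weak_rel space_signature" using Q(1) by (rule quotientI)
      have QC: "Q \<in> ?C" using equiv_class_self[OF e Q(1)] .
      then have "?C \<in> striped_classes space_signature" using C Q(2) unfolding striped_classes_def by blast
      then show "O' \<in> Psi_induced ` striped_classes space_signature"
        using Psi_induced_eq(1)[OF C QC] Q(3) by (metis image_eqI)
    qed
  qed
qed

section \<open>Normal bases and the zero vector\<close>

lemma normal_basis_iff:
  assumes x: "x \<in> nil_cone"
  shows "(\<exists>b. normal_basis (v, x) b) \<longleftrightarrow>
    (\<exists>lam eps mu w. jordan_gens x lam eps w \<and> generalized_striped (lam, eps, mu) \<and> v = marked_sum x lam mu w)"
proof
  assume "\<exists>b. normal_basis (v, x) b"
  then show "\<exists>lam eps mu w. jordan_gens x lam eps w \<and> generalized_striped (lam, eps, mu) \<and> v = marked_sum x lam mu w"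
    unfolding normal_basis_def using jordan_basis_imp_gens[OF x] by (metis fst_conv snd_conv)
next
  assume "\<exists>lam eps mu w. jordan_gens x lam eps w \<and> generalized_striped (lam, eps, mu) \<and> v = marked_sum x lam mu w"
  then obtain lam eps mu w where J: "jordan_gens x lam eps w" "generalized_striped (lam, eps, mu)" "v = marked_sum x lam mu w"
    by blast
  have mk: "marking lam mu" using J(2) by simp
  show "\<exists>b. normal_basis (v, x) b"
    unfolding normal_basis_def fst_conv snd_conv
    using J(2,3) mk jordan_gens_imp_basis(1)[OF J(1)] jordan_gens_imp_basis(2)[OF J(1) mk, symmetric]
    by (intro exI[of _ "\<lambda>i j. (x ^^ nat (int (lam i) - j)) (w i)"]
        exI[of _ lam] exI[of _ eps] exI[of _ mu]) simp
qed

lemma Psi_image: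
  "Psi ` mcps space_signature = {O' \<in> K_orbits (UNIV \<times> nil_cone). \<forall>p\<in>O'. \<exists>b. normal_basis p b}"
proof (intro subset_antisym subsetI)
  fix O' assume "O' \<in> Psi ` mcps space_signature"
  then obtain Q where Q: "Q \<in> mcps space_signature" "generalized_striped Q" "Psi Q = O'"
    using ex_generalized_striped by blast
  obtain lam eps mu where eq: "Q = (lam, eps, mu)" by (metis prod_cases3)
  have "\<exists>b. normal_basis p b" if "p \<in> O'" for p
  proof -
    obtain v x where p: "p = (v, x)" by (cases p)
    have "Psi (lam, eps, mu) = K_orbit (v, x)"
    proof -
      obtain y u where "Psi Q = K_orbit (u, y)" using Psi_obtain Q(1) unfolding eq by blast
      then show ?thesis using K_orbit_eq_mem that Q(3) unfolding p eq by metis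
    qed
    then obtain w where w: "jordan_gens x lam eps w" "v = marked_sum x lam mu w"
      using Psi_eq_orbitD Q(1) unfolding eq by blast
    then show ?thesis unfolding p using normal_basis_iff[OF jordan_gensD(1)[OF w(1)]] Q(2) unfolding eq by blast
  qed
  then show "O' \<in> {O' \<in> K_orbits (UNIV \<times> nil_cone). \<forall>p\<in>O'. \<exists>b. normal_basis p b}"
    using Psi_in_orbits Q by blast
next
  fix O' assume O': "O' \<in> {O' \<in> K_orbits (UNIV \<times> nil_cone). \<forall>p\<in>O'. \<exists>b. normal_basis p b}"
  then obtain v x where vx: "O' = K_orbit (v, x)" "x \<in> nil_cone" unfolding K_orbits_def by auto
  have "\<exists>b. normal_basis (v, x) b" using O' vx K_orbit_self by blast
  then obtain lam eps mu w where J: "jordan_gens x lam eps w" "generalized_striped (lam, eps, mu)" "v = marked_sum x lam mu w"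
    using normal_basis_iff[OF vx(2)] by blast
  have mk: "marking lam mu" using J(2) by simp
  show "O' \<in> Psi ` mcps space_signature"
    using mcpsI[OF J(1) mk] Psi_eq[OF J(1) mk] J(3) vx(1) by (metis image_eqI)
qed

text \<open>The zero vector forces marks \<le> 0, and a mark in (-n, 0] is determined by its residue
  class, so a color m leaves a single marking. Since v does not determine the color, every m
  occurs.\<close>

lemma striped_zero_fibre:
  assumes x: "x \<in> nil_cone" and ty: "colored_jordan_type x lam eps"
  shows "{Q \<in> mcps space_signature. striped Q \<and> Psi Q = K_orbit (0, x)} =
    {Q. \<exists>m. row_equivalent (rho m (lam, eps, \<lambda>_. 0)) Q}"
proof -
  let ?n = "int CARD('n)"
  obtain b where "colored_jordan_basis x lam eps b" using ty unfolding colored_jordan_type_def by blast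
  then obtain w where J: "jordan_gens x lam eps w" using jordan_basis_imp_gens(1)[OF x] by blast
  define d where "d m i = (GREATEST k. k \<le> (0::int) \<and> eps i + res (int (lam i) - k) = m)" for m i
  have d: "d m i \<le> 0" "- ?n < d m i" "eps i + res (nu lam (d m) i) = m"
    and d_max: "\<And>k. k \<le> 0 \<Longrightarrow> eps i + res (int (lam i) - k) = m \<Longrightarrow> k \<le> d m i" for m i
    unfolding d_def nu_def using greatest_mark[where y = 0 and c = "eps i" and L = "int (lam i)" and m = m] by auto
  have rho: "rho m (lam, eps, \<lambda>_. 0) = (lam, eps, d m)" for m
    by (simp add: d_def fun_eq_iff)
  show ?thesis
  proof (intro subset_antisym subsetI)
    fix Q assume "Q \<in> {Q \<in> mcps space_signature. striped Q \<and> Psi Q = K_orbit (0, x)}"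
    then have Q: "Q \<in> mcps space_signature" "striped Q" "Psi Q = K_orbit (0, x)" by auto
    obtain lam' eps' mu' where eq: "Q = (lam', eps', mu')" by (metis prod_cases3)
    obtain w' where w': "jordan_gens x lam' eps' w'" "0 = marked_sum x lam' mu' w'"
      using Psi_eq_orbitD Q(1,3) unfolding eq by blast
    obtain s where s: "lam' = lam" "bij s" "lam \<circ> s = lam" "eps' = eps \<circ> s"
      using jordan_type_unique[OF J w'(1)] by blast
    have ls: "lam (s i) = lam i" for i using s(3) by (metis comp_apply)
    have np: "mu' i \<le> 0" for i
      using marked_sum_eq_0_iff[OF w'(1)] w'(2) mcpsD Q(1) unfolding eq by metis
    define m where "m = eps' 0 + res (nu lam mu' 0)"
    have st: "mu' i > - ?n" "eps' i + res (nu lam mu' i) = m" for i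
      using Q(2) unfolding eq s(1) m_def striped.simps by blast+
    have "mu' i = d m (s i)" for i
    proof (rule antisym)
      have col: "eps (s i) + res (int (lam (s i)) - mu' i) = m"
        using st(2)[of i] by (simp add: s(4) nu_def ls)
      show "mu' i \<le> d m (s i)" by (rule d_max[OF np col])
      have "(res (nu lam (d m) (s i)) :: 'n mod_ring) = res (int (lam (s i)) - mu' i)"
        using col d(3)[of "s i" m] by (metis add_left_cancel)
      then have "(res (d m (s i)) :: 'n mod_ring) = res (mu' i)"
        by (simp add: nu_def res_eq_iff mod_eq_dvd_iff) (simp add: dvd_diff_commute)
      moreover have "d m (s i) < mu' i + ?n" using d(1)[of m "s i"] st(1)[of i] by linarith
      ultimately show "d m (s i) \<le> mu' i" by (rule res_eq_imp_le)
    qed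
    then have "row_equivalent (lam, eps, d m) Q"
      unfolding eq using s ls by (auto simp: fun_eq_iff intro!: exI[of _ s])
    then show "Q \<in> {Q. \<exists>m. row_equivalent (rho m (lam, eps, \<lambda>_. 0)) Q}" unfolding rho by blast
  next
    fix Q assume "Q \<in> {Q. \<exists>m. row_equivalent (rho m (lam, eps, \<lambda>_. 0)) Q}"
    then obtain m where m: "row_equivalent (lam, eps, d m) Q" unfolding rho by blast
    obtain lam' eps' mu' where eq: "Q = (lam', eps', mu')" by (metis prod_cases3)
    obtain s where s: "bij s" "\<And>i. lam (s i) = lam i" "lam' = lam" "eps' = eps \<circ> s" "mu' = d m \<circ> s"
      using m unfolding eq by auto
    have ls: "lam \<circ> s = lam" using s(2) by auto
    have mk: "marking lam (d m)" unfolding marking_def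
      using d(1)[of m] by (meson of_nat_0_le_iff order_trans)
    \<comment> \<open>Two numbers in (-n, 0] differ by less than n; together with
      \<open>lam j \<le> lam i\<close> this gives the inequality for \<open>nu\<close>.\<close>
    have ws: "striped_marks lam eps (d m)"
    proof -
      have lt: "d m j < d m i + ?n" for i j using d(1)[of m j] d(2)[of m i] by linarith
      have "nu lam (d m) j < nu lam (d m) i + ?n" if "lam j \<le> lam i" for i j
        using lt[of i j] that unfolding nu_def by linarith
      moreover have "eps i + res (nu lam (d m) i) = eps j + res (nu lam (d m) j)" for i j
        by (simp only: d(3))
      ultimately show ?thesis unfolding striped_marks_def using lt d(2) by blast
    qed
    have J': "jordan_gens x lam eps' (w \<circ> s)"
      using jordan_gens_reindex[OF J s(1)] jordan_gensD(4)[OF J] ls s(4) by simp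
    have mk': "marking lam mu'" using d(1) unfolding marking_def s(5)
      by (metis comp_apply of_nat_0_le_iff order_trans)
    have "striped Q" unfolding eq striped_iff s(3)
      using striped_marks_reindex[OF ws, of s] ls s(4,5) jordan_gensD(3)[OF J'] mk' by simp
    moreover have "marked_sum x lam mu' (w \<circ> s) = 0"
      using marked_sum_eq_0_iff[OF J' mk'] d(1) s(5) by simp
    then have "Psi Q = K_orbit (0, x)" using Psi_eq[OF J' mk'] unfolding eq s(3) by simp
    moreover have "Q \<in> mcps space_signature" using mcpsI[OF J' mk'] unfolding eq s(3) .
    ultimately show "Q \<in> {Q \<in> mcps space_signature. striped Q \<and> Psi Q = K_orbit (0, x)}" by blast
  qed
qed

end


theorem theorem4p12:
  fixes scale :: "'f::field \<Rightarrow> 'v::ab_group_add \<Rightarrow> 'v"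
    and V :: "'n::finite mod_ring \<Rightarrow> 'v set"
  assumes "colored_space scale V"
  defines "\<xi> \<equiv> colored_space.space_signature scale V"
    and "\<N> \<equiv> colored_space.nil_cone scale V"
    and "V' \<equiv> colored_space.homogeneous V"
    and "orbit \<equiv> colored_space.K_orbit scale V"
    and "orbits \<equiv> colored_space.K_orbits scale V"
    and "\<Psi> \<equiv> colored_space.Psi scale V"
  shows
    \<comment> \<open>1\<close>
    "(\<Psi> ` mcps \<xi> =
        {\<O> \<in> orbits (UNIV \<times> \<N>). \<forall>p \<in> \<O>. \<exists>b. colored_space.normal_basis scale V p b} \<and>
      (\<forall>\<O>. {Q \<in> mcps \<xi>. \<Psi> Q = \<O>} \<noteq> {} \<longrightarrow>
            (\<exists>Q \<in> {Q \<in> mcps \<xi>. \<Psi> Q = \<O>}. generalized_striped Q))) \<and>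
    \<comment> \<open>2\<close>
     (\<Psi> respects weak_rel \<xi> \<and>
      bij_betw (colored_space.Psi_induced scale V) (striped_classes \<xi>) (orbits (V' \<times> \<N>))) \<and>
    \<comment> \<open>2a\<close>
     (\<forall>\<O> \<in> orbits (UNIV \<times> \<N>).
        \<O> \<in> orbits (V' \<times> \<N>) \<longleftrightarrow> (\<exists>Q \<in> mcps \<xi>. striped Q \<and> \<Psi> Q = \<O>)) \<and>
    \<comment> \<open>2b\<close>
     (\<forall>v \<in> V'. \<forall>x \<in> \<N>. v \<noteq> 0 \<longrightarrow>
        (\<forall>Q \<in> mcps \<xi>. \<forall>Q' \<in> mcps \<xi>.
           striped Q \<and> \<Psi> Q = orbit (v, x) \<and> striped Q' \<and> \<Psi> Q' = orbit (v, x) \<longrightarrow>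
           row_equivalent Q Q')) \<and>
    \<comment> \<open>2c\<close>
     (\<forall>x \<in> \<N>. \<forall>lam eps. colored_space.colored_jordan_type scale V x lam eps \<longrightarrow>
        {Q \<in> mcps \<xi>. striped Q \<and> \<Psi> Q = orbit (0, x)} =
        {Q. \<exists>m. row_equivalent (rho m (lam, eps, \<lambda>_. 0)) Q})"
proof -
  interpret colored_space scale V by fact
  note defs = \<xi>_def \<N>_def V'_def orbit_def orbits_def \<Psi>_def
  show ?thesis unfolding defs
  proof (intro conjI)
    show "Psi ` mcps space_signature =
        {\<O> \<in> K_orbits (UNIV \<times> nil_cone). \<forall>p\<in>\<O>. \<exists>b. normal_basis p b}"
      by (rule Psi_image)
    show "\<forall>\<O>. {Q \<in> mcps space_signature. Psi Q = \<O>} \<noteq> {} \<longrightarrow>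
        (\<exists>Q\<in>{Q \<in> mcps space_signature. Psi Q = \<O>}. generalized_striped Q)"
    proof (intro allI impI)
      fix \<O> assume "{Q \<in> mcps space_signature. Psi Q = \<O>} \<noteq> {}"
      then obtain Q where "Q \<in> mcps space_signature" "Psi Q = \<O>" by blast
      then show "\<exists>Q\<in>{Q \<in> mcps space_signature. Psi Q = \<O>}. generalized_striped Q"
        using ex_generalized_striped[of Q] by blast
    qed
    show "Psi respects weak_rel space_signature" by (rule Psi_respects)
    show "bij_betw Psi_induced (striped_classes space_signature) (K_orbits (homogeneous \<times> nil_cone))"
      by (rule Psi_induced_bij)
    show "\<forall>\<O>\<in>K_orbits (UNIV \<times> nil_cone). \<O> \<in> K_orbits (homogeneous \<times> nil_cone) \<longleftrightarrow>
        (\<exists>Q\<in>mcps space_signature. striped Q \<and> Psi Q = \<O>)"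
    proof
      fix \<O>
      show "\<O> \<in> K_orbits (homogeneous \<times> nil_cone) \<longleftrightarrow>
          (\<exists>Q\<in>mcps space_signature. striped Q \<and> Psi Q = \<O>)"
      proof
        assume "\<O> \<in> K_orbits (homogeneous \<times> nil_cone)"
        then obtain v x where "v \<in> homogeneous" "x \<in> nil_cone" "\<O> = K_orbit (v, x)"
          unfolding K_orbits_def by blast
        then show "\<exists>Q\<in>mcps space_signature. striped Q \<and> Psi Q = \<O>"
          using homogeneous_ex_striped by simp
      qed (use striped_Psi_homogeneous in blast)
    qed
    show "\<forall>v\<in>homogeneous. \<forall>x\<in>nil_cone. v \<noteq> 0 \<longrightarrow>
        (\<forall>Q\<in>mcps space_signature. \<forall>Q'\<in>mcps space_signature.
          striped Q \<and> Psi Q = K_orbit (v, x) \<and> striped Q' \<and> Psi Q' = K_orbit (v, x) \<longrightarrow>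
          row_equivalent Q Q')"
      using striped_row_equivalent by blast
    show "\<forall>x\<in>nil_cone. \<forall>lam eps. colored_jordan_type x lam eps \<longrightarrow>
        {Q \<in> mcps space_signature. striped Q \<and> Psi Q = K_orbit (0, x)} =
        {Q. \<exists>m. row_equivalent (rho m (lam, eps, \<lambda>_. 0)) Q}"
      using striped_zero_fibre by blast
  qed
qed

end
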